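(* Let $k\ge1$ and $n$ be positive integers. If $[n]^{*k+1}$ embeds into a $2k$-manifold $M$, then there is an $(n,k)$-matrix of rank (over $\mathbb{Z}_2$) at most $\beta_k(M)$.
   Context: $[n]=\{1,\dots,n\}$. $[n]^{*k+1}$ is the $k$-dimensional simplicial complex with vertex set $[k+1]\times[n]$ whose $k$-faces are spanned by $(1,a_1),\dots,(k+1,a_{k+1})$ for arbitrary $a_i\in[n]$. Manifolds are PL (possibly with boundary), embeddings are PL, $\beta_k(M)=\dim H_k(M;\mathbb{Z}_2)$. A $k$-octahedron is determined by 2-element subsets $P_1,\dots,P_{k+1}\subset[n]$: it is the set $P=P_1*\dots*P_{k+1}$ of all $k$-faces of $[n]^{*k+1}$ spanned by $(1,a_1),\dots,(k+1,a_{k+1})$ with $a_i\in P_i$ (the $k$-faces of a subcomplex isomorphic to the boundary of the $(k+1)$-dimensional cross-polytope, a $k$-sphere). Two $k$-octahedra $P,Q$ are vertex-disjoint if $P_i\cap Q_i=\emptyset$ for all $i$. $\oplus$ denotes symmetric difference (mod 2 sum) of sets of $k$-faces. An $(n,k)$-matrix is a square matrix $A$ with entries in $\mathbb{Z}_2$, whose rows and columns are indexed by all $k$-octahedra of $[n]^{*k+1}$, such that: (symmetric) $A_{P,Q}=A_{Q,P}$; (independent) $A_{P,Q}=0$ whenever $P,Q$ are vertex-disjoint; (additive) $A_{P,Q}=A_{X,Q}+A_{Y,Q}$ whenever $P=X\oplus Y$ for $k$-octahedra $X,Y$; (non-trivial) $SA=1$, where $SA$ is the sum of $A_{P,Q}$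 over all unordered pairs $\{P,Q\}$ of $k$-octahedra with $P_i,Q_i\subset[3]$ for all $i$ and $P_i\cap Q_i=\{1\}$ for all $i\in[k+1]$ (i.e. $P\cap Q$ is the single face spanned by $(1,1),\dots,(k+1,1)$).
   Formalization: The formal statement assumes n ≥ 3 instead of n ≥ 1: for n = 1, 2 the sum SA is empty, so no (n,k)-matrix exists, although [n]^{*k+1} (a k-simplex or k-sphere) embeds into every nonempty 2k-manifold. *)

theory Defs
  imports
    "HOL-Analysis.Analysis"
    "HOL-Homology.Homology"
    "HOL-Library.Z2"
    "HOL-Library.Function_Algebras"
    "HOL-Library.Extended_Nat"
begin

section \<open>Piecewise linear topology\<close>

text \<open>Polyhedra, PL maps and PL manifolds are subsets of (maps between) Euclidean spaces, following
  Rourke and Sanderson, \<^emph>\<open>Introduction to Piecewise-Linear Topology\<close>, Chapter 1. No compactness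
  or closedness in the ambient space is required.\<close>

definition cone_over :: "'a::euclidean_space \<Rightarrow> 'a set \<Rightarrow> 'a set" where
  "cone_over a L = insert a (\<Union>x\<in>L. closed_segment a x)"

text \<open>\<open>cone_over a L\<close> is a cone neighbourhood (a star) of \<open>a\<close> in \<open>P\<close>, with link \<open>L\<close>.\<close>

definition star_in :: "'a::euclidean_space set \<Rightarrow> 'a \<Rightarrow> 'a set \<Rightarrow> bool" where
  "star_in P a L \<longleftrightarrow>
     compact L \<and> a \<notin> L \<and>
     pairwise (\<lambda>x y. closed_segment a x \<inter> closed_segment a y = {a}) L \<and>
     cone_over a L \<subseteq> P \<and>
     (\<exists>U. openin (top_of_set P) U \<and> a \<in> U \<and> U \<subseteq> cone_over a L)"

definition pl_polyhedron :: "'a::euclidean_space set \<Rightarrow> bool" where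
  "pl_polyhedron P \<longleftrightarrow> (\<forall>a\<in>P. \<exists>L. star_in P a L)"

definition pl_map :: "('a::euclidean_space \<Rightarrow> 'b::euclidean_space) \<Rightarrow> 'a set \<Rightarrow> 'b set \<Rightarrow> bool" where
  "pl_map f P Q \<longleftrightarrow>
     pl_polyhedron P \<and> pl_polyhedron Q \<and> continuous_on P f \<and> f ` P \<subseteq> Q \<and>
     (\<forall>a\<in>P. \<exists>L. star_in P a L \<and>
        (\<forall>x\<in>L. \<forall>t\<in>{0..1}. f ((1 - t) *\<^sub>R a + t *\<^sub>R x) = (1 - t) *\<^sub>R f a + t *\<^sub>R f x))"

definition pl_homeomorphic :: "'a::euclidean_space set \<Rightarrow> 'b::euclidean_space set \<Rightarrow> bool" where
  "pl_homeomorphic P Q \<longleftrightarrow> (\<exists>f g. homeomorphism P Q f g \<and> pl_map f P Q \<and> pl_map g Q P)"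

definition pl_embedding :: "('a::euclidean_space \<Rightarrow> 'b::euclidean_space) \<Rightarrow> 'a set \<Rightarrow> 'b set \<Rightarrow> bool" where
  "pl_embedding f P Q \<longleftrightarrow>
     pl_map f P Q \<and> (\<exists>g. homeomorphism P (f ` P) f g \<and> pl_map g (f ` P) P)"

text \<open>Every point has a neighbourhood that is a PL \<open>m\<close>-ball; boundary points are allowed.\<close>

definition pl_manifold :: "nat \<Rightarrow> 'a::euclidean_space set \<Rightarrow> bool" where
  "pl_manifold m M \<longleftrightarrow>
     pl_polyhedron M \<and>
     (\<forall>x\<in>M. \<exists>U N. \<exists>S :: 'a set.
        openin (top_of_set M) U \<and> x \<in> U \<and> U \<subseteq> N \<and> N \<subseteq> M \<and>
        (int m) simplex S \<and> pl_homeomorphic N S)"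


section \<open>Geometric realizations and the complex $[n]^{*k+1}$\<close>

text \<open>An abstract complex is the set of its nonempty faces.\<close>

definition geometric_realization :: "'v set set \<Rightarrow> ('v \<Rightarrow> 'a::euclidean_space) \<Rightarrow> bool" where
  "geometric_realization K v \<longleftrightarrow>
     inj_on v (\<Union>K) \<and>
     (\<forall>\<sigma>\<in>K. \<not> affine_dependent (v ` \<sigma>)) \<and>
     (\<forall>\<sigma>\<in>K. \<forall>\<tau>\<in>K. convex hull (v ` \<sigma>) \<inter> convex hull (v ` \<tau>) = convex hull (v ` (\<sigma> \<inter> \<tau>)))"

definition body :: "'v set set \<Rightarrow> ('v \<Rightarrow> 'a::euclidean_space) \<Rightarrow> 'a set" where
  "body K v = (\<Union>\<sigma>\<in>K. convex hull (v ` \<sigma>))"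

definition k_faces :: "nat \<Rightarrow> nat \<Rightarrow> (nat \<times> nat) set set" where
  "k_faces n k = {(\<lambda>i. (i, a i)) ` {1..k+1} | a. \<forall>i\<in>{1..k+1}. a i \<in> {1..n}}"

definition join_power :: "nat \<Rightarrow> nat \<Rightarrow> (nat \<times> nat) set set" where
  "join_power n k = {\<sigma>. \<sigma> \<noteq> {} \<and> (\<exists>\<tau>\<in>k_faces n k. \<sigma> \<subseteq> \<tau>)}"


section \<open>Mod 2 Betti numbers\<close>

text \<open>Singular homology with coefficients in $\mathbb{Z}_2$. The chain complex
  $C_*(X) \otimes \mathbb{Z}_2$ is $C_*(X)/2C_*(X)$, whose cycles and boundaries are represented here by
  integral chains: cycles are chains with even boundary, and boundaries are taken up to even chains.\<close>

definition mod2_cycles :: "nat \<Rightarrow> 'a topology \<Rightarrow> 'a chain set" where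
  "mod2_cycles p X = {c. singular_chain p X c \<and> (\<exists>e. chain_boundary p c = frag_cmul 2 e)}"

definition mod2_boundaries :: "nat \<Rightarrow> 'a topology \<Rightarrow> 'a chain set" where
  "mod2_boundaries p X =
     {chain_boundary (Suc p) d + frag_cmul 2 e | d e. singular_chain (Suc p) X d \<and> singular_chain p X e}"

definition mod2_homology_group :: "nat \<Rightarrow> 'a topology \<Rightarrow> 'a chain set monoid" where
  "mod2_homology_group p X =
     subgroup_generated (chain_group p X) (mod2_cycles p X) Mod mod2_boundaries p X"

text \<open>The dimension of an abelian group of exponent 2 as a vector space over $\mathbb{Z}_2$. Linear
  combinations with coefficients 0, 1 are products over subsets, so \<open>S\<close> ranges over the finite
  linearly independent sets.\<close>

definition mod2_dim :: "('g, 'm) monoid_scheme \<Rightarrow> enat" where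
  "mod2_dim G =
     Sup {enat (card S) | S. finite S \<and> S \<subseteq> carrier G \<and>
            (\<forall>T\<subseteq>S. finprod G (\<lambda>x. x) T = \<one>\<^bsub>G\<^esub> \<longrightarrow> T = {})}"

definition mod2_betti :: "nat \<Rightarrow> 'a::topological_space set \<Rightarrow> enat" where
  "mod2_betti p M = mod2_dim (mod2_homology_group p (top_of_set M))"

lemma frag_cmul_2_minus: "frag_cmul (-2) e = frag_cmul 2 (- e)"
  by (intro poly_mapping_eqI) simp

lemma mod2_cycles_subgroup: "subgroup (mod2_cycles p X) (chain_group p X)"
proof
  show "mod2_cycles p X \<subseteq> carrier (chain_group p X)"
    by (auto simp: mod2_cycles_def)
  show "x \<otimes>\<^bsub>chain_group p X\<^esub> y \<in> mod2_cycles p X"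
    if "x \<in> mod2_cycles p X" "y \<in> mod2_cycles p X" for x y
    using that
    by (auto simp: mod2_cycles_def singular_chain_add chain_boundary_add frag_cmul_distrib2 [symmetric])
  show "\<one>\<^bsub>chain_group p X\<^esub> \<in> mod2_cycles p X"
    by (auto simp: mod2_cycles_def intro: exI [where x = 0])
  show "inv\<^bsub>chain_group p X\<^esub> x \<in> mod2_cycles p X" if x: "x \<in> mod2_cycles p X" for x
  proof -
    have sx: "singular_chain p X x" using x by (simp add: mod2_cycles_def)
    obtain e where "chain_boundary p x = frag_cmul 2 e"
      using x by (auto simp: mod2_cycles_def)
    then have "chain_boundary p (-x) = frag_cmul 2 (-e)"
      by (simp add: chain_boundary_minus frag_cmul_2_minus)
    then show ?thesis
      using sx by (auto simp: mod2_cycles_def singular_chain_def)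
  qed
qed

lemma mod2_boundaries_subset: "mod2_boundaries p X \<subseteq> mod2_cycles p X"
proof
  fix c assume "c \<in> mod2_boundaries p X"
  then obtain d e where c: "c = chain_boundary (Suc p) d + frag_cmul 2 e"
    and d: "singular_chain (Suc p) X d" and e: "singular_chain p X e"
    by (auto simp: mod2_boundaries_def)
  have "chain_boundary p c = frag_cmul 2 (chain_boundary p e)"
    using chain_boundary_boundary [OF d] by (simp add: c chain_boundary_add chain_boundary_cmul)
  moreover have "singular_chain p X c"
    using singular_chain_boundary [OF d] e by (simp add: c singular_chain_add singular_chain_cmul)
  ultimately show "c \<in> mod2_cycles p X"
    by (auto simp: mod2_cycles_def)
qed

lemma mod2_boundaries_subgroup: "subgroup (mod2_boundaries p X) (chain_group p X)"
proof
  show sub: "mod2_boundaries p X \<subseteq> carrier (chain_group p X)"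
    using mod2_boundaries_subset [of p X] by (auto simp: mod2_cycles_def)
  show "x \<otimes>\<^bsub>chain_group p X\<^esub> y \<in> mod2_boundaries p X"
    if xy: "x \<in> mod2_boundaries p X" "y \<in> mod2_boundaries p X" for x y
  proof -
    obtain d e d' e' where "x = chain_boundary (Suc p) d + frag_cmul 2 e"
      "y = chain_boundary (Suc p) d' + frag_cmul 2 e'"
      and s: "singular_chain (Suc p) X d" "singular_chain p X e"
      "singular_chain (Suc p) X d'" "singular_chain p X e'"
      using xy by (auto simp: mod2_boundaries_def)
    then have "x + y = chain_boundary (Suc p) (d + d') + frag_cmul 2 (e + e')"
      by (simp add: chain_boundary_add frag_cmul_distrib2 algebra_simps)
    then show ?thesis
      using s singular_chain_add by (fastforce simp: mod2_boundaries_def)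
  qed
  show "\<one>\<^bsub>chain_group p X\<^esub> \<in> mod2_boundaries p X"
    by (force simp: mod2_boundaries_def intro: exI [where x = 0])
  show "inv\<^bsub>chain_group p X\<^esub> x \<in> mod2_boundaries p X" if x: "x \<in> mod2_boundaries p X" for x
  proof -
    obtain d e where "x = chain_boundary (Suc p) d + frag_cmul 2 e"
      and s: "singular_chain (Suc p) X d" "singular_chain p X e"
      using x by (auto simp: mod2_boundaries_def)
    then have "- x = chain_boundary (Suc p) (- d) + frag_cmul 2 (- e)"
      by (simp add: chain_boundary_minus frag_cmul_2_minus)
    moreover have "inv\<^bsub>chain_group p X\<^esub> x = - x"
      using sub x by (auto simp: singular_chain_def)
    ultimately show ?thesis
      using s singular_chain_minus by (fastforce simp: mod2_boundaries_def)
  qed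
qed

lemma comm_group_mod2_homology_group: "comm_group (mod2_homology_group p X)"
proof -
  let ?Z = "subgroup_generated (chain_group p X) (mod2_cycles p X)"
  interpret Z: comm_group ?Z
    by (intro group.abelian_subgroup_generated group_chain_group)
       (auto simp: abelian_chain_group mod2_cycles_def)
  have "subgroup (mod2_boundaries p X) ?Z"
    by (simp add: group.subgroup_of_subgroup_generated mod2_boundaries_subgroup mod2_boundaries_subset)
  then show ?thesis
    unfolding mod2_homology_group_def by (rule Z.abelian_FactGroup)
qed

lemma mod2_homology_group_exponent_2:
  assumes "x \<in> carrier (mod2_homology_group p X)"
  shows "x \<otimes>\<^bsub>mod2_homology_group p X\<^esub> x = \<one>\<^bsub>mod2_homology_group p X\<^esub>"
proof -
  let ?Z = "subgroup_generated (chain_group p X) (mod2_cycles p X)"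
  let ?B = "mod2_boundaries p X"
  interpret Z: comm_group ?Z
    by (intro group.abelian_subgroup_generated group_chain_group)
       (auto simp: abelian_chain_group mod2_cycles_def)
  have B: "subgroup ?B ?Z"
    by (simp add: group.subgroup_of_subgroup_generated mod2_boundaries_subgroup mod2_boundaries_subset)
  then have N: "?B \<lhd> ?Z"
    by (simp add: Z.normal_iff_subgroup)
  have carrier_Z: "carrier ?Z = mod2_cycles p X"
    by (simp add: subgroup.carrier_subgroup_generated_subgroup mod2_cycles_subgroup)
  obtain c where c: "c \<in> mod2_cycles p X" "x = ?B #>\<^bsub>?Z\<^esub> c"
    using assms carrier_Z by (auto simp: mod2_homology_group_def FactGroup_def RCOSETS_def)
  have "c + c = chain_boundary (Suc p) 0 + frag_cmul 2 c"
    by (intro poly_mapping_eqI) (simp add: lookup_add)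
  then have "c + c \<in> ?B"
    using c singular_chain_0 unfolding mod2_boundaries_def mod2_cycles_def by blast
  then have "c \<otimes>\<^bsub>?Z\<^esub> c \<in> ?B" by simp
  then have "?B #>\<^bsub>?Z\<^esub> (c \<otimes>\<^bsub>?Z\<^esub> c) = ?B"
    using Z.coset_join2 B c carrier_Z by blast
  then show ?thesis
    using normal.rcos_sum [OF N, of c c] c carrier_Z by (simp add: mod2_homology_group_def)
qed


section \<open>Octahedra and $(n,k)$-matrices\<close>

text \<open>A \<open>k\<close>-octahedron is represented by the tuple $(P_1,\dots,P_{k+1})$ that determines it, as an
  extensional function on $\{1,\dots,k+1\}$.\<close>

definition octahedra :: "nat \<Rightarrow> nat \<Rightarrow> (nat \<Rightarrow> nat set) set" where
  "octahedra n k = {1..k+1} \<rightarrow>\<^sub>E {S. S \<subseteq> {1..n} \<and> card S = 2}"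

definition oct_faces :: "nat \<Rightarrow> (nat \<Rightarrow> nat set) \<Rightarrow> (nat \<times> nat) set set" where
  "oct_faces k P = {(\<lambda>i. (i, a i)) ` {1..k+1} | a. \<forall>i\<in>{1..k+1}. a i \<in> P i}"

definition vertex_disjoint :: "nat \<Rightarrow> (nat \<Rightarrow> nat set) \<Rightarrow> (nat \<Rightarrow> nat set) \<Rightarrow> bool" where
  "vertex_disjoint k P Q \<longleftrightarrow> (\<forall>i\<in>{1..k+1}. P i \<inter> Q i = {})"

definition S_pairs :: "nat \<Rightarrow> nat \<Rightarrow> (nat \<Rightarrow> nat set) set set" where
  "S_pairs n k =
     {{P, Q} | P Q. P \<in> octahedra n k \<and> Q \<in> octahedra n k \<and>
        (\<forall>i\<in>{1..k+1}. P i \<subseteq> {1..3} \<and> Q i \<subseteq> {1..3} \<and> P i \<inter> Q i = {1})}"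

text \<open>For symmetric \<open>A\<close> the entry at an unordered pair does not depend on the order.\<close>

definition S_sum :: "nat \<Rightarrow> nat \<Rightarrow> ((nat \<Rightarrow> nat set) \<Rightarrow> (nat \<Rightarrow> nat set) \<Rightarrow> bit) \<Rightarrow> bit" where
  "S_sum n k A = (\<Sum>E\<in>S_pairs n k. THE b. \<exists>P Q. E = {P, Q} \<and> b = A P Q)"

text \<open>Only the entries of \<open>A\<close> at octahedra are relevant.\<close>

definition nk_matrix :: "nat \<Rightarrow> nat \<Rightarrow> ((nat \<Rightarrow> nat set) \<Rightarrow> (nat \<Rightarrow> nat set) \<Rightarrow> bit) \<Rightarrow> bool" where
  "nk_matrix n k A \<longleftrightarrow>
     (\<forall>P\<in>octahedra n k. \<forall>Q\<in>octahedra n k. A P Q = A Q P) \<and>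
     (\<forall>P\<in>octahedra n k. \<forall>Q\<in>octahedra n k. vertex_disjoint k P Q \<longrightarrow> A P Q = 0) \<and>
     (\<forall>P\<in>octahedra n k. \<forall>X\<in>octahedra n k. \<forall>Y\<in>octahedra n k.
        oct_faces k P = sym_diff (oct_faces k X) (oct_faces k Y) \<longrightarrow>
        (\<forall>Q\<in>octahedra n k. A P Q = A X Q + A Y Q)) \<and>
     S_sum n k A = 1"

text \<open>The rank of the square matrix $(A_{ij})_{i,j \in I}$: the dimension of its column space.\<close>

definition matrix_rank :: "'i set \<Rightarrow> ('i \<Rightarrow> 'i \<Rightarrow> 'f::field) \<Rightarrow> nat" where
  "matrix_rank I A =
     vector_space.dim (\<lambda>c u i. c * u i) ((\<lambda>j i. if i \<in> I then A i j else 0) ` I)"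

lemma vector_space_fun: "vector_space (\<lambda>(c::'f::field) (u::'i \<Rightarrow> 'f) i. c * u i)"
  by unfold_locales (auto simp: algebra_simps fun_eq_iff)

text \<open>The sum \<open>S_sum\<close> involves $\{1,2,3\} \subseteq [n]$. For \<open>n < 3\<close> it is empty, so that
  $(n,k)$-matrices exist only for \<open>n \<ge> 3\<close>.\<close>

lemma nk_matrix_imp_n_ge_3:
  assumes "nk_matrix n k A"
  shows "n \<ge> 3"
proof (rule ccontr)
  assume "\<not> n \<ge> 3"
  then have n: "{1..n} \<subseteq> {1, 2}" by auto
  have "S_pairs n k = {}"
  proof (rule ccontr)
    assume "S_pairs n k \<noteq> {}"
    then obtain P Q where PQ: "P \<in> octahedra n k" "Q \<in> octahedra n k"
      and I: "\<forall>i\<in>{1..k+1}. P i \<inter> Q i = {1}"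
      unfolding S_pairs_def by blast
    have two: "R 1 = {1, 2}" if "R \<in> octahedra n k" for R
    proof -
      have "(1::nat) \<in> {1..k+1}" by simp
      with that have "R 1 \<subseteq> {1..n}" "card (R 1) = 2"
        unfolding octahedra_def by fastforce+
      with n show ?thesis
        by (intro card_seteq) auto
    qed
    have "P 1 \<inter> Q 1 = {1}" using I by simp
    then show False using two [OF PQ(1)] two [OF PQ(2)] by auto
  qed
  then have "S_sum n k A = 0" by (simp add: S_sum_def)
  with assms show False by (simp add: nk_matrix_def)
qed

end

theory Submission
  imports Defs
begin

text \<open>Put \<open>m = 2k\<close> and let \<open>\<Delta>\<close> be the diagonal of \<open>M \<times> M\<close>. On relative \<open>m\<close>-cycles of
  \<open>(M \<times> M, M \<times> M - \<Delta>)\<close> there is a functional \<open>D\<close>, the Thom class of the diagonal, which in every chart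
  takes the mod 2 degree of \<open>(x, y) \<mapsto> y - x\<close> at the origin. It is glued from the charts by
  Mayer-Vietoris: for an open subset of a chart square the relative homology vanishes below degree
  \<open>m\<close> and is generated in degree \<open>m\<close> by small discs transverse to \<open>\<Delta>\<close>, and on such a disc any two
  charts give the value 1, by Borsuk's theorem that odd maps have odd degree. Charts at the boundary
  of \<open>M\<close> cause no difficulty, since a ball is convex and its interior points suffice.

  Let \<open>z P\<close> be the \<open>k\<close>-cycle of \<open>M\<close> carried by the octahedron \<open>P\<close>, and put \<open>A P Q = D (z P \<times> z Q)\<close>. This is
  symmetric, additive, and zero for vertex-disjoint octahedra. The sum of the products \<open>z P \<times> z Q\<close> over
  the pairs in \<open>S_sum\<close> is, up to cells off \<open>\<Delta>\<close>, the cone from \<open>((1, 1), (1, 1))\<close> over the \<open>k\<close>-fold join of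
  hexagons (the deleted join of three points with themselves). Shrinking it into a chart turns
  \<open>(x, y) \<mapsto> y - x\<close> into an odd map of this \<open>m\<close>-disc, so that \<open>D\<close> is 1 on it, again by Borsuk.

  A homology in \<open>M\<close> between the cycles \<open>z P\<close> is a linear relation between the columns of \<open>A\<close>, hence the
  rank is at most the dimension of the span of the classes of the \<open>z P\<close>. Finitely many charts suffice
  because only finitely many chains are involved.\<close>

section \<open>Mod 2 singular chains\<close>

text \<open>Transition maps are only homeomorphisms, so charts cannot be compared through
  derivatives or orientations. The remedy is a symmetric transverse disc: at \<open>p\<close> it is
  \<open>u \<mapsto> (p - r u, p + r u)\<close> rather than \<open>(p, p + r u)\<close>. Replacing
  \<open>u\<close> by \<open>-u\<close> exchanges the two points, so the difference of the two
  coordinates, read in any chart, is an odd map of a ball that vanishes only at the origin. In the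
  same way the exchange of factors acts antipodally on the join of hexagons, and one theorem on odd
  maps serves both places. That theorem is proved with chains: two equivariant families of
  hemispheres are compared degree by degree, which is possible because relative cycles below the top
  degree bound, and in the top degree they differ by a chain plus its antipode, of degree zero mod
  2.

  Chains are kept instead of homology classes because the octahedral cycles satisfy exact
  identities, and because explicit bounding chains have compact support. The latter is decisive
  since \<open>M\<close> need not be compact. The model of a chart is the unit ball of a coordinate
  subspace of a Euclidean space, as \<open>2k\<close> need not be the dimension of a type.\<close>

type_synonym 'a z2 = "'a \<Rightarrow>\<^sub>0 bit"

type_synonym 'a mod2_chain = "((nat \<Rightarrow> real) \<Rightarrow> 'a) z2"

abbreviation keys :: "('a \<Rightarrow>\<^sub>0 'b::zero) \<Rightarrow> 'a set" where
  "keys \<equiv> Poly_Mapping.keys"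

definition sg :: "'a \<Rightarrow> 'a z2" where
  "sg x = Poly_Mapping.single x 1"

text \<open>The linear extension of \<open>f\<close>: as all coefficients are 0 or 1, a sum over the
  support suffices, and additivity is the cancellation in \<open>sum_sym_diff\<close>.\<close>

definition ext :: "('a \<Rightarrow> 'b z2) \<Rightarrow> 'a z2 \<Rightarrow> 'b z2" where
  "ext f c = (\<Sum>x\<in>keys c. f x)"

lemma z2_self [simp]: "(x::'a z2) + x = 0"
  by (intro poly_mapping_eqI) (simp add: lookup_add)

lemma z2_self_left [simp]: "(x::'a z2) + (x + y) = y"
  by (simp flip: add.assoc)

lemma z2_eq_iff: "(x::'a z2) = y \<longleftrightarrow> x + y = 0"
  by (metis add.right_neutral z2_self z2_self_left)

lemma z2_cancel: "(x::'a z2) + y = z \<Longrightarrow> y = x + z"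
  by (metis z2_self_left)

lemma keys_sg [simp]: "keys (sg x) = {x}"
  by (simp add: sg_def)

lemma lookup_z2: "Poly_Mapping.lookup c x = (if x \<in> keys c then 1 else 0 :: bit)"
  by (simp add: in_keys_iff)

lemma keys_z2_add: "keys (a + b :: 'a z2) = sym_diff (keys a) (keys b)"
proof -
  have "u + v \<noteq> 0 \<longleftrightarrow> (u \<noteq> 0) \<noteq> (v \<noteq> 0)" for u v :: bit
    by (cases u; cases v) simp_all
  then show ?thesis
    unfolding set_eq_iff Un_iff Diff_iff in_keys_iff lookup_add by blast
qed

lemma sum_sym_diff:
  fixes f :: "'a \<Rightarrow> 'b z2"
  assumes "finite A" "finite B"
  shows "sum f (sym_diff A B) = sum f A + sum f B"
proof -
  have "sum f A = sum f (A \<inter> B) + sum f (A - B)"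
    by (rule sum.Int_Diff [OF assms(1)])
  moreover have "sum f B = sum f (B \<inter> A) + sum f (B - A)"
    by (rule sum.Int_Diff [OF assms(2)])
  moreover have "sum f (sym_diff A B) = sum f (A - B) + sum f (B - A)"
    using assms by (intro sum.union_disjoint) auto
  ultimately show ?thesis
    by (simp add: ac_simps Int_commute)
qed

lemma ext_sg [simp]: "ext f (sg x) = f x"
  by (simp add: ext_def)

lemma ext_0 [simp]: "ext f 0 = 0"
  by (simp add: ext_def)

lemma ext_add: "ext f (a + b) = ext f a + ext f b"
  by (simp add: ext_def keys_z2_add sum_sym_diff)

lemma ext_sum: "ext f (sum g I) = (\<Sum>i\<in>I. ext f (g i))"
  by (induction I rule: infinite_finite_induct) (simp_all add: ext_add)

lemma z2_expand: "(\<Sum>x\<in>keys c. sg x) = c"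
proof (intro poly_mapping_eqI)
  fix y
  have "Poly_Mapping.lookup (\<Sum>x\<in>keys c. sg x) y = (\<Sum>x\<in>keys c. if x = y then 1 else 0)"
    unfolding lookup_sum sg_def lookup_single by (simp add: when_def)
  also have "\<dots> = Poly_Mapping.lookup c y"
    by (simp add: lookup_z2)
  finally show "Poly_Mapping.lookup (\<Sum>x\<in>keys c. sg x) y = Poly_Mapping.lookup c y" .
qed

lemma z2_induct [consumes 1, case_names zero one add]:
  assumes "keys c \<subseteq> S"
    and "P 0" and "\<And>x. x \<in> S \<Longrightarrow> P (sg x)"
    and "\<And>a b. P a \<Longrightarrow> P b \<Longrightarrow> P (a + b)"
  shows "P c"
proof -
  have "P (\<Sum>x\<in>T. sg x)" if "finite T" "T \<subseteq> S" for T
    using that by (induction T) (auto intro: assms)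
  from this [of "keys c"] assms(1) show ?thesis
    by (simp add: z2_expand)
qed

lemma ext_ext: "ext f (ext g c) = ext (\<lambda>x. ext f (g x)) c"
proof -
  have "ext f (ext g c) = ext f (\<Sum>x\<in>keys c. g x)"
    unfolding ext_def [of g c] ..
  also have "\<dots> = (\<Sum>x\<in>keys c. ext f (g x))"
    by (rule ext_sum)
  finally show ?thesis
    unfolding ext_def [of _ c] .
qed

lemma ext_cong: "c = d \<Longrightarrow> (\<And>x. x \<in> keys d \<Longrightarrow> f x = g x) \<Longrightarrow> ext f c = ext g d"
  unfolding ext_def by (metis (mono_tags, lifting) sum.cong)

lemma ext_plus: "ext (\<lambda>x. f x + g x) c = ext f c + ext g c"
  unfolding ext_def by (rule sum.distrib)

lemma ext_id [simp]: "ext sg c = c"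
  unfolding ext_def by (rule z2_expand)

lemma ext_const_0 [simp]: "ext (\<lambda>x. 0) c = 0"
  unfolding ext_def by (rule sum.neutral_const)

lemma ext_swap: "ext (\<lambda>x. ext (\<lambda>y. f x y) d) c = ext (\<lambda>y. ext (\<lambda>x. f x y) c) d"
  unfolding ext_def by (rule sum.swap)

lemma keys_ext: "keys (ext f c) \<subseteq> (\<Union>x\<in>keys c. keys (f x))"
proof -
  have "keys (sum f T) \<subseteq> (\<Union>x\<in>T. keys (f x))" for T
    by (induction T rule: infinite_finite_induct) (auto simp: keys_z2_add)
  then show ?thesis by (simp add: ext_def)
qed

section \<open>Reduction of integral chains mod 2\<close>

definition rho :: "('a \<Rightarrow>\<^sub>0 int) \<Rightarrow> 'a z2" where
  "rho c = Poly_Mapping.map of_int c"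

text \<open>A section of \<open>rho\<close> with coefficients 0 and 1. It is not additive, so
  additivity of operations defined through it has to come from \<open>rho_additive\<close>.\<close>

definition lift :: "'a z2 \<Rightarrow> ('a \<Rightarrow>\<^sub>0 int)" where
  "lift c = (\<Sum>x\<in>keys c. frag_of x)"

lemma lookup_rho: "Poly_Mapping.lookup (rho c) x = of_int (Poly_Mapping.lookup c x)"
  by (simp add: rho_def Poly_Mapping.map.rep_eq when_def)

lemma rho_add: "rho (a + b) = rho a + rho b"
  by (intro poly_mapping_eqI) (simp add: lookup_rho lookup_add)

lemma rho_diff: "rho (a - b) = rho a + rho b"
  by (intro poly_mapping_eqI) (simp add: lookup_rho lookup_add lookup_minus)

lemma rho_0 [simp]: "rho 0 = 0"
  by (intro poly_mapping_eqI) (simp add: lookup_rho)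

lemma rho_frag_of [simp]: "rho (frag_of x) = sg x"
  by (intro poly_mapping_eqI) (auto simp: lookup_rho sg_def lookup_single)

lemma rho_cmul: "rho (frag_cmul n c) = (if even n then 0 else rho c)"
proof -
  have "of_int n = (0::bit)" if "even n"
    using that by (metis bit_2_eq_0 dvdE mult_zero_left of_int_mult of_int_numeral)
  moreover have "of_int n = (1::bit)" if "odd n"
    using that by (metis bit_2_eq_0 oddE mult_zero_left of_int_mult of_int_numeral of_int_add of_int_1 add_0)
  ultimately show ?thesis
    by (intro poly_mapping_eqI) (simp add: lookup_rho)
qed

lemma rho_sum: "rho (sum f I) = (\<Sum>i\<in>I. rho (f i))"
  by (induction I rule: infinite_finite_induct) (simp_all add: rho_add)

lemma rho_lift [simp]: "rho (lift c) = c"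
  by (simp add: lift_def rho_sum z2_expand)

lemma keys_rho: "keys (rho c) \<subseteq> keys c"
  by (auto simp: in_keys_iff lookup_rho)

lemma keys_lift: "keys (lift c) = keys c"
proof
  show "keys (lift c) \<subseteq> keys c"
    using keys_sum [of frag_of "keys c"] by (auto simp: lift_def keys_frag_of)
  show "keys c \<subseteq> keys (lift c)"
    using keys_rho [of "lift c"] by simp
qed

lemma rho_eq_0_imp: assumes "rho c = 0" obtains e where "c = frag_cmul 2 e" "keys e \<subseteq> keys c"
proof
  have ev: "even (Poly_Mapping.lookup c x)" for x
  proof (rule ccontr)
    assume "odd (Poly_Mapping.lookup c x)"
    then have "of_int (Poly_Mapping.lookup c x) = (1::bit)"
      by (metis bit_2_eq_0 oddE mult_zero_left of_int_mult of_int_numeral of_int_add of_int_1 add_0)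
    then show False
      using assms by (metis lookup_rho lookup_zero zero_neq_one)
  qed
  define e where "e = Poly_Mapping.map (\<lambda>n. n div 2) c"
  have l: "Poly_Mapping.lookup e x = Poly_Mapping.lookup c x div 2" for x
    by (simp add: e_def Poly_Mapping.map.rep_eq when_def)
  show "c = frag_cmul 2 e"
    using ev by (intro poly_mapping_eqI) (simp add: l)
  show "keys e \<subseteq> keys c"
    by (auto simp: in_keys_iff l)
qed

lemma rho_frag_extend: "rho (frag_extend f c) = ext (\<lambda>x. rho (f x)) (rho c)"
proof -
  have "keys c \<subseteq> UNIV" by simp
  then show ?thesis
    by (induction c rule: frag_induction) (simp_all add: frag_extend_diff rho_diff ext_add)
qed

text \<open>Chains with the same reduction differ by twice a chain, and an additive \<open>F\<close>
  keeps such a difference even. Thus iterated subdivision and its chain homotopy, given for integral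
  chains, descend to mod 2 chains.\<close>

lemma rho_additive:
  assumes "\<And>a b. F (a - b :: 'a \<Rightarrow>\<^sub>0 int) = F a - F b" "rho a = rho b"
  shows "rho (F a) = rho (F b)"
proof -
  have F0: "F 0 = 0"
    using assms(1) [of 0 0] by simp
  have Fm: "F (- x) = - F x" for x
    using assms(1) [of 0 x] F0 by simp
  have Fa: "F (x + y) = F x + F y" for x y
    using assms(1) [of x "- y"] Fm by simp
  have "rho (a - b) = 0"
    by (simp add: rho_diff assms(2))
  then obtain e where "a - b = frag_cmul 2 e"
    by (rule rho_eq_0_imp)
  then have "a = b + (e + e)"
    by (metis add_diff_cancel_left' diff_add_cancel add.commute frag_cmul_distrib frag_cmul_one one_add_one)
  then show ?thesis
    by (simp add: Fa rho_add)
qed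

section \<open>Singular chains mod 2 in subsets of a space\<close>

abbreviation smp :: "nat \<Rightarrow> 'a::topological_space set \<Rightarrow> ((nat \<Rightarrow> real) \<Rightarrow> 'a) \<Rightarrow> bool" where
  "smp p S \<equiv> singular_simplex p (top_of_set S)"

definition ch :: "nat \<Rightarrow> 'a::topological_space set \<Rightarrow> 'a mod2_chain \<Rightarrow> bool" where
  "ch p S c \<longleftrightarrow> keys c \<subseteq> Collect (smp p S)"

definition bd :: "nat \<Rightarrow> 'a mod2_chain \<Rightarrow> 'a mod2_chain" where
  "bd p c = (if p = 0 then 0 else ext (\<lambda>s. \<Sum>k\<le>p. sg (singular_face p k s)) c)"

definition cm :: "nat \<Rightarrow> ('a \<Rightarrow> 'b) \<Rightarrow> 'a mod2_chain \<Rightarrow> 'b mod2_chain" where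
  "cm p g c = ext (\<lambda>s. sg (simplex_map p g s)) c"

lemma smp_iff:
  "smp p S s \<longleftrightarrow> smp p UNIV s \<and> s ` standard_simplex p \<subseteq> S"
  using singular_simplex_subtopology [of p euclidean S s] by (simp add: subtopology_UNIV)

lemma smp_mono: "smp p S s \<Longrightarrow> S \<subseteq> T \<Longrightarrow> smp p T s"
  by (meson smp_iff subset_trans)

lemma smp_Int: "smp p (S \<inter> T) s \<longleftrightarrow> smp p S s \<and> smp p T s"
  by (metis smp_iff le_inf_iff)

lemma ch_0 [simp]: "ch p S 0"
  by (simp add: ch_def)

lemma ch_sg: "ch p S (sg s) \<longleftrightarrow> smp p S s"
  by (simp add: ch_def)

lemma ch_add [intro]: "ch p S a \<Longrightarrow> ch p S b \<Longrightarrow> ch p S (a + b)"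
  by (auto simp: ch_def keys_z2_add)

lemma ch_sum: "(\<And>i. i \<in> I \<Longrightarrow> ch p S (f i)) \<Longrightarrow> ch p S (sum f I)"
  by (induction I rule: infinite_finite_induct) auto

lemma ch_ext: "(\<And>x. x \<in> keys c \<Longrightarrow> ch p S (f x)) \<Longrightarrow> ch p S (ext f c)"
  unfolding ext_def by (rule ch_sum)

lemma ch_mono: "ch p S c \<Longrightarrow> S \<subseteq> T \<Longrightarrow> ch p T c"
  unfolding ch_def using smp_mono by blast

text \<open>All subsets carry the topology of one ambient type, so lying in a set is a condition on
  the image of a simplex. Mayer-Vietoris uses this to place a chain that is written both in
  \<open>A\<close> and in \<open>B\<close> into the intersection.\<close>

lemma ch_Int: "ch p (S \<inter> T) c \<longleftrightarrow> ch p S c \<and> ch p T c"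
  unfolding ch_def by (auto simp: smp_Int subset_iff)

lemma ch_rho: "singular_chain p (top_of_set S) c \<Longrightarrow> ch p S (rho c)"
  unfolding ch_def singular_chain_def by (rule subset_trans [OF keys_rho])

lemma ch_lift: "singular_chain p (top_of_set S) (lift c) \<longleftrightarrow> ch p S c"
  by (simp add: ch_def singular_chain_def keys_lift)

lemma bd_0 [simp]: "bd p 0 = 0" "bd 0 c = 0"
  by (auto simp: bd_def)

lemma bd_add: "bd p (a + b) = bd p a + bd p b"
  by (simp add: bd_def ext_add)

lemma bd_sum: "bd p (sum f I) = (\<Sum>i\<in>I. bd p (f i))"
  by (induction I rule: infinite_finite_induct) (simp_all add: bd_add)

lemma bd_sg: "bd (Suc p) (sg s) = (\<Sum>k\<le>Suc p. sg (singular_face (Suc p) k s))"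
  by (simp add: bd_def)

lemma rho_boundary: "rho (chain_boundary p c) = bd p (rho c)"
  by (auto simp: chain_boundary_def bd_def rho_frag_extend rho_sum rho_cmul intro!: ext_cong sum.cong)

lemma bd_eq_rho: "bd p c = rho (chain_boundary p (lift c))"
  by (simp add: rho_boundary)

lemma ch_bd: "ch p S c \<Longrightarrow> ch (p - 1) S (bd p c)"
  unfolding bd_eq_rho using ch_rho singular_chain_boundary ch_lift by (metis One_nat_def)

lemma ch_bd_Suc: "ch (Suc p) S c \<Longrightarrow> ch p S (bd (Suc p) c)"
  using ch_bd by fastforce

lemma bd_bd: "ch (Suc p) S c \<Longrightarrow> bd p (bd (Suc p) c) = 0"
  unfolding bd_eq_rho [of "Suc p"]
  by (metis rho_boundary ch_lift chain_boundary_boundary_alt rho_0)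

lemma cm_0 [simp]: "cm p g 0 = 0"
  by (simp add: cm_def)

lemma cm_add: "cm p g (a + b) = cm p g a + cm p g b"
  by (simp add: cm_def ext_add)

lemma cm_sum: "cm p g (sum f I) = (\<Sum>i\<in>I. cm p g (f i))"
  by (simp add: cm_def ext_sum)

lemma cm_sg [simp]: "cm p g (sg s) = sg (simplex_map p g s)"
  by (simp add: cm_def)

lemma rho_chain_map: "rho (chain_map p g c) = cm p g (rho c)"
  by (simp add: chain_map_def cm_def rho_frag_extend)

lemma cm_eq_rho: "cm p g c = rho (chain_map p g (lift c))"
  by (simp add: rho_chain_map)

lemma ch_cm:
  assumes "ch p S c" "continuous_on S g" "g ` S \<subseteq> T"
  shows "ch p T (cm p g c)"
proof -
  have "continuous_map (top_of_set S) (top_of_set T) g"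
    using assms by (auto simp: continuous_map_in_subtopology)
  then show ?thesis
    unfolding cm_eq_rho using assms by (meson ch_lift ch_rho singular_chain_chain_map)
qed

lemma bd_cm:
  assumes "ch p S c" shows "bd p (cm p g c) = cm (p - 1) g (bd p c)"
  unfolding cm_eq_rho [of p] bd_eq_rho [of _ c]
  by (metis One_nat_def assms ch_lift chain_boundary_chain_map rho_boundary rho_chain_map)

lemma bd_cm_Suc: "ch (Suc p) S c \<Longrightarrow> bd (Suc p) (cm (Suc p) g c) = cm p g (bd (Suc p) c)"
  using bd_cm by fastforce

lemma cm_cong:
  assumes "ch p S c" "\<And>x. x \<in> S \<Longrightarrow> g x = h x"
  shows "cm p g c = cm p h c"
  unfolding cm_def
proof (intro ext_cong refl)
  fix s assume "s \<in> keys c"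
  then have "smp p S s"
    using assms(1) by (auto simp: ch_def)
  then have "s ` standard_simplex p \<subseteq> S"
    using smp_iff by blast
  then show "sg (simplex_map p g s) = sg (simplex_map p h s)"
    using assms(2) by (intro arg_cong [where f=sg]) (auto simp: simplex_map_def fun_eq_iff restrict_def)
qed

lemma cm_compose: "cm p g (cm p f c) = cm p (g \<circ> f) c"
  unfolding cm_def ext_ext
proof (intro ext_cong refl)
  fix s
  show "ext (\<lambda>s. sg (simplex_map p g s)) (sg (simplex_map p f s)) = sg (simplex_map p (g \<circ> f) s)"
    by (simp add: simplex_map_def o_assoc) (intro arg_cong [where f=sg] restrict_ext; simp)
qed

lemma cm_ident:
  assumes "ch p S c" "\<And>x. x \<in> S \<Longrightarrow> g x = x"
  shows "cm p g c = c"
proof -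
  have "cm p g c = ext sg c"
    unfolding cm_def
  proof (intro ext_cong refl)
    fix s assume "s \<in> keys c"
    then have "smp p S s"
      using assms(1) by (auto simp: ch_def)
    then have "s ` standard_simplex p \<subseteq> S" "s \<in> extensional (standard_simplex p)"
      by (simp add: smp_iff [of p S], simp add: singular_simplex_def)
    then show "sg (simplex_map p g s) = sg s"
      using assms(2) by (intro arg_cong [where f=sg]) (auto simp: simplex_map_def fun_eq_iff restrict_def extensional_def)
  qed
  then show ?thesis by simp
qed

lemma compact_standard_simplex: "compact (standard_simplex p)"
  using compactin_standard_simplex [of p] by (simp add: euclidean_product_topology flip: compactin_euclidean_iff)

lemma smp_continuous: "smp p S s \<Longrightarrow> continuous_on (standard_simplex p) s"
  by (simp add: singular_simplex_def continuous_map_in_subtopology euclidean_product_topology)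

lemma smp_altdef:
  "smp p S s \<longleftrightarrow> continuous_on (standard_simplex p) s \<and> s ` standard_simplex p \<subseteq> S \<and> s \<in> extensional (standard_simplex p)"
  by (auto simp: singular_simplex_def continuous_map_in_subtopology euclidean_product_topology)

text \<open>Only finitely many simplices occur and each has compact image. This is how open sets are
  exchanged for finite unions of boxes, and \<open>M\<close> for finitely many charts.\<close>

lemma ch_compact_support:
  assumes "ch p S c" obtains K where "compact K" "K \<subseteq> S" "ch p K c"
proof
  let ?K = "\<Union>s\<in>keys c. s ` standard_simplex p"
  have s: "smp p S s" if t: "s \<in> keys c" for s
    using subsetD [OF assms [unfolded ch_def] t] by simp
  show "compact ?K"
  proof (rule compact_UN [OF finite_keys])
    fix t assume "t \<in> keys c"
    from compact_continuous_image [OF smp_continuous [OF s [OF this]] compact_standard_simplex]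
    show "compact (t ` standard_simplex p)" .
  qed
  show "?K \<subseteq> S"
    using s unfolding smp_altdef by blast
  show "ch p ?K c"
    unfolding ch_def
  proof clarify
    fix t assume t: "t \<in> keys c"
    then have "t ` standard_simplex p \<subseteq> ?K" by blast
    then show "smp p ?K t"
      using s [OF t] by (simp add: smp_altdef)
  qed
qed

section \<open>Cross products\<close>

definition pre :: "'a \<Rightarrow> 'a list z2 \<Rightarrow> 'a list z2" where
  "pre x c = ext (\<lambda>l. sg (x # l)) c"

text \<open>The boundary on ordered vertex lists is the augmented one: the boundary of a
  one-element list is the empty list.\<close>

primrec lb :: "'a list \<Rightarrow> 'a list z2" where
  "lb [] = 0"
| "lb (x # xs) = sg xs + pre x (lb xs)"

definition del :: "nat \<Rightarrow> 'a list \<Rightarrow> 'a list" where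
  "del k l = take k l @ drop (Suc k) l"

lemma pre_add: "pre x (a + b) = pre x a + pre x b"
  by (simp add: pre_def ext_add)

lemma pre_0 [simp]: "pre x 0 = 0"
  by (simp add: pre_def)

lemma pre_sg [simp]: "pre x (sg l) = sg (x # l)"
  by (simp add: pre_def)

lemma pre_sum: "pre x (sum f I) = (\<Sum>i\<in>I. pre x (f i))"
  by (simp add: pre_def ext_sum)

lemma lb_sum: "lb l = (\<Sum>k<length l. sg (del k l))"
proof (induction l)
  case (Cons x xs)
  have "(\<Sum>k<length (x # xs). sg (del k (x # xs))) = sg (del 0 (x # xs)) + (\<Sum>k<length xs. sg (del (Suc k) (x # xs)))"
    by (simp only: list.size add_Suc_right add_0_right sum.lessThan_Suc_shift)
  also have "\<dots> = sg xs + (\<Sum>k<length xs. pre x (sg (del k xs)))"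
    by (simp add: del_def)
  finally show ?case
    by (simp add: Cons pre_sum)
qed simp

text \<open>Cones are formed by appending the apex at the end of a list, whereas \<open>lb\<close>
  recurses from the front.\<close>

lemma lb_snoc: "lb (l @ [p]) = ext (\<lambda>m. sg (m @ [p])) (lb l) + sg l"
  by (induction l) (simp_all add: pre_def ext_add ext_ext ac_simps)

definition aff :: "'a::real_vector list \<Rightarrow> (nat \<Rightarrow> real) \<Rightarrow> 'a" where
  "aff l = restrict (\<lambda>x. \<Sum>i<length l. x i *\<^sub>R l ! i) (standard_simplex (length l - 1))"

text \<open>The empty list, which the augmented boundary makes of a single vertex, is sent to 0.
  This turns the augmented boundary of lists into the unaugmented singular boundary.\<close>

definition aff_chain :: "'a::real_vector list z2 \<Rightarrow> 'a mod2_chain" where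
  "aff_chain c = ext (\<lambda>l. if l = [] then 0 else sg (aff l)) c"

lemma aff_chain_add: "aff_chain (a + b) = aff_chain a + aff_chain b"
  by (simp add: aff_chain_def ext_add)

lemma aff_chain_0 [simp]: "aff_chain 0 = 0"
  by (simp add: aff_chain_def)

lemma aff_chain_sg: "aff_chain (sg l) = (if l = [] then 0 else sg (aff l))"
  by (simp add: aff_chain_def)

lemma aff_chain_sum: "aff_chain (sum f I) = (\<Sum>i\<in>I. aff_chain (f i))"
  by (simp add: aff_chain_def ext_sum)

lemma nth_del: "length l = Suc n \<Longrightarrow> k \<le> n \<Longrightarrow> i < n \<Longrightarrow> del k l ! i = (if i < k then l ! i else l ! Suc i)"
  by (auto simp: del_def nth_append min_def)

lemma length_del: "length l = Suc n \<Longrightarrow> k \<le> n \<Longrightarrow> length (del k l) = n"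
  by (simp add: del_def min_def)

text \<open>A face map inserts a zero coordinate at \<open>k\<close>, so the sum may skip that
  index. The summand \<open>h\<close> is arbitrary because both affine simplices and the weights
  \<open>wt\<close> need this.\<close>

lemma sum_simplical_face:
  fixes h :: "nat \<Rightarrow> real \<Rightarrow> 'b::comm_monoid_add"
  assumes "k \<le> n" "\<And>i. h i 0 = 0"
  shows "(\<Sum>i<Suc n. h i (simplical_face k x i)) = (\<Sum>i<n. h (if i < k then i else Suc i) (x i))"
proof -
  let ?g = "\<lambda>i. if i < k then i else Suc i"
  have "(\<Sum>i<Suc n. h i (simplical_face k x i)) = (\<Sum>i\<in>{..<Suc n} - {k}. h i (simplical_face k x i))"
    by (rule sum.mono_neutral_right) (auto simp: simplical_face_def assms(2))
  also have "\<dots> = (\<Sum>i<n. h (?g i) (simplical_face k x (?g i)))"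
  proof (rule sum.reindex_bij_betw [symmetric])
    show "bij_betw ?g {..<n} ({..<Suc n} - {k})"
      by (rule bij_betw_byWitness [where f' = "\<lambda>i. if i < k then i else i - 1"]) (use assms(1) in auto)
  qed
  also have "\<dots> = (\<Sum>i<n. h (?g i) (x i))"
    by (rule sum.cong) (auto simp: simplical_face_def)
  finally show ?thesis .
qed

lemma singular_face_aff:
  assumes l: "length l = Suc (Suc p)" and k: "k \<le> Suc p"
  shows "singular_face (Suc p) k (aff l) = aff (del k l)"
proof
  fix x
  show "singular_face (Suc p) k (aff l) x = aff (del k l) x"
  proof (cases "x \<in> standard_simplex p")
    case True
    then have "simplical_face k x \<in> standard_simplex (Suc p)"
      using k simplical_face_in_standard_simplex [of "Suc p" k x] by simp
    then have "singular_face (Suc p) k (aff l) x = (\<Sum>i<Suc (Suc p). simplical_face k x i *\<^sub>R l ! i)"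
      using True l by (simp add: singular_face_def aff_def del: sum.lessThan_Suc)
    also have "\<dots> = (\<Sum>i<Suc p. x i *\<^sub>R l ! (if i < k then i else Suc i))"
      using sum_simplical_face [of k "Suc p" "\<lambda>i r. r *\<^sub>R l ! i"] k by simp
    also have "\<dots> = aff (del k l) x"
      using True k nth_del [OF l] length_del [OF l] by (auto simp: aff_def if_distrib simp del: sum.lessThan_Suc intro!: sum.cong)
    finally show ?thesis .
  qed (use k length_del [OF l] in \<open>simp add: singular_face_def aff_def\<close>)
qed

lemma bd_aff_chain:
  assumes "\<And>l. l \<in> keys c \<Longrightarrow> length l = Suc p"
  shows "bd p (aff_chain c) = aff_chain (ext lb c)"
proof -
  have *: "bd p (aff_chain (sg l)) = aff_chain (lb l)" if l: "length l = Suc p" for l :: "'a list"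
  proof (cases p)
    case 0
    with l obtain x where "l = [x]" by (metis One_nat_def length_0_conv length_Suc_conv)
    then show ?thesis by (simp add: 0 aff_chain_sg)
  next
    case (Suc q)
    have "aff_chain (lb l) = (\<Sum>k<Suc p. aff_chain (sg (del k l)))"
      by (simp only: lb_sum aff_chain_sum l)
    also have "\<dots> = (\<Sum>k\<le>Suc q. sg (singular_face (Suc q) k (aff l)))"
    proof (rule sum.cong)
      show "aff_chain (sg (del k l)) = sg (singular_face (Suc q) k (aff l))" if "k \<in> {..Suc q}" for k
        using that l Suc length_del [of l p k] by (auto simp: aff_chain_sg singular_face_aff)
    qed (auto simp: Suc)
    also have "\<dots> = bd p (aff_chain (sg l))"
      using l by (auto simp: aff_chain_sg Suc bd_sg simp del: sum.atMost_Suc)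
    finally show ?thesis by simp
  qed
  have "keys c \<subseteq> {l. length l = Suc p}"
    using assms by auto
  then show ?thesis
    by (induction c rule: z2_induct [consumes 1]) (auto simp: * aff_chain_add bd_add ext_add)
qed

lemma convex_combination_standard_simplex:
  assumes "x \<in> standard_simplex p" "l \<noteq> []" "length l = Suc p"
  shows "(\<Sum>i<length l. x i *\<^sub>R l ! i) \<in> convex hull (set l)"
  using assms by (intro convex_sum convex_convex_hull) (auto simp: standard_simplex_def hull_inc lessThan_Suc_atMost)

lemma smp_aff:
  fixes l :: "'a::real_normed_vector list"
  assumes "length l = Suc p" "convex hull (set l) \<subseteq> S"
  shows "smp p S (aff l)"
  unfolding smp_altdef
proof (intro conjI)
  have "continuous_on (standard_simplex p) (\<lambda>x. \<Sum>i<length l. x i *\<^sub>R l ! i)"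
    by (intro continuous_on_sum continuous_on_scaleR continuous_on_const
        continuous_on_subset [OF continuous_on_product_coordinates subset_UNIV])
  then show "continuous_on (standard_simplex p) (aff l)"
    using assms(1) by (simp add: aff_def cong: continuous_on_cong)
  show "aff l ` standard_simplex p \<subseteq> S"
  proof clarify
    fix x assume "x \<in> standard_simplex p"
    moreover from this have "(\<Sum>i<length l. x i *\<^sub>R l ! i) \<in> convex hull (set l)"
      by (rule convex_combination_standard_simplex) (use assms(1) in auto)
    ultimately show "aff l x \<in> S"
      using assms by (auto simp: aff_def)
  qed
  show "aff l \<in> extensional (standard_simplex p)"
    using assms(1) by (simp add: aff_def)
qed

lemma ch_aff_chain:
  fixes c :: "'a::real_normed_vector list z2"
  assumes "\<And>l. l \<in> keys c \<Longrightarrow> length l = Suc p \<and> convex hull (set l) \<subseteq> S"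
  shows "ch p S (aff_chain c)"
  unfolding aff_chain_def
proof (rule ch_ext)
  fix l assume "l \<in> keys c"
  then show "ch p S (if l = [] then 0 else sg (aff l))"
    using assms [of l] by (auto simp: ch_sg intro: smp_aff)
qed

lemma cm_aff_chain:
  assumes "linear g" "\<And>l. l \<in> keys c \<Longrightarrow> length l = Suc p"
  shows "cm p g (aff_chain c) = aff_chain (ext (\<lambda>l. sg (map g l)) c)"
proof -
  have "simplex_map p g (aff l) = aff (map g l)" if l: "length l = Suc p" for l
  proof
    fix x
    have "g (\<Sum>i<length l. x i *\<^sub>R l ! i) = (\<Sum>i<length l. x i *\<^sub>R map g l ! i)"
      by (simp add: linear_sum [OF assms(1)] linear_cmul [OF assms(1)])
    then show "simplex_map p g (aff l) x = aff (map g l) x"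
      using l by (simp add: simplex_map_def aff_def restrict_def del: sum.lessThan_Suc)
  qed
  then have *: "cm p g (aff_chain (sg l)) = aff_chain (sg (map g l))" if "length l = Suc p" for l
    using that by (auto simp: aff_chain_sg)
  have "keys c \<subseteq> {l. length l = Suc p}"
    using assms by auto
  then show ?thesis
    by (induction c rule: z2_induct [consumes 1]) (auto simp: * aff_chain_add cm_add ext_add)
qed

text \<open>The shuffle triangulation of a product of two ordered simplices.\<close>

fun shuf :: "'a list \<Rightarrow> 'b list \<Rightarrow> ('a \<times> 'b) list z2" where
  "shuf [] ws = 0"
| "shuf (u # us) [] = 0"
| "shuf (u # us) (w # ws) =
     pre (u, w) (shuf us (w # ws) + shuf (u # us) ws + (if us = [] \<and> ws = [] then sg [] else 0))"

lemma shuf_Nil [simp]: "shuf us [] = 0"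
  by (cases us) auto

lemma ext_lb_pre: "ext lb (pre x c) = c + pre x (ext lb c)"
  by (simp add: pre_def ext_ext ext_plus)

lemma ext_Nil_lb: "ext (\<lambda>l. if l = [] then c else 0) (lb us) = (if length us = 1 then c else 0)"
proof (cases us)
  case (Cons u vs)
  have "ext (\<lambda>l. if l = [] then c else 0) (pre u d) = 0" for d
    by (simp add: pre_def ext_ext)
  then show ?thesis
    using Cons by (simp add: ext_add)
qed simp

lemma ext_if_conj: "ext (\<lambda>l. if P l \<and> Q then c else 0) d = (if Q then ext (\<lambda>l. if P l then c else 0) d else 0)"
  by simp

lemma ext_pre_shuf1:
  "ext (\<lambda>l. shuf l (w # ws)) (pre u c) =
   pre (u, w) (ext (\<lambda>l. shuf l (w # ws)) c + ext (\<lambda>l. shuf (u # l) ws) c + ext (\<lambda>l. if l = [] \<and> ws = [] then sg [] else 0) c)"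
  by (simp add: pre_def ext_ext ext_plus ext_add)

lemma ext_pre_shuf2:
  "ext (\<lambda>l. shuf (u # us) l) (pre w c) =
   pre (u, w) (ext (\<lambda>l. shuf us (w # l)) c + ext (\<lambda>l. shuf (u # us) l) c + ext (\<lambda>l. if us = [] \<and> l = [] then sg [] else 0) c)"
  by (simp add: pre_def ext_ext ext_plus ext_add)

text \<open>Interior faces of the triangulated product cancel in pairs, which leaves the product
  rule. The last summand comes from augmentation: the product of two vertices has the empty list as
  boundary, while both product terms are 0.\<close>

lemma lb_shuf:
  "ext lb (shuf us ws) = ext (\<lambda>u. shuf u ws) (lb us) + ext (\<lambda>w. shuf us w) (lb ws)
     + (if length us = 1 \<and> length ws = 1 then sg [] else 0)"
proof (induction us ws rule: shuf.induct)
  case (3 u us w ws)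
  have 1: "ext (\<lambda>l. if l = [] \<and> ws = [] then sg [] else 0) (lb us) = (if length us = 1 \<and> ws = [] then sg [] else 0 :: ('a \<times> 'b) list z2)"
    by (simp add: ext_if_conj ext_Nil_lb)
  have 2: "ext (\<lambda>l. if us = [] \<and> l = [] then sg [] else 0) (lb ws) = (if us = [] \<and> length ws = 1 then sg [] else 0 :: ('a \<times> 'b) list z2)"
    using ext_Nil_lb [of "sg []" ws] by (cases "us = []") simp_all
  have 3: "ext (\<lambda>l. shuf us l) (pre w c) = ext (\<lambda>l. shuf us (w # l)) c" for c
    by (simp add: pre_def ext_ext)
  have 4: "ext (\<lambda>l. shuf l ws) (pre u c) = ext (\<lambda>l. shuf (u # l) ws) c" for c
    by (simp add: pre_def ext_ext)
  show ?case
    by (simp add: ext_lb_pre ext_add 3 4 ext_pre_shuf1 ext_pre_shuf2 1 2 "3.IH" pre_add ac_simps)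
qed auto

lemma shuf_map: "shuf (map f us) (map g ws) = ext (\<lambda>l. sg (map (map_prod f g) l)) (shuf us ws)"
  by (induction us ws rule: shuf.induct) (auto simp: pre_def ext_ext ext_add ext_plus)

text \<open>The recursion of \<open>shuf\<close> treats its arguments alike. This is one half of the
  symmetry of the matrix; the other is the invariance of the diagonal class under exchange of
  factors.\<close>

lemma shuf_swap: "shuf ws us = ext (\<lambda>l. sg (map prod.swap l)) (shuf us ws)"
  by (induction us ws rule: shuf.induct) (auto simp: pre_def ext_ext ext_add ext_plus ac_simps)

lemma keys_pre: "keys (pre x c) \<subseteq> (#) x ` keys c"
  unfolding pre_def using keys_ext [of "\<lambda>l. sg (x # l)" c] by auto

lemma keys_shuf:
  "l \<in> keys (shuf us ws) \<Longrightarrow> Suc (length l) = length us + length ws \<and> set l \<subseteq> set us \<times> set ws"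
proof (induction us ws arbitrary: l rule: shuf.induct)
  case (3 u us w ws)
  let ?C = "(if us = [] \<and> ws = [] then sg [] else 0) :: ('a \<times> 'b) list z2"
  have "l \<in> (#) (u, w) ` keys (shuf us (w # ws) + shuf (u # us) ws + ?C)"
    using "3.prems" keys_pre unfolding shuf.simps by (rule rev_subsetD)
  then obtain m where m: "l = (u, w) # m" "m \<in> keys (shuf us (w # ws) + shuf (u # us) ws + ?C)"
    by (rule imageE)
  have "keys (a + b + c) \<subseteq> keys a \<union> keys b \<union> keys c"
    for a b c :: "('a \<times> 'b) list z2"
    by (auto simp: keys_z2_add)
  from subsetD [OF this m(2)] consider "m \<in> keys (shuf us (w # ws))"
    | "m \<in> keys (shuf (u # us) ws)" | "us = []" "ws = []" "m = []"
    by (cases "us = [] \<and> ws = []") auto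
  then show ?case
  proof cases
    case 1 from "3.IH"(1) [OF 1] show ?thesis by (auto simp: m(1))
  next
    case 2 from "3.IH"(2) [OF 2] show ?thesis by (auto simp: m(1))
  next
    case 3 then show ?thesis by (simp add: m(1))
  qed
qed auto

text \<open>\<open>wt js x\<close> pushes the barycentric coordinates \<open>x\<close> forward along the vertex map
  \<open>i \<mapsto> js ! i\<close>.\<close>

definition wt :: "nat list \<Rightarrow> (nat \<Rightarrow> real) \<Rightarrow> nat \<Rightarrow> real" where
  "wt js x = (\<lambda>j. \<Sum>i<length js. if js ! i = j then x i else 0)"

definition prod_simplex :: "((nat \<Rightarrow> real) \<Rightarrow> 'a) \<Rightarrow> ((nat \<Rightarrow> real) \<Rightarrow> 'b) \<Rightarrow> (nat \<times> nat) list \<Rightarrow> (nat \<Rightarrow> real) \<Rightarrow> 'a \<times> 'b" where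
  "prod_simplex s t l = restrict (\<lambda>x. (s (wt (map fst l) x), t (wt (map snd l) x))) (standard_simplex (length l - 1))"

definition prod_chain :: "((nat \<Rightarrow> real) \<Rightarrow> 'a) \<Rightarrow> ((nat \<Rightarrow> real) \<Rightarrow> 'b) \<Rightarrow> (nat \<times> nat) list z2 \<Rightarrow> ('a \<times> 'b) mod2_chain" where
  "prod_chain s t c = ext (\<lambda>l. if l = [] then 0 else sg (prod_simplex s t l)) c"

text \<open>The Eilenberg-Zilber shuffle product. The triangulation is made once, on lists of
  indices, and transported by \<open>prod_chain\<close>.\<close>

definition cross :: "nat \<Rightarrow> nat \<Rightarrow> 'a mod2_chain \<Rightarrow> 'b mod2_chain \<Rightarrow> ('a \<times> 'b) mod2_chain" where
  "cross p q c d = ext (\<lambda>s. ext (\<lambda>t. prod_chain s t (shuf [0..<Suc p] [0..<Suc q])) d) c"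

lemma prod_chain_add: "prod_chain s t (a + b) = prod_chain s t a + prod_chain s t b"
  by (simp add: prod_chain_def ext_add)

lemma prod_chain_sum: "prod_chain s t (sum f I) = (\<Sum>i\<in>I. prod_chain s t (f i))"
  by (simp add: prod_chain_def ext_sum)

lemma prod_chain_0 [simp]: "prod_chain s t 0 = 0"
  by (simp add: prod_chain_def)

lemma prod_chain_sg: "prod_chain s t (sg l) = (if l = [] then 0 else sg (prod_simplex s t l))"
  by (simp add: prod_chain_def)

lemma cross_add1: "cross p q (a + b) d = cross p q a d + cross p q b d"
  by (simp add: cross_def ext_add)

lemma cross_add2: "cross p q c (a + b) = cross p q c a + cross p q c b"
  by (simp add: cross_def ext_add ext_plus)

lemma cross_0 [simp]: "cross p q 0 d = 0" "cross p q c 0 = 0"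
  by (simp_all add: cross_def)

lemma cross_sum2: "cross p q c (sum f I) = (\<Sum>i\<in>I. cross p q c (f i))"
  by (induction I rule: infinite_finite_induct) (simp_all add: cross_add2)

lemma cross_sg: "cross p q (sg s) (sg t) = prod_chain s t (shuf [0..<Suc p] [0..<Suc q])"
  by (simp add: cross_def)

lemma wt_in_standard_simplex:
  assumes x: "x \<in> standard_simplex n" and js: "length js = Suc n" "set js \<subseteq> {..p}"
  shows "wt js x \<in> standard_simplex p"
proof -
  have x0: "0 \<le> x i" for i
    using x by (simp add: standard_simplex_def)
  have s1: "sum x {..n} = 1"
    using x by (simp add: standard_simplex_def)
  have le: "wt js x j \<le> 1" for j
  proof -
    have "wt js x j \<le> (\<Sum>i<length js. x i)"
      unfolding wt_def by (rule sum_mono) (simp add: x0)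
    then show ?thesis
      using s1 js by (simp add: lessThan_Suc_atMost)
  qed
  have "(\<Sum>j\<le>p. wt js x j) = (\<Sum>i<length js. \<Sum>j\<le>p. if js ! i = j then x i else 0)"
    unfolding wt_def by (rule sum.swap)
  also have "\<dots> = (\<Sum>i<length js. x i)"
  proof (rule sum.cong)
    fix i assume "i \<in> {..<length js}"
    then have "js ! i \<le> p"
      using js(2) by (metis atMost_iff lessThan_iff nth_mem subsetD)
    then show "(\<Sum>j\<le>p. if js ! i = j then x i else 0) = x i"
      by simp
  qed simp
  finally have "(\<Sum>j\<le>p. wt js x j) = 1"
    using s1 js by (simp add: lessThan_Suc_atMost)
  moreover have "wt js x j = 0" if "j > p" for j
    unfolding wt_def
  proof (rule sum.neutral, clarify)
    fix i assume "i < length js"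
    then have "js ! i \<le> p"
      using js(2) by (metis atMost_iff nth_mem subsetD)
    then show "(if js ! i = j then x i else 0) = 0"
      using that by simp
  qed
  ultimately show ?thesis
    using le by (simp add: standard_simplex_def wt_def sum_nonneg x0)
qed

lemma continuous_on_wt: "continuous_on S (wt js)"
proof -
  have "continuous_on S (\<lambda>x. if js ! i = j then x i else 0)" for i j
    by (cases "js ! i = j") (simp_all add: continuous_on_subset [OF continuous_on_product_coordinates subset_UNIV])
  then have "continuous_on S (\<lambda>x. wt js x j)" for j
    unfolding wt_def by (intro continuous_on_sum)
  then show ?thesis
    by (simp add: continuous_on_coordinatewise_then_product)
qed

lemma smp_prod_simplex:
  assumes s: "smp p A s" and t: "smp q B t" and l: "length l = Suc n" "set l \<subseteq> {..p} \<times> {..q}"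
  shows "smp n (A \<times> B) (prod_simplex s t l)"
proof -
  have f: "wt (map fst l) x \<in> standard_simplex p" if "x \<in> standard_simplex n" for x
    using that l by (intro wt_in_standard_simplex) auto
  have g: "wt (map snd l) x \<in> standard_simplex q" if "x \<in> standard_simplex n" for x
    using that l by (intro wt_in_standard_simplex) auto
  have cs: "continuous_on (standard_simplex p) s" "s ` standard_simplex p \<subseteq> A"
    and ct: "continuous_on (standard_simplex q) t" "t ` standard_simplex q \<subseteq> B"
    using s t by (simp_all add: smp_altdef)
  have "continuous_on (standard_simplex n) (\<lambda>x. s (wt (map fst l) x))"
    by (rule continuous_on_compose2 [OF cs(1) continuous_on_wt]) (use f in blast)
  moreover have "continuous_on (standard_simplex n) (\<lambda>x. t (wt (map snd l) x))"
    by (rule continuous_on_compose2 [OF ct(1) continuous_on_wt]) (use g in blast)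
  ultimately have "continuous_on (standard_simplex n) (prod_simplex s t l)"
    using l(1) by (simp add: prod_simplex_def continuous_on_Pair cong: continuous_on_cong)
  moreover have "prod_simplex s t l ` standard_simplex n \<subseteq> A \<times> B"
    using l(1) f g cs(2) ct(2) by (fastforce simp: prod_simplex_def)
  ultimately show ?thesis
    using l(1) by (simp add: smp_altdef prod_simplex_def)
qed

lemma ch_cross:
  assumes "ch p A c" "ch q B d"
  shows "ch (p + q) (A \<times> B) (cross p q c d)"
  unfolding cross_def prod_chain_def
proof (intro ch_ext)
  fix s t l
  assume "s \<in> keys c" "t \<in> keys d"
  then have st: "smp p A s" "smp q B t"
    using subsetD [OF assms(1) [unfolded ch_def]] subsetD [OF assms(2) [unfolded ch_def]] by simp_all
  assume "l \<in> keys (shuf [0..<Suc p] [0..<Suc q])"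
  from keys_shuf [OF this] have l: "length l = Suc (p + q)" "set l \<subseteq> {0..<Suc p} \<times> {0..<Suc q}"
    by auto
  have "set l \<subseteq> {..p} \<times> {..q}"
    using l(2) by (simp only: atLeast0LessThan lessThan_Suc_atMost)
  then show "ch (p + q) (A \<times> B) (if l = [] then 0 else sg (prod_simplex s t l))"
    using st l(1) by (auto simp: ch_sg intro: smp_prod_simplex)
qed

text \<open>The vertex map of the inclusion of the face opposite to vertex \<open>k\<close>.\<close>

definition skip :: "nat \<Rightarrow> nat \<Rightarrow> nat" where
  "skip k j = (if j < k then j else Suc j)"

lemma simplical_face_wt: "simplical_face k (wt js x) = wt (map (skip k) js) x"
proof
  fix j
  consider "j < k" | "j = k" | m where "j = Suc m" "k \<le> m"
    by (metis Suc_diff_1 gr_implies_not0 less_Suc_eq_le linorder_neqE_nat not_gr_zero)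
  then show "simplical_face k (wt js x) j = wt (map (skip k) js) x j"
    by cases (auto simp: simplical_face_def wt_def skip_def intro!: sum.cong sum.neutral)
qed

lemma wt_simplical_face:
  assumes "length js = Suc n" "k \<le> n"
  shows "wt js (simplical_face k x) = wt (del k js) x"
proof
  fix j
  have "wt js (simplical_face k x) j = (\<Sum>i<n. if js ! (if i < k then i else Suc i) = j then x i else 0)"
    using sum_simplical_face [OF assms(2), of "\<lambda>i r. if js ! i = j then r else 0" x] assms(1)
    by (simp add: wt_def del: sum.lessThan_Suc)
  also have "\<dots> = wt (del k js) x j"
    unfolding wt_def using length_del [OF assms] nth_del [OF assms]
    by (intro sum.cong) (auto simp: if_distrib)
  finally show "wt js (simplical_face k x) j = wt (del k js) x j" .
qed

lemma map_del: "map f (del k l) = del k (map f l)"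
  by (simp add: del_def take_map drop_map)

lemma singular_face_prod_simplex:
  assumes l: "length l = Suc (Suc n)" and k: "k \<le> Suc n"
  shows "singular_face (Suc n) k (prod_simplex s t l) = prod_simplex s t (del k l)"
proof
  fix x
  show "singular_face (Suc n) k (prod_simplex s t l) x = prod_simplex s t (del k l) x"
  proof (cases "x \<in> standard_simplex n")
    case True
    then have "simplical_face k x \<in> standard_simplex (Suc n)"
      using k simplical_face_in_standard_simplex [of "Suc n" k x] by simp
    moreover have "wt (map fst l) (simplical_face k x) = wt (map fst (del k l)) x"
      "wt (map snd l) (simplical_face k x) = wt (map snd (del k l)) x"
      using wt_simplical_face l k by (simp_all add: map_del)
    ultimately show ?thesis
      using True l length_del [OF l k] by (simp add: singular_face_def prod_simplex_def)
  qed (use length_del [OF l k] in \<open>simp add: singular_face_def prod_simplex_def\<close>)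
qed

lemma bd_prod_chain:
  assumes "\<And>l. l \<in> keys c \<Longrightarrow> length l = Suc n"
  shows "bd n (prod_chain s t c) = prod_chain s t (ext lb c)"
proof -
  have *: "bd n (prod_chain s t (sg l)) = prod_chain s t (lb l)" if l: "length l = Suc n" for l
  proof (cases n)
    case 0
    with l obtain x where "l = [x]" by (metis One_nat_def length_0_conv length_Suc_conv)
    then show ?thesis by (simp add: 0 prod_chain_sg)
  next
    case (Suc q)
    have "prod_chain s t (lb l) = (\<Sum>k<Suc n. prod_chain s t (sg (del k l)))"
      by (simp only: lb_sum prod_chain_sum l)
    also have "\<dots> = (\<Sum>k\<le>Suc q. sg (singular_face (Suc q) k (prod_simplex s t l)))"
    proof (rule sum.cong)
      show "prod_chain s t (sg (del k l)) = sg (singular_face (Suc q) k (prod_simplex s t l))" if "k \<in> {..Suc q}" for k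
        using that l Suc length_del [of l n k] by (auto simp: prod_chain_sg singular_face_prod_simplex)
    qed (auto simp: Suc)
    also have "\<dots> = bd n (prod_chain s t (sg l))"
      using l by (auto simp: prod_chain_sg Suc bd_sg simp del: sum.atMost_Suc)
    finally show ?thesis by simp
  qed
  have "keys c \<subseteq> {l. length l = Suc n}"
    using assms by auto
  then show ?thesis
    by (induction c rule: z2_induct [consumes 1]) (auto simp: * prod_chain_add bd_add ext_add)
qed

lemma del_upt: "k \<le> n \<Longrightarrow> del k [0..<Suc n] = map (skip k) [0..<n]"
  by (rule nth_equalityI) (auto simp: length_del nth_del skip_def simp del: upt_Suc)

lemma prod_chain_face1:
  assumes "\<And>l. l \<in> keys c \<Longrightarrow> set l \<subseteq> {..p} \<times> UNIV"
  shows "prod_chain (singular_face (Suc p) k s) t c = prod_chain s t (ext (\<lambda>l. sg (map (map_prod (skip k) id) l)) c)"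
proof -
  have "prod_simplex (singular_face (Suc p) k s) t l = prod_simplex s t (map (map_prod (skip k) id) l)"
    if l: "set l \<subseteq> {..p} \<times> UNIV" "l \<noteq> []" for l
  proof
    fix x
    have *: "map fst (map (map_prod (skip k) id) l) = map (skip k) (map fst l)"
      "map snd (map (map_prod (skip k) id) l) = map snd l" by simp_all
    show "prod_simplex (singular_face (Suc p) k s) t l x = prod_simplex s t (map (map_prod (skip k) id) l) x"
    proof (cases "x \<in> standard_simplex (length l - 1)")
      case True
      have "wt (map fst l) x \<in> standard_simplex p"
        using True l by (intro wt_in_standard_simplex [where n = "length l - 1"]) auto
      then show ?thesis
        using True unfolding prod_simplex_def * by (simp add: singular_face_def simplical_face_wt)
    qed (simp add: prod_simplex_def)
  qed
  then show ?thesis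
    unfolding prod_chain_def ext_ext using assms by (intro ext_cong refl) auto
qed

lemma prod_chain_face2:
  assumes "\<And>l. l \<in> keys c \<Longrightarrow> set l \<subseteq> UNIV \<times> {..q}"
  shows "prod_chain s (singular_face (Suc q) k t) c = prod_chain s t (ext (\<lambda>l. sg (map (map_prod id (skip k)) l)) c)"
proof -
  have "prod_simplex s (singular_face (Suc q) k t) l = prod_simplex s t (map (map_prod id (skip k)) l)"
    if l: "set l \<subseteq> UNIV \<times> {..q}" "l \<noteq> []" for l
  proof
    fix x
    have *: "map snd (map (map_prod id (skip k)) l) = map (skip k) (map snd l)"
      "map fst (map (map_prod id (skip k)) l) = map fst l" by simp_all
    show "prod_simplex s (singular_face (Suc q) k t) l x = prod_simplex s t (map (map_prod id (skip k)) l) x"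
    proof (cases "x \<in> standard_simplex (length l - 1)")
      case True
      have "wt (map snd l) x \<in> standard_simplex q"
        using True l by (intro wt_in_standard_simplex [where n = "length l - 1"]) auto
      then show ?thesis
        using True unfolding prod_simplex_def * by (simp add: singular_face_def simplical_face_wt)
    qed (simp add: prod_simplex_def)
  qed
  then show ?thesis
    unfolding prod_chain_def ext_ext using assms by (intro ext_cong refl) auto
qed

lemma keys_shuf_upt:
  assumes "l \<in> keys (shuf [0..<Suc p] [0..<Suc q])"
  shows "length l = Suc (p + q)" "set l \<subseteq> {..p} \<times> {..q}"
proof -
  show "length l = Suc (p + q)" using keys_shuf [OF assms] by auto
  have "set l \<subseteq> set [0..<Suc p] \<times> set [0..<Suc q]"
    using keys_shuf [OF assms] by blast
  then show "set l \<subseteq> {..p} \<times> {..q}"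
    by (simp only: set_upt atLeast0LessThan lessThan_Suc_atMost)
qed

lemma prod_chain_lb1:
  "prod_chain s t (ext (\<lambda>u. shuf u [0..<Suc q]) (lb [0..<Suc p])) = ext (\<lambda>s. prod_chain s t (shuf [0..<p] [0..<Suc q])) (bd p (sg s))"
proof (cases p)
  case (Suc p')
  have *: "prod_chain (singular_face p k s) t (shuf [0..<p] [0..<Suc q]) = prod_chain s t (shuf (map (skip k) [0..<p]) [0..<Suc q])" for k
  proof -
    have "prod_chain (singular_face p k s) t (shuf [0..<p] [0..<Suc q]) =
        prod_chain s t (ext (\<lambda>l. sg (map (map_prod (skip k) id) l)) (shuf [0..<p] [0..<Suc q]))"
      using keys_shuf_upt [of _ p' q] unfolding Suc by (intro prod_chain_face1) fastforce
    then show ?thesis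
      using shuf_map [of "skip k" "[0..<p]" id "[0..<Suc q]"] by (simp del: upt_Suc)
  qed
  have lbp: "lb [0..<Suc p] = (\<Sum>k<Suc p. sg (map (skip k) [0..<p]))"
    unfolding lb_sum by (rule sum.cong) (auto simp: del_upt simp del: upt_Suc)
  have "bd p (sg s) = (\<Sum>k<Suc p. sg (singular_face p k s))"
    by (simp only: Suc bd_sg lessThan_Suc_atMost)
  then show ?thesis
    by (simp only: lbp ext_sum prod_chain_sum ext_sg *)
qed simp

lemma prod_chain_lb2:
  "prod_chain s t (ext (\<lambda>w. shuf [0..<Suc p] w) (lb [0..<Suc q])) = ext (\<lambda>t. prod_chain s t (shuf [0..<Suc p] [0..<q])) (bd q (sg t))"
proof (cases q)
  case (Suc q')
  have *: "prod_chain s (singular_face q k t) (shuf [0..<Suc p] [0..<q]) = prod_chain s t (shuf [0..<Suc p] (map (skip k) [0..<q]))" for k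
  proof -
    have "prod_chain s (singular_face q k t) (shuf [0..<Suc p] [0..<q]) =
        prod_chain s t (ext (\<lambda>l. sg (map (map_prod id (skip k)) l)) (shuf [0..<Suc p] [0..<q]))"
      using keys_shuf_upt [of _ p q'] unfolding Suc by (intro prod_chain_face2) fastforce
    then show ?thesis
      using shuf_map [of id "[0..<Suc p]" "skip k" "[0..<q]"] by (simp del: upt_Suc)
  qed
  have lbp: "lb [0..<Suc q] = (\<Sum>k<Suc q. sg (map (skip k) [0..<q]))"
    unfolding lb_sum by (rule sum.cong) (auto simp: del_upt simp del: upt_Suc)
  have "bd q (sg t) = (\<Sum>k<Suc q. sg (singular_face q k t))"
    by (simp only: Suc bd_sg lessThan_Suc_atMost)
  then show ?thesis
    by (simp only: lbp ext_sum prod_chain_sum ext_sg *)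
qed simp

lemma bd_ext: "bd p (ext f c) = ext (\<lambda>x. bd p (f x)) c"
  by (simp add: ext_def bd_sum)

lemma cm_ext: "cm p g (ext f c) = ext (\<lambda>x. cm p g (f x)) c"
  by (simp add: ext_def cm_sum)

lemma bd_eq_ext: "bd p c = ext (\<lambda>s. bd p (sg s)) c"
  by (metis bd_ext ext_id)

text \<open>The truncated subtraction does no harm: for \<open>p = 0\<close> the factor
  \<open>bd p c\<close> is 0, and likewise for \<open>q\<close>. The augmentation term of
  \<open>lb_shuf\<close> disappears because \<open>prod_chain\<close> sends the empty list to
  0.\<close>

lemma bd_cross:
  "bd (p + q) (cross p q c d) = cross (p - 1) q (bd p c) d + cross p (q - 1) c (bd q d)"
proof -
  let ?P = "[0..<Suc p]" and ?Q = "[0..<Suc q]"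
  have *: "bd (p + q) (prod_chain s t (shuf ?P ?Q)) = ext (\<lambda>s. prod_chain s t (shuf [0..<p] ?Q)) (bd p (sg s)) + ext (\<lambda>t. prod_chain s t (shuf ?P [0..<q])) (bd q (sg t))" for s t
  proof -
    have "bd (p + q) (prod_chain s t (shuf ?P ?Q)) = prod_chain s t (ext lb (shuf ?P ?Q))"
      by (rule bd_prod_chain) (rule keys_shuf_upt)
    also have "\<dots> = prod_chain s t (ext (\<lambda>u. shuf u ?Q) (lb ?P)) + prod_chain s t (ext (\<lambda>w. shuf ?P w) (lb ?Q))"
      by (auto simp only: lb_shuf prod_chain_add prod_chain_sg prod_chain_0 if_True if_False split: if_splits) simp_all
    finally show ?thesis
      by (simp only: prod_chain_lb1 prod_chain_lb2)
  qed
  have p1: "cross (p - 1) q (bd p c) d = ext (\<lambda>s. ext (\<lambda>t. ext (\<lambda>s. prod_chain s t (shuf [0..<p] ?Q)) (bd p (sg s))) d) c"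
  proof (cases p)
    case (Suc p')
    have "cross (p - 1) q (bd p c) d = ext (\<lambda>s. ext (\<lambda>s. ext (\<lambda>t. prod_chain s t (shuf [0..<p] ?Q)) d) (bd p (sg s))) c"
      unfolding cross_def by (subst bd_eq_ext) (simp only: ext_ext Suc diff_Suc_1)
    then show ?thesis
      by (simp only: ext_swap [where d = d])
  qed (simp add: cross_def)
  have p2: "cross p (q - 1) c (bd q d) = ext (\<lambda>s. ext (\<lambda>t. ext (\<lambda>t. prod_chain s t (shuf ?P [0..<q])) (bd q (sg t))) d) c"
  proof (cases q)
    case (Suc p')
    then show ?thesis
      unfolding cross_def by (subst bd_eq_ext) (simp only: ext_ext Suc diff_Suc_1)
  qed (simp add: cross_def)
  show ?thesis
    unfolding p1 p2 unfolding ext_plus [symmetric] unfolding cross_def bd_ext * ..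
qed

lemma cm_swap_cross:
  fixes c :: "'a mod2_chain" and d :: "'b mod2_chain"
  shows "cm (p + q) prod.swap (cross p q c d) = cross q p d c"
proof -
  have "cm (p + q) prod.swap (prod_chain s t (shuf [0..<Suc p] [0..<Suc q])) = prod_chain t s (shuf [0..<Suc q] [0..<Suc p])"
    for s :: "(nat \<Rightarrow> real) \<Rightarrow> 'a" and t :: "(nat \<Rightarrow> real) \<Rightarrow> 'b"
    unfolding shuf_swap [of "[0..<Suc q]" "[0..<Suc p]"] prod_chain_def ext_ext cm_ext
  proof (intro ext_cong refl)
    fix l assume "l \<in> keys (shuf [0..<Suc p] [0..<Suc q])"
    then have l: "length l = Suc (p + q)" by (rule keys_shuf_upt)
    have "map fst (map prod.swap l) = map snd l" "map snd (map prod.swap l) = map fst l"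
      by simp_all
    then have "simplex_map (p + q) prod.swap (prod_simplex s t l) = prod_simplex t s (map prod.swap l)"
      unfolding prod_simplex_def simplex_map_def using l by (auto simp: fun_eq_iff restrict_def simp del: map_map)
    then show "cm (p + q) prod.swap (if l = [] then 0 else sg (prod_simplex s t l)) =
         ext (\<lambda>l. if l = [] then 0 else sg (prod_simplex t s l)) (sg (map prod.swap l))"
      using l by auto
  qed
  then have "cm (p + q) prod.swap (cross p q c d) = ext (\<lambda>s. ext (\<lambda>t. prod_chain t s (shuf [0..<Suc q] [0..<Suc p])) d) c"
    unfolding cross_def cm_ext by (simp only:)
  then show ?thesis
    unfolding cross_def by (simp only: ext_swap [where c = c])
qed

section \<open>Products of affine chains\<close>

definition shuf_chain :: "'a list z2 \<Rightarrow> 'b list z2 \<Rightarrow> ('a \<times> 'b) list z2" where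
  "shuf_chain c d = ext (\<lambda>u. ext (\<lambda>w. shuf u w) d) c"

lemma shuf_chain_add1: "shuf_chain (a + b) d = shuf_chain a d + shuf_chain b d"
  by (simp add: shuf_chain_def ext_add)

lemma shuf_chain_add2: "shuf_chain c (a + b) = shuf_chain c a + shuf_chain c b"
  by (simp add: shuf_chain_def ext_add ext_plus)

lemma shuf_chain_0 [simp]: "shuf_chain 0 d = 0" "shuf_chain c 0 = 0"
  by (simp_all add: shuf_chain_def)

lemma shuf_chain_sg [simp]: "shuf_chain (sg u) (sg w) = shuf u w"
  by (simp add: shuf_chain_def)

lemma sum_Pair: "(\<Sum>i\<in>I. (f i, g i)) = (\<Sum>i\<in>I. f i, \<Sum>i\<in>I. g i)"
  by (induction I rule: infinite_finite_induct) (simp_all add: zero_prod_def)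

lemma aff_wt:
  assumes x: "x \<in> standard_simplex n" and js: "length js = Suc n" "set js \<subseteq> {..p}" and u: "length u = Suc p"
  shows "aff u (wt js x) = (\<Sum>i<Suc n. x i *\<^sub>R u ! (js ! i))"
proof -
  have "aff u (wt js x) = (\<Sum>j<Suc p. (\<Sum>i<Suc n. if js ! i = j then x i else 0) *\<^sub>R u ! j)"
    using wt_in_standard_simplex [OF x js] u js(1) by (simp add: aff_def wt_def del: sum.lessThan_Suc)
  also have "\<dots> = (\<Sum>j<Suc p. \<Sum>i<Suc n. if js ! i = j then x i *\<^sub>R u ! j else 0)"
    by (intro sum.cong refl) (simp only: scaleR_sum_left if_distrib [of "\<lambda>r. r *\<^sub>R _"] scaleR_zero_left)
  also have "\<dots> = (\<Sum>i<Suc n. \<Sum>j<Suc p. if js ! i = j then x i *\<^sub>R u ! j else 0)"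
    by (rule sum.swap)
  also have "\<dots> = (\<Sum>i<Suc n. x i *\<^sub>R u ! (js ! i))"
  proof (rule sum.cong)
    fix i assume "i \<in> {..<Suc n}"
    then have "js ! i < Suc p"
      using js by (metis atMost_iff lessThan_iff less_Suc_eq_le nth_mem subsetD)
    then show "(\<Sum>j<Suc p. if js ! i = j then x i *\<^sub>R u ! j else 0) = x i *\<^sub>R u ! (js ! i)"
      by (simp del: sum.lessThan_Suc)
  qed simp
  finally show ?thesis .
qed

text \<open>The shuffle product of affine simplices consists of affine simplices of the product
  space. Hence products of octahedral cycles are images of chains of vertex pairs, and identities
  between them become finite combinatorics.\<close>

lemma cross_cm_aff_chain:
  assumes c: "\<And>l. l \<in> keys c \<Longrightarrow> length l = Suc p"
    and d: "\<And>l. l \<in> keys d \<Longrightarrow> length l = Suc q"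
  shows "cross p q (cm p f (aff_chain c)) (cm q g (aff_chain d)) = cm (p + q) (map_prod f g) (aff_chain (shuf_chain c d))"
proof -
  have *: "prod_chain (simplex_map p f (aff u)) (simplex_map q g (aff w)) (shuf [0..<Suc p] [0..<Suc q]) = cm (p + q) (map_prod f g) (aff_chain (shuf u w))"
    if u: "length u = Suc p" and w: "length w = Suc q" for u w
  proof -
    have "shuf u w = shuf (map ((!) u) [0..<Suc p]) (map ((!) w) [0..<Suc q])"
      by (metis map_nth u w)
    also have "\<dots> = ext (\<lambda>l. sg (map (map_prod ((!) u) ((!) w)) l)) (shuf [0..<Suc p] [0..<Suc q])"
      by (rule shuf_map)
    finally have Euw: "shuf u w = ext (\<lambda>l. sg (map (map_prod ((!) u) ((!) w)) l)) (shuf [0..<Suc p] [0..<Suc q])" .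
    show ?thesis
      unfolding Euw aff_chain_def prod_chain_def ext_ext cm_ext
    proof (intro ext_cong refl)
      fix l assume l: "l \<in> keys (shuf [0..<Suc p] [0..<Suc q])"
      note len = keys_shuf_upt(1) [OF l] and set = keys_shuf_upt(2) [OF l]
      let ?m = "map (map_prod ((!) u) ((!) w)) l"
      have "prod_simplex (simplex_map p f (aff u)) (simplex_map q g (aff w)) l = simplex_map (p + q) (map_prod f g) (aff ?m)"
      proof
        fix x
        show "prod_simplex (simplex_map p f (aff u)) (simplex_map q g (aff w)) l x = simplex_map (p + q) (map_prod f g) (aff ?m) x"
        proof (cases "x \<in> standard_simplex (p + q)")
          case True
          have l1: "length (map fst l) = Suc (p + q)" "set (map fst l) \<subseteq> {..p}"
            and l2: "length (map snd l) = Suc (p + q)" "set (map snd l) \<subseteq> {..q}"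
            using len set by auto
          have "aff ?m x = (\<Sum>i<Suc (p + q). x i *\<^sub>R (map_prod ((!) u) ((!) w) (l ! i)))"
            using True len by (simp add: aff_def del: sum.lessThan_Suc)
          also have "\<dots> = (\<Sum>i<Suc (p + q). (x i *\<^sub>R u ! (map fst l ! i), x i *\<^sub>R w ! (map snd l ! i)))"
            by (rule sum.cong) (auto simp: len map_prod_def split: prod.splits)
          also have "\<dots> = (aff u (wt (map fst l) x), aff w (wt (map snd l) x))"
            unfolding sum_Pair aff_wt [OF True l1 u] aff_wt [OF True l2 w] ..
          finally show ?thesis
            using True len wt_in_standard_simplex [OF True l1] wt_in_standard_simplex [OF True l2]
            by (simp add: prod_simplex_def simplex_map_def)
        qed (simp add: prod_simplex_def simplex_map_def len)
      qed
      then show "(if l = [] then 0 else sg (prod_simplex (simplex_map p f (aff u)) (simplex_map q g (aff w)) l)) =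
         ext (\<lambda>l. cm (p + q) (map_prod f g) (if l = [] then 0 else sg (aff l))) (sg ?m)"
        using len by auto
    qed
  qed
  have 1: "cross p q (cm p f (aff_chain (sg u))) (cm q g (aff_chain d)) = cm (p + q) (map_prod f g) (aff_chain (shuf_chain (sg u) d))"
    if u: "length u = Suc p" for u
  proof -
    have "keys d \<subseteq> {l. length l = Suc q}"
      using d by auto
    then show ?thesis
    proof (induction d rule: z2_induct [consumes 1])
      case (one w)
      have "u \<noteq> []" "w \<noteq> []" using u one by auto
      then show ?case
        using * [OF u, of w] one by (simp add: aff_chain_sg cross_sg del: upt_Suc)
    qed (simp_all add: cross_add2 cm_add aff_chain_add shuf_chain_add2)
  qed
  have "keys c \<subseteq> {l. length l = Suc p}"
    using c by auto
  then show ?thesis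
    by (induction c rule: z2_induct [consumes 1]) (simp_all add: 1 cross_add1 cm_add aff_chain_add shuf_chain_add1)
qed

lemma shuf_single_right: "shuf us [w] = (if us = [] then 0 else sg (map (\<lambda>u. (u, w)) us))"
  by (induction us) auto

lemma wt_upt: "x \<in> standard_simplex p \<Longrightarrow> wt [0..<Suc p] x = x"
proof
  fix j assume x: "x \<in> standard_simplex p"
  have "wt [0..<Suc p] x j = (\<Sum>i<Suc p. if i = j then x i else 0)"
    unfolding wt_def by (rule sum.cong) (auto simp del: upt_Suc)
  then show "wt [0..<Suc p] x j = x j"
    using x by (auto simp: standard_simplex_def simp del: sum.lessThan_Suc)
qed

text \<open>The product with a point has a single shuffle simplex, and it is the slice at
  \<open>r\<close>. This identifies the two ends of a prism.\<close>

lemma cm_cross_point: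
  fixes c :: "'a mod2_chain" and H :: "'a \<times> real \<Rightarrow> 'b"
  shows "cm p H (cross p 0 c (sg (aff [r]))) = cm p (\<lambda>x. H (x, r)) c"
proof -
  have "cross p 0 (sg s) (sg (aff [r])) = sg (prod_simplex s (aff [r]) (map (\<lambda>u. (u, 0)) [0..<Suc p]))" for s :: "(nat \<Rightarrow> real) \<Rightarrow> 'a"
  proof -
    have z: "[0..<Suc 0] = [0]" by simp
    have "shuf [0..<Suc p] [0..<Suc 0] = sg (map (\<lambda>u. (u, 0)) [0..<Suc p])"
      unfolding z shuf_single_right by (simp del: upt_Suc)
    then show ?thesis
      unfolding cross_sg by (simp add: prod_chain_sg del: upt_Suc)
  qed
  moreover have "simplex_map p H (prod_simplex s (aff [r]) (map (\<lambda>u. (u, 0)) [0..<Suc p])) = simplex_map p (\<lambda>x. H (x, r)) s"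
    for s :: "(nat \<Rightarrow> real) \<Rightarrow> 'a"
  proof
    fix x
    have *: "map fst (map (\<lambda>u. (u, 0::nat)) [0..<Suc p]) = [0..<Suc p]"
      by (simp add: o_def del: upt_Suc)
    show "simplex_map p H (prod_simplex s (aff [r]) (map (\<lambda>u. (u, 0)) [0..<Suc p])) x = simplex_map p (\<lambda>x. H (x, r)) s x"
    proof (cases "x \<in> standard_simplex p")
      case True
      have m: "length (map snd (map (\<lambda>u. (u, 0::nat)) [0..<Suc p])) = Suc p"
        "set (map snd (map (\<lambda>u. (u, 0::nat)) [0..<Suc p])) \<subseteq> {..0}"
        by (auto simp del: upt_Suc)
      have nth: "map snd (map (\<lambda>u. (u, 0::nat)) [0..<Suc p]) ! i = 0" if "i < Suc p" for i
        using that by (simp del: upt_Suc)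
      have "aff [r] (wt (map snd (map (\<lambda>u. (u, 0)) [0..<Suc p])) x) =
          (\<Sum>i<Suc p. x i *\<^sub>R [r] ! (map snd (map (\<lambda>u. (u, 0::nat)) [0..<Suc p]) ! i))"
        by (rule aff_wt [OF True m]) simp
      also have "\<dots> = (\<Sum>i<Suc p. x i *\<^sub>R r)"
        by (rule sum.cong) (simp_all add: nth del: upt_Suc map_map)
      also have "\<dots> = r"
        using True by (simp add: standard_simplex_def lessThan_Suc_atMost flip: sum_distrib_right del: sum.lessThan_Suc)
      finally show ?thesis
        using True * by (simp add: simplex_map_def prod_simplex_def wt_upt del: upt_Suc map_map)
    qed (simp add: simplex_map_def)
  qed
  ultimately have *: "cm p H (cross p 0 (sg s) (sg (aff [r]))) = cm p (\<lambda>x. H (x, r)) (sg s)"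
    for s :: "(nat \<Rightarrow> real) \<Rightarrow> 'a"
    by (simp only: cm_sg)
  have "keys c \<subseteq> UNIV" by simp
  then show ?thesis
    by (induction c rule: z2_induct [consumes 1]) (simp_all only: * cross_add1 cm_add cross_0 cm_0)
qed

section \<open>Homology of pairs\<close>

definition prism :: "nat \<Rightarrow> ('a \<times> real \<Rightarrow> 'b) \<Rightarrow> 'a mod2_chain \<Rightarrow> 'b mod2_chain" where
  "prism p H c = cm (Suc p) H (cross p 1 c (sg (aff [0, 1])))"

lemma ch_unit_interval: "ch 1 {0..1} (sg (aff [0, 1::real]))"
  unfolding ch_sg by (rule smp_aff) (simp_all add: segment_convex_hull [symmetric] closed_segment_eq_real_ivl)

lemma bd_unit_interval: "bd 1 (sg (aff [0, 1::real])) = sg (aff [0]) + sg (aff [1])"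
  using bd_aff_chain [of "sg [0, 1::real]" 1] by (simp add: aff_chain_sg aff_chain_add ac_simps)

lemma ch_prism:
  assumes "ch p A c" "continuous_on (A \<times> {0..1}) H" "H ` (A \<times> {0..1}) \<subseteq> B"
  shows "ch (Suc p) B (prism p H c)"
  using ch_cross [OF assms(1) ch_unit_interval] assms(2,3) unfolding prism_def
  by (intro ch_cm) auto

lemma bd_prism:
  assumes "ch p A c"
  shows "bd (Suc p) (prism p H c) = prism (p - 1) H (bd p c) + (cm p (\<lambda>x. H (x, 0)) c + cm p (\<lambda>x. H (x, 1)) c)"
proof -
  have X: "ch (Suc p) (A \<times> {0..1}) (cross p 1 c (sg (aff [0, 1::real])))"
    using ch_cross [OF assms ch_unit_interval] by simp
  have "bd (Suc p) (prism p H c) = cm p H (bd (p + 1) (cross p 1 c (sg (aff [0, 1]))))"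
    unfolding prism_def using bd_cm_Suc [OF X, of H] by simp
  also have "\<dots> = cm p H (cross (p - 1) 1 (bd p c) (sg (aff [0, 1]))) + cm p H (cross p 0 c (sg (aff [0]) + sg (aff [1])))"
    unfolding bd_cross cm_add bd_unit_interval by simp
  also have "cm p H (cross (p - 1) 1 (bd p c) (sg (aff [0, 1]))) = prism (p - 1) H (bd p c)"
    by (cases p) (simp_all add: prism_def)
  finally show ?thesis
    by (simp only: cross_add2 cm_add cm_cross_point)
qed

text \<open>The pair is \<open>(A, A \<inter> D)\<close>; the set \<open>D\<close> need not lie in \<open>A\<close>.\<close>

definition cyc :: "nat \<Rightarrow> 'a::topological_space set \<Rightarrow> 'a set \<Rightarrow> 'a mod2_chain \<Rightarrow> bool" where
  "cyc p A D z \<longleftrightarrow> ch p A z \<and> ch (p - 1) D (bd p z)"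

definition hmg :: "nat \<Rightarrow> 'a::topological_space set \<Rightarrow> 'a set \<Rightarrow> 'a mod2_chain \<Rightarrow> 'a mod2_chain \<Rightarrow> bool" where
  "hmg p A D z w \<longleftrightarrow> (\<exists>b d. ch (Suc p) A b \<and> ch p (A \<inter> D) d \<and> z + w = bd (Suc p) b + d)"

lemma hmgI: "ch (Suc p) A b \<Longrightarrow> ch p (A \<inter> D) d \<Longrightarrow> z + w = bd (Suc p) b + d \<Longrightarrow> hmg p A D z w"
  unfolding hmg_def by metis

lemma hmgE:
  assumes "hmg p A D z w"
  obtains b d where "ch (Suc p) A b" "ch p (A \<inter> D) d" "z + w = bd (Suc p) b + d"
  using assms unfolding hmg_def by metis

lemma cyc_ch: "cyc p A D z \<Longrightarrow> ch p A z"
  by (simp add: cyc_def)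

lemma cyc_bd: "cyc p A D z \<Longrightarrow> ch (p - 1) (A \<inter> D) (bd p z)"
  unfolding cyc_def ch_Int using ch_bd by blast

lemma cyc_0 [simp]: "cyc p A D 0"
  by (simp add: cyc_def)

lemma cyc_add: "cyc p A D z \<Longrightarrow> cyc p A D w \<Longrightarrow> cyc p A D (z + w)"
  by (simp add: cyc_def bd_add ch_add)

lemma cyc_mono: "cyc p A D z \<Longrightarrow> A \<subseteq> A' \<Longrightarrow> D \<subseteq> D' \<Longrightarrow> cyc p A' D' z"
  unfolding cyc_def by (meson ch_mono)

lemma cyc_restrict: "cyc p A D z \<Longrightarrow> ch p A' z \<Longrightarrow> cyc p A' D z"
  by (simp add: cyc_def)

lemma hmg_refl: "hmg p A D z z"
  by (rule hmgI [of _ _ 0 _ 0]) simp_all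

lemma hmg_sym: "hmg p A D z w \<Longrightarrow> hmg p A D w z"
  by (simp add: hmg_def add.commute)

lemma hmg_add: assumes "hmg p A D z w" "hmg p A D z' w'" shows "hmg p A D (z + z') (w + w')"
proof -
  obtain b d where 1: "ch (Suc p) A b" "ch p (A \<inter> D) d" "z + w = bd (Suc p) b + d"
    using assms(1) by (rule hmgE)
  obtain b' d' where 2: "ch (Suc p) A b'" "ch p (A \<inter> D) d'" "z' + w' = bd (Suc p) b' + d'"
    using assms(2) by (rule hmgE)
  show ?thesis
  proof (rule hmgI)
    show "ch (Suc p) A (b + b')" "ch p (A \<inter> D) (d + d')"
      using 1 2 by (simp_all add: ch_add)
    have "z + z' + (w + w') = (z + w) + (z' + w')" by (simp add: ac_simps)
    then show "z + z' + (w + w') = bd (Suc p) (b + b') + (d + d')"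
      by (simp only: 1 2 bd_add) (simp add: ac_simps)
  qed
qed

lemma hmg_shift: "hmg p A D z w \<longleftrightarrow> hmg p A D (z + w) 0"
  by (simp add: hmg_def)

lemma hmg_trans: assumes "hmg p A D x y" "hmg p A D y z" shows "hmg p A D x z"
proof -
  have "hmg p A D (x + y + (y + z)) 0"
    using hmg_add [OF assms] unfolding hmg_shift [of p A D "x + y"] .
  moreover have "x + y + (y + z) = x + z"
    by (simp add: ac_simps)
  ultimately show ?thesis
    by (simp only: hmg_shift [of p A D x])
qed

lemma hmg_mono: "hmg p A D z w \<Longrightarrow> A \<subseteq> A' \<Longrightarrow> D \<subseteq> D' \<Longrightarrow> hmg p A' D' z w"
  unfolding hmg_def by (metis Int_mono ch_mono)

lemma hmg_off: "ch p (A \<inter> D) z \<Longrightarrow> hmg p A D z 0"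
  by (rule hmgI [of _ _ 0]) simp_all

lemma hmg_bd: "ch (Suc p) A b \<Longrightarrow> hmg p A D (bd (Suc p) b) 0"
  by (rule hmgI [of _ _ b _ 0]) simp_all

lemma cyc_hmg:
  assumes "cyc p A D z" "hmg p A D z w"
  shows "cyc p A D w"
proof -
  obtain b d where 1: "ch (Suc p) A b" "ch p (A \<inter> D) d" "z + w = bd (Suc p) b + d"
    using assms(2) by (rule hmgE)
  have w: "w = z + (bd (Suc p) b + d)"
    using 1(3) by (rule z2_cancel)
  have "ch p A d" "ch (p - 1) D (bd p d)"
    using 1(2) ch_bd by (auto simp: ch_Int)
  then show ?thesis
    using assms(1) 1(1) unfolding w cyc_def by (simp add: bd_add bd_bd ch_add ch_bd_Suc)
qed

lemma cyc_cm:
  assumes "cyc p A D z" "continuous_on A g" "g ` A \<subseteq> B" "g ` (A \<inter> D) \<subseteq> D'"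
  shows "cyc p B D' (cm p g z)"
  unfolding cyc_def
proof
  show "ch p B (cm p g z)"
    using assms by (metis cyc_ch ch_cm)
  have "ch (p - 1) D' (cm (p - 1) g (bd p z))"
    using assms by (intro ch_cm [OF cyc_bd [OF assms(1)]]) (auto intro: continuous_on_subset)
  then show "ch (p - 1) D' (bd p (cm p g z))"
    by (simp only: bd_cm [OF cyc_ch [OF assms(1)]])
qed

lemma hmg_cm:
  assumes "hmg p A D z w" "continuous_on A g" "g ` A \<subseteq> B" "g ` (A \<inter> D) \<subseteq> D'"
  shows "hmg p B D' (cm p g z) (cm p g w)"
proof -
  obtain b d where 1: "ch (Suc p) A b" "ch p (A \<inter> D) d" "z + w = bd (Suc p) b + d"
    using assms(1) by (rule hmgE)
  show ?thesis
  proof (rule hmgI)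
    show "ch (Suc p) B (cm (Suc p) g b)"
      using 1(1) assms(2,3) by (rule ch_cm)
    show "ch p (B \<inter> D') (cm p g d)"
      using assms by (intro ch_cm [OF 1(2)]) (auto intro: continuous_on_subset)
    show "cm p g z + cm p g w = bd (Suc p) (cm (Suc p) g b) + cm p g d"
      by (simp only: bd_cm_Suc [OF 1(1)] 1(3) cm_add [symmetric])
  qed
qed

lemma hmg_homotopy:
  fixes H :: "'a::topological_space \<times> real \<Rightarrow> 'b::topological_space"
  assumes z: "cyc p A D z" and H: "continuous_on (A \<times> {0..1}) H" "H ` (A \<times> {0..1}) \<subseteq> B"
    and D: "\<And>x t. x \<in> A \<Longrightarrow> x \<in> D \<Longrightarrow> t \<in> {0..1} \<Longrightarrow> H (x, t) \<in> D'"
  shows "hmg p B D' (cm p (\<lambda>x. H (x, 0)) z) (cm p (\<lambda>x. H (x, 1)) z)"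
proof (rule hmgI)
  show "ch (Suc p) B (prism p H z)"
    using ch_prism [OF cyc_ch [OF z] H] .
  \<comment> \<open>For \<open>p = 0\<close> the index \<open>p - 1\<close> is again 0 and the prism
    would have the wrong dimension; but then \<open>bd p z = 0\<close>.\<close>
  show "ch p (B \<inter> D') (prism (p - 1) H (bd p z))"
  proof (cases p)
    case (Suc q)
    have "ch (Suc (p - 1)) (B \<inter> D') (prism (p - 1) H (bd p z))"
    proof (rule ch_prism [OF cyc_bd [OF z]])
      show "continuous_on ((A \<inter> D) \<times> {0..1}) H"
        using H(1) by (rule continuous_on_subset) auto
      show "H ` ((A \<inter> D) \<times> {0..1}) \<subseteq> B \<inter> D'"
        using H(2) D by blast
    qed
    then show ?thesis by (simp add: Suc)
  qed (simp add: prism_def)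
  show "cm p (\<lambda>x. H (x, 0)) z + cm p (\<lambda>x. H (x, 1)) z = bd (Suc p) (prism p H z) + prism (p - 1) H (bd p z)"
    by (simp add: bd_prism [OF cyc_ch [OF z]] ac_simps)
qed

section \<open>Subdivision and Mayer-Vietoris\<close>

definition sd :: "nat \<Rightarrow> nat \<Rightarrow> 'a mod2_chain \<Rightarrow> 'a mod2_chain" where
  "sd N p c = rho ((singular_subdivision p ^^ N) (lift c))"

lemma sd_rho: "sd N p (rho c) = rho ((singular_subdivision p ^^ N) c)"
  unfolding sd_def by (rule rho_additive) (simp_all add: singular_subdivision_power_diff)

lemma sd_add: "sd N p (a + b) = sd N p a + sd N p b"
proof -
  have "sd N p (a + b) = sd N p (rho (lift a - lift b))"
    by (simp add: rho_diff)
  also have "\<dots> = rho ((singular_subdivision p ^^ N) (lift a - lift b))"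
    by (rule sd_rho)
  also have "\<dots> = sd N p a + sd N p b"
    by (simp only: singular_subdivision_power_diff rho_diff sd_def)
  finally show ?thesis .
qed

lemma singular_chain_subdivision_power:
  "singular_chain p X c \<Longrightarrow> singular_chain p X ((singular_subdivision p ^^ N) c)"
  by (induction N) (auto intro: singular_chain_singular_subdivision)

lemma ch_sd: "ch p S c \<Longrightarrow> ch p S (sd N p c)"
  unfolding sd_def by (intro ch_rho singular_chain_subdivision_power) (simp add: ch_lift)

lemma bd_sd:
  assumes "ch p S c" shows "bd p (sd N p c) = sd N (p - 1) (bd p c)"
proof -
  have c: "singular_chain p (top_of_set S) (lift c)"
    using assms by (simp add: ch_lift)
  have "chain_boundary p ((singular_subdivision p ^^ N) (lift c)) = (singular_subdivision (p - 1) ^^ N) (chain_boundary p (lift c))"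
  proof (induction N)
    case (Suc N)
    then show ?case
      using chain_boundary_singular_subdivision [OF singular_chain_subdivision_power [OF c, of N]] by simp
  qed simp
  then show ?thesis
    unfolding sd_def [of N p] rho_boundary [symmetric] by (simp only: sd_rho [symmetric] rho_boundary rho_lift)
qed

lemma hmg_sd:
  assumes "cyc p A D z" shows "hmg p A D z (sd N p z)"
proof -
  obtain h where h0: "\<And>p. h p 0 = (0 :: 'a chain)"
    and hd: "\<And>p c1 c2. h p (c1 - c2) = h p c1 - h p c2"
    and hc: "\<And>p X c. singular_chain p X c \<Longrightarrow> singular_chain (Suc p) X (h p c)"
    and hb: "\<And>p X c. singular_chain p X c
        \<Longrightarrow> chain_boundary (Suc p) (h p c) + h (p - Suc 0) (chain_boundary p c) = (singular_subdivision p ^^ N) c - c"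
    using chain_homotopic_iterated_singular_subdivision [of N thesis] by blast
  have z: "singular_chain p (top_of_set A) (lift z)"
    using assms by (simp add: ch_lift cyc_ch)
  have b: "singular_chain (p - 1) (top_of_set (A \<inter> D)) (lift (bd p z))"
    using cyc_bd [OF assms] by (simp add: ch_lift)
  show ?thesis
  proof (rule hmgI)
    show "ch (Suc p) A (rho (h p (lift z)))"
      by (intro ch_rho hc z)
    show "ch p (A \<inter> D) (rho (h (p - 1) (lift (bd p z))))"
    proof (cases p)
      case 0
      then show ?thesis by (simp add: h0 lift_def)
    next
      case (Suc q)
      then show ?thesis using hc [OF b] by (simp add: ch_rho)
    qed
    have "rho (h (p - 1) (lift (bd p z))) = rho (h (p - 1) (chain_boundary p (lift z)))"
      by (rule rho_additive) (simp_all add: hd rho_boundary)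
    moreover have "rho (chain_boundary (Suc p) (h p (lift z)) + h (p - Suc 0) (chain_boundary p (lift z))) = z + sd N p z"
      unfolding hb [OF z] by (simp add: rho_diff sd_def add.commute)
    ultimately show "z + sd N p z = bd (Suc p) (rho (h p (lift z))) + rho (h (p - 1) (lift (bd p z)))"
      by (simp add: rho_add rho_boundary)
  qed
qed

lemma z2_split:
  fixes c :: "'a z2"
  assumes "\<And>f. f \<in> keys c \<Longrightarrow> P f \<or> Q f"
  obtains x y where "c = x + y" "\<And>f. f \<in> keys x \<Longrightarrow> f \<in> keys c \<and> P f"
    "\<And>f. f \<in> keys y \<Longrightarrow> f \<in> keys c \<and> Q f"
proof
  let ?x = "ext (\<lambda>f. if P f then sg f else 0) c" and ?y = "ext (\<lambda>f. if P f then 0 else sg f) c"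
  have "?x + ?y = ext sg c"
    unfolding ext_plus [symmetric] by (intro ext_cong) auto
  then show "c = ?x + ?y" by simp
  show "f \<in> keys c \<and> P f" if f: "f \<in> keys ?x" for f
    using subsetD [OF keys_ext f] by (auto split: if_splits)
  show "f \<in> keys c \<and> Q f" if f: "f \<in> keys ?y" for f
    using subsetD [OF keys_ext f] assms by (auto split: if_splits)
qed

text \<open>The simplices of a fine subdivision lie in \<open>A\<close> or in \<open>B\<close>, by a
  Lebesgue number argument. The claim is made for all large \<open>N\<close>, because a chain and
  its boundary have to be subdivided equally often.\<close>

lemma sd_small:
  assumes A: "openin (top_of_set (A \<union> B)) A" and B: "openin (top_of_set (A \<union> B)) B" and c: "ch p (A \<union> B) c"
  obtains n where "\<And>N. n \<le> N \<Longrightarrow> \<exists>x y. ch p A x \<and> ch p B y \<and> sd N p c = x + y"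
proof -
  have "singular_chain p (top_of_set (A \<union> B)) (lift c)"
    using c by (simp add: ch_lift)
  then obtain n where n: "\<And>m f. \<lbrakk>n \<le> m; f \<in> keys ((singular_subdivision p ^^ m) (lift c))\<rbrakk>
                      \<Longrightarrow> \<exists>V \<in> {A, B}. f \<in> (standard_simplex p) \<rightarrow> V"
    using sufficient_iterated_singular_subdivision_exists [of "{A, B}" "top_of_set (A \<union> B)" p "lift c" thesis] A B by fastforce
  show ?thesis
  proof (rule that)
    fix N assume N: "n \<le> N"
    have s: "smp p (A \<union> B) f" if "f \<in> keys (sd N p c)" for f
      using subsetD [OF ch_sd [OF c, unfolded ch_def] that] by simp
    have V: "f ` standard_simplex p \<subseteq> A \<or> f ` standard_simplex p \<subseteq> B" if "f \<in> keys (sd N p c)" for f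
    proof -
      have "f \<in> keys ((singular_subdivision p ^^ N) (lift c))"
        using that keys_rho unfolding sd_def by (rule rev_subsetD)
      from n [OF N this] show ?thesis
        by (simp add: image_subset_iff_funcset)
    qed
    obtain x y where "sd N p c = x + y"
      and x: "\<And>f. f \<in> keys x \<Longrightarrow> f \<in> keys (sd N p c) \<and> f ` standard_simplex p \<subseteq> A"
      and y: "\<And>f. f \<in> keys y \<Longrightarrow> f \<in> keys (sd N p c) \<and> f ` standard_simplex p \<subseteq> B"
      using z2_split [of "sd N p c" "\<lambda>f. f ` standard_simplex p \<subseteq> A" "\<lambda>f. f ` standard_simplex p \<subseteq> B" thesis] V by metis
    moreover have "ch p A x" "ch p B y"
      using x y s by (auto simp: ch_def smp_altdef)
    ultimately show "\<exists>x y. ch p A x \<and> ch p B y \<and> sd N p c = x + y"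
      by blast
  qed
qed

lemma openin_restrict:
  assumes "openin (top_of_set U) A" "V \<subseteq> U"
  shows "openin (top_of_set V) (A \<inter> V)"
proof -
  obtain T where "open T" "A = U \<inter> T"
    using assms(1) unfolding openin_open by blast
  then have "open T" "A \<inter> V = V \<inter> T"
    using assms(2) by auto
  then show ?thesis
    unfolding openin_open by blast
qed

text \<open>The assumption \<open>van\<close> makes the connecting homomorphism zero, so that every
  class of the union comes from the two parts.\<close>

lemma Mayer_Vietoris_split:
  assumes oA: "openin (top_of_set (A \<union> B)) A" and oB: "openin (top_of_set (A \<union> B)) B"
    and z: "cyc p (A \<union> B) D z"
    and van: "p = 0 \<or> (\<forall>w. cyc (p - 1) (A \<inter> B) D w \<longrightarrow> hmg (p - 1) (A \<inter> B) D w 0)"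
  obtains a b where "cyc p A D a" "cyc p B D b" "hmg p (A \<union> B) D z (a + b)"
proof -
  let ?AD = "A \<inter> D" and ?BD = "B \<inter> D"
  have eq: "(A \<union> B) \<inter> D = ?AD \<union> ?BD" by blast
  have o: "openin (top_of_set (?AD \<union> ?BD)) ?AD" "openin (top_of_set (?AD \<union> ?BD)) ?BD"
  proof -
    have "?AD = A \<inter> (?AD \<union> ?BD)" "?BD = B \<inter> (?AD \<union> ?BD)" "?AD \<union> ?BD \<subseteq> A \<union> B"
      by blast+
    then show "openin (top_of_set (?AD \<union> ?BD)) ?AD" "openin (top_of_set (?AD \<union> ?BD)) ?BD"
      using openin_restrict [OF oA] openin_restrict [OF oB] by metis+
  qed
  obtain n1 where n1: "\<And>N. n1 \<le> N \<Longrightarrow> \<exists>x y. ch p A x \<and> ch p B y \<and> sd N p z = x + y"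
    using sd_small [OF oA oB cyc_ch [OF z]] by metis
  have "ch (p - 1) (?AD \<union> ?BD) (bd p z)"
    using cyc_bd [OF z] by (simp only: eq)
  then obtain n2 where n2: "\<And>N. n2 \<le> N \<Longrightarrow> \<exists>x y. ch (p - 1) ?AD x \<and> ch (p - 1) ?BD y \<and> sd N (p - 1) (bd p z) = x + y"
    using sd_small [OF o] by metis
  define N where "N = max n1 n2"
  obtain x y where x: "ch p A x" and y: "ch p B y" and xy: "sd N p z = x + y"
    using n1 [of N] by (auto simp: N_def)
  obtain u v where u: "ch (p - 1) ?AD u" and v: "ch (p - 1) ?BD v" and uv: "sd N (p - 1) (bd p z) = u + v"
    using n2 [of N] by (auto simp: N_def)
  have uA: "ch (p - 1) A u" and uD: "ch (p - 1) D u" and vB: "ch (p - 1) B v" and vD: "ch (p - 1) D v"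
    using u v by (simp_all add: ch_Int)
  show ?thesis
  proof (cases p)
    case 0
    then show ?thesis
      using x y xy hmg_sd [OF z, of N] by (intro that [of x y]) (auto simp: cyc_def)
  next
    case (Suc q)
    have bxy: "bd p x + bd p y = u + v"
      using bd_sd [OF cyc_ch [OF z], of N] by (simp only: xy uv bd_add)
    \<comment> \<open>\<open>w\<close> represents the image of \<open>z\<close> under the connecting
      homomorphism: expressed through \<open>x\<close> it lies in \<open>A\<close>, through
      \<open>y\<close> in \<open>B\<close>.\<close>
    define w where "w = bd p x + u"
    have w2: "w = bd p y + v"
      unfolding w_def using z2_cancel [OF bxy] by (simp only: ac_simps z2_self_left)
    have "cyc q (A \<inter> B) D w"
      unfolding cyc_def
    proof
      have "ch q A w"
        using ch_bd [OF x] uA by (simp add: w_def Suc ch_add)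
      moreover have "ch q B w"
        using ch_bd [OF y] vB by (simp add: w2 Suc ch_add)
      ultimately show "ch q (A \<inter> B) w" by (simp add: ch_Int)
      show "ch (q - 1) D (bd q w)"
        using bd_bd [of q A x] x ch_bd [OF uD] by (simp add: w_def Suc bd_add)
    qed
    then have "hmg q (A \<inter> B) D w 0"
      using van Suc by simp
    then obtain b d where b: "ch (Suc q) (A \<inter> B) b" "ch q (A \<inter> B \<inter> D) d" "w + 0 = bd (Suc q) b + d"
      by (rule hmgE)
    \<comment> \<open>\<open>b\<close> fills \<open>w\<close> modulo \<open>D\<close>. Added to both
      \<open>x\<close> and \<open>y\<close> it makes them relative cycles, and it cancels in their
      sum.\<close>
    have wb: "bd p b = w + d"
      using b(3) by (simp add: Suc)
    have dD: "ch q D d"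
      using b(2) by (simp add: ch_Int)
    show ?thesis
    proof (rule that)
      have "ch p A b" "ch p B b"
        using b(1) by (simp_all add: ch_Int Suc)
      moreover have "bd p (x + b) = u + d"
        by (simp add: bd_add wb) (simp add: w_def ac_simps)
      moreover have "bd p (y + b) = v + d"
        by (simp add: bd_add wb) (simp add: w2 ac_simps)
      moreover have "ch q D u" "ch q D v"
        using uD vD by (simp_all add: Suc)
      ultimately show "cyc p A D (x + b)" "cyc p B D (y + b)"
        using x y dD unfolding cyc_def by (simp_all add: ch_add) (simp_all add: Suc ch_add)
      have "x + b + (y + b) = sd N p z"
        by (simp add: xy ac_simps)
      then show "hmg p (A \<union> B) D z (x + b + (y + b))"
        using hmg_sd [OF z, of N] by simp
    qed
  qed
qed

text \<open>After subdivision the bounding chain in the union splits into one part in each set;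
  moving each cycle across its own part yields the same cycle, which then lies in the
  intersection.\<close>

lemma Mayer_Vietoris_join:
  assumes oA: "openin (top_of_set (A \<union> B)) A" and oB: "openin (top_of_set (A \<union> B)) B"
    and a: "cyc p A D a" and b: "cyc p B D b" and h: "hmg p (A \<union> B) D a b"
  obtains w where "cyc p (A \<inter> B) D w" "hmg p A D a w" "hmg p B D b w"
proof -
  let ?AD = "A \<inter> D" and ?BD = "B \<inter> D"
  have eq: "(A \<union> B) \<inter> D = ?AD \<union> ?BD" by blast
  have o: "openin (top_of_set (?AD \<union> ?BD)) ?AD" "openin (top_of_set (?AD \<union> ?BD)) ?BD"
  proof -
    have "?AD = A \<inter> (?AD \<union> ?BD)" "?BD = B \<inter> (?AD \<union> ?BD)" "?AD \<union> ?BD \<subseteq> A \<union> B"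
      by blast+
    then show "openin (top_of_set (?AD \<union> ?BD)) ?AD" "openin (top_of_set (?AD \<union> ?BD)) ?BD"
      using openin_restrict [OF oA] openin_restrict [OF oB] by metis+
  qed
  obtain e d where e: "ch (Suc p) (A \<union> B) e" and d: "ch p ((A \<union> B) \<inter> D) d" and ed: "a + b = bd (Suc p) e + d"
    using h by (rule hmgE)
  obtain n1 where n1: "\<And>N. n1 \<le> N \<Longrightarrow> \<exists>x y. ch (Suc p) A x \<and> ch (Suc p) B y \<and> sd N (Suc p) e = x + y"
    using sd_small [OF oA oB e] by metis
  obtain n2 where n2: "\<And>N. n2 \<le> N \<Longrightarrow> \<exists>x y. ch p ?AD x \<and> ch p ?BD y \<and> sd N p d = x + y"
    using sd_small [OF o d [unfolded eq]] by metis
  define N where "N = max n1 n2"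
  obtain x y where x: "ch (Suc p) A x" and y: "ch (Suc p) B y" and xy: "sd N (Suc p) e = x + y"
    using n1 [of N] by (auto simp: N_def)
  obtain u v where u: "ch p ?AD u" and v: "ch p ?BD v" and uv: "sd N p d = u + v"
    using n2 [of N] by (auto simp: N_def)
  have s: "sd N p a + sd N p b = bd (Suc p) x + bd (Suc p) y + (u + v)"
    using arg_cong [OF ed, of "sd N p"] bd_sd [OF e, of N] by (simp add: sd_add xy uv bd_add)
  define w where "w = sd N p a + (bd (Suc p) x + u)"
  have w2: "w = sd N p b + (bd (Suc p) y + v)"
    unfolding w_def using z2_cancel [OF s] by (simp add: ac_simps)
  have ha: "hmg p A D a w"
  proof (rule hmg_trans [OF hmg_sd [OF a, of N]])
    show "hmg p A D (sd N p a) w"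
      by (rule hmgI [OF x u]) (simp add: w_def)
  qed
  have hb: "hmg p B D b w"
  proof (rule hmg_trans [OF hmg_sd [OF b, of N]])
    show "hmg p B D (sd N p b) w"
      by (rule hmgI [OF y v]) (simp add: w2)
  qed
  have "cyc p A D w" "cyc p B D w"
    using ha hb cyc_hmg a b by blast+
  then have "cyc p (A \<inter> B) D w"
    by (simp add: cyc_def ch_Int)
  then show ?thesis
    using that ha hb by blast
qed

text \<open>With straight-line homotopies only segments have to be checked; nearly all deformations
  below are of this kind.\<close>

lemma hmg_linear:
  fixes g0 g1 :: "'a::topological_space \<Rightarrow> 'b::real_normed_vector"
  assumes z: "cyc p A D z" and c: "continuous_on A g0" "continuous_on A g1"
    and B: "\<And>x. x \<in> A \<Longrightarrow> closed_segment (g0 x) (g1 x) \<subseteq> B"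
    and D: "\<And>x. x \<in> A \<Longrightarrow> x \<in> D \<Longrightarrow> closed_segment (g0 x) (g1 x) \<subseteq> D'"
  shows "hmg p B D' (cm p g0 z) (cm p g1 z)"
proof -
  let ?H = "\<lambda>(x, t). (1 - t) *\<^sub>R g0 x + t *\<^sub>R g1 x"
  have seg: "?H (x, t) \<in> closed_segment (g0 x) (g1 x)" if "t \<in> {0..1}" for x t
    using that by (auto simp: in_segment)
  have "continuous_on (A \<times> {0..1}) (\<lambda>x. g0 (fst x))" "continuous_on (A \<times> {0..1}) (\<lambda>x. g1 (fst x))"
    using c by (auto intro: continuous_on_compose2 [OF _ continuous_on_fst])
  then have "continuous_on (A \<times> {0..1}) ?H"
    unfolding split_def by (intro continuous_intros)
  moreover have "?H ` (A \<times> {0..1}) \<subseteq> B"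
    using seg B by fast
  ultimately have "hmg p B D' (cm p (\<lambda>x. ?H (x, 0)) z) (cm p (\<lambda>x. ?H (x, 1)) z)"
    using seg D by (intro hmg_homotopy [OF z]) blast+
  then show ?thesis by simp
qed

section \<open>Degree of chains at the origin\<close>

definition snoc :: "'a \<Rightarrow> 'a list z2 \<Rightarrow> 'a list z2" where
  "snoc x c = ext (\<lambda>l. sg (l @ [x])) c"

lemma snoc_add: "snoc x (a + b) = snoc x a + snoc x b"
  by (simp add: snoc_def ext_add)

lemma snoc_sg [simp]: "snoc x (sg l) = sg (l @ [x])"
  by (simp add: snoc_def)

lemma snoc_0 [simp]: "snoc x 0 = 0"
  by (simp add: snoc_def)

lemma ext_lb_snoc: "ext lb (snoc x c) = snoc x (ext lb c) + c"
  by (simp add: snoc_def ext_ext lb_snoc ext_plus)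

lemma keys_snoc: "keys (snoc x c) \<subseteq> (\<lambda>l. l @ [x]) ` keys c"
  unfolding snoc_def using keys_ext [of "\<lambda>l. sg (l @ [x])" c] by auto

lemma ext_map_snoc: "ext (\<lambda>l. sg (map f l)) (snoc x c) = snoc (f x) (ext (\<lambda>l. sg (map f l)) c)"
  by (simp add: snoc_def ext_ext)

text \<open>The model space is the span \<open>V\<close> of part of the standard basis, so its
  dimension is the length of a list. The order of the list drives the induction over
  dimension.\<close>

locale frame =
  fixes bs :: "'a::euclidean_space list"
  assumes dist: "distinct bs" and basis: "set bs \<subseteq> Basis"
begin

abbreviation V :: "'a set" where "V \<equiv> span (set bs)"

text \<open>The complement of the subspace where the first \<open>i\<close> coordinates vanish: the
  homology of \<open>(V, Dn i)\<close> is that of an \<open>i\<close>-space relative to the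
  complement of its origin. For \<open>i\<close> the length of \<open>bs\<close> it contains all
  nonzero points of \<open>V\<close>, see \<open>V_Dn\<close>.\<close>

definition Dn :: "nat \<Rightarrow> 'a set" where "Dn i = {x. \<exists>l<i. x \<bullet> bs ! l \<noteq> 0}"

text \<open>\<open>W i\<close> is the boundary of the cross-polytope with vertices \<open>\<plusminus>bs ! l\<close> for \<open>l < i\<close>, and \<open>Z i\<close>
  is the cone over it from the origin.\<close>

primrec W :: "nat \<Rightarrow> 'a list z2" where
  "W 0 = sg []"
| "W (Suc i) = snoc (bs ! i) (W i) + snoc (- bs ! i) (W i)"

definition Z :: "nat \<Rightarrow> 'a mod2_chain" where
  "Z i = aff_chain (snoc 0 (W i))"

lemma orthonormal: "i < length bs \<Longrightarrow> j < length bs \<Longrightarrow> bs ! i \<bullet> bs ! j = (if i = j then 1 else 0)"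
  using dist basis by (simp add: inner_Basis nth_eq_iff_index_eq subset_iff)

lemma bs_in_V: "i < length bs \<Longrightarrow> bs ! i \<in> V" "i < length bs \<Longrightarrow> - bs ! i \<in> V"
  by (simp_all add: span_base span_neg)

lemma lb_W: "ext lb (W i) = 0"
  by (induction i) (simp_all add: ext_add ext_lb_snoc)

lemma W_uminus: "ext (\<lambda>l. sg (map uminus l)) (W i) = W i"
  by (induction i) (simp_all add: ext_add ext_map_snoc ac_simps)

lemma W_length: "l \<in> keys (W i) \<Longrightarrow> length l = i"
proof (induction i arbitrary: l)
  case (Suc i)
  then show ?case
    using keys_snoc [of "bs ! i" "W i"] keys_snoc [of "- bs ! i" "W i"] by (auto simp: keys_z2_add)
qed simp

lemma keys_W_Suc:
  assumes "l \<in> keys (W (Suc i))"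
  obtains k c where "k \<in> keys (W i)" "c = 1 \<or> c = - 1" "l = k @ [c *\<^sub>R bs ! i]"
proof -
  have "l \<in> keys (snoc (bs ! i) (W i)) \<or> l \<in> keys (snoc (- bs ! i) (W i))"
    using assms by (auto simp: keys_z2_add)
  then show ?thesis
    using subsetD [OF keys_snoc, of l "bs ! i"] subsetD [OF keys_snoc, of l "- bs ! i"] that [of _ 1] that [of _ "-1"]
    by auto
qed

lemma W_set:
  "l \<in> keys (W i) \<Longrightarrow> i \<le> length bs \<Longrightarrow> set l \<subseteq> {x\<in>V. \<forall>j. i \<le> j \<longrightarrow> j < length bs \<longrightarrow> x \<bullet> bs ! j = 0}"
proof (induction i arbitrary: l)
  case (Suc i)
  obtain k c where k: "k \<in> keys (W i)" "l = k @ [c *\<^sub>R bs ! i]"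
    using keys_W_Suc [OF Suc.prems(1)] by metis
  have "set k \<subseteq> {x\<in>V. \<forall>j. i \<le> j \<longrightarrow> j < length bs \<longrightarrow> x \<bullet> bs ! j = 0}"
    using Suc.IH k(1) Suc.prems by simp
  moreover have "c *\<^sub>R bs ! i \<in> V"
    using Suc.prems by (simp add: bs_in_V span_scale)
  ultimately show ?case
    using Suc.prems k(2) by (auto simp: orthonormal)
qed simp

lemma W_hull0:
  assumes "l \<in> keys (W i)" "i \<le> length bs" "x \<in> convex hull (set l)"
  shows "x \<in> V" "i \<le> j \<Longrightarrow> j < length bs \<Longrightarrow> x \<bullet> bs ! j = 0"
proof -
  let ?C = "{x\<in>V. \<forall>j. i \<le> j \<longrightarrow> j < length bs \<longrightarrow> x \<bullet> bs ! j = 0}"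
  have "convex ?C"
    unfolding convex_def by (auto simp: span_add span_scale inner_left_distrib)
  then have "convex hull (set l) \<subseteq> ?C"
    using W_set [OF assms(1,2)] by (intro hull_minimal)
  with assms(3) show "x \<in> V" "i \<le> j \<Longrightarrow> j < length bs \<Longrightarrow> x \<bullet> bs ! j = 0"
    by auto
qed

text \<open>In a cone with apex \<open>\<plusminus>bs ! i\<close> over a face, the coordinate along
  \<open>bs ! i\<close> is, up to sign, the weight of the apex. Where it vanishes the point lies in
  the base, which is inside \<open>Dn i\<close> by induction.\<close>

lemma W_hull:
  "l \<in> keys (W i) \<Longrightarrow> i \<le> length bs \<Longrightarrow> x \<in> convex hull (set l) \<Longrightarrow> x \<in> Dn i"
  and W_hull_snoc: "l \<in> keys (W i) \<Longrightarrow> i < length bs \<Longrightarrow> c = 1 \<or> c = - 1 \<Longrightarrow>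
      x \<in> convex hull (set (l @ [c *\<^sub>R bs ! i])) \<Longrightarrow> x \<in> V \<and> 0 \<le> c * (x \<bullet> bs ! i) \<and> (x \<in> Dn i \<or> 0 < c * (x \<bullet> bs ! i))"
proof -
  have step: "x \<in> V \<and> 0 \<le> c * (x \<bullet> bs ! i) \<and> (x \<in> Dn i \<or> 0 < c * (x \<bullet> bs ! i))"
    if l: "l \<in> keys (W i)" and i: "i < length bs" and c: "c = 1 \<or> c = - 1"
      and x: "x \<in> convex hull (set (l @ [c *\<^sub>R bs ! i]))" and IH: "\<And>y. y \<in> convex hull (set l) \<Longrightarrow> y \<in> Dn i"
    for l i c x
  proof -
    have cV: "c *\<^sub>R bs ! i \<in> V"
      using i by (simp add: bs_in_V span_scale)
    have cc: "c * c = 1" using c by auto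
    show ?thesis
    proof (cases "l = []")
      case True
      then have "x = c *\<^sub>R bs ! i" using x by simp
      then show ?thesis using cV i cc by (simp add: orthonormal)
    next
      case False
      have "x \<in> convex hull (insert (c *\<^sub>R bs ! i) (set l))"
        using x by simp
      then obtain u w y where uw: "0 \<le> u" "0 \<le> w" "u + w = 1" and y: "y \<in> convex hull (set l)"
        and xe: "x = u *\<^sub>R c *\<^sub>R bs ! i + w *\<^sub>R y"
        using False by (auto simp: convex_hull_insert simp del: scaleR_scaleR)
      have yV: "y \<in> V" and yi: "y \<bullet> bs ! i = 0"
        using W_hull0 [OF l _ y] i by auto
      have xi: "c * (x \<bullet> bs ! i) = u"
        using i cc by (simp add: xe inner_left_distrib yi orthonormal algebra_simps)
      have "x \<in> V"
        using yV cV by (simp add: xe span_add span_scale del: scaleR_scaleR)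
      moreover have "x \<in> Dn i" if "u = 0"
        using that uw IH [OF y] by (simp add: xe)
      ultimately show ?thesis
        using xi uw by fastforce
    qed
  qed
  show main: "x \<in> Dn i" if "l \<in> keys (W i)" "i \<le> length bs" "x \<in> convex hull (set l)" for l i x
    using that
  proof (induction i arbitrary: l x)
    case (Suc i)
    obtain k c where k: "k \<in> keys (W i)" "c = 1 \<or> c = - 1" "l = k @ [c *\<^sub>R bs ! i]"
      using keys_W_Suc [OF Suc.prems(1)] by metis
    have "x \<in> Dn i \<or> 0 < c * (x \<bullet> bs ! i)"
      using step [OF k(1) _ k(2), of x] Suc k by simp
    then show ?case
      unfolding Dn_def by (auto simp: less_Suc_eq)
  qed simp
  show "x \<in> V \<and> 0 \<le> c * (x \<bullet> bs ! i) \<and> (x \<in> Dn i \<or> 0 < c * (x \<bullet> bs ! i))"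
    if "l \<in> keys (W i)" "i < length bs" "c = 1 \<or> c = - 1" "x \<in> convex hull (set (l @ [c *\<^sub>R bs ! i]))"
    using step [OF that] main that by simp
qed

lemma Dn_Suc: "Dn (Suc i) = Dn i \<union> {x. x \<bullet> bs ! i < 0} \<union> {x. 0 < x \<bullet> bs ! i}"
  by (auto simp: Dn_def less_Suc_eq)

lemma open_Dn: "open (Dn i)"
proof -
  have "Dn i = (\<Union>l\<in>{..<i}. {x. x \<bullet> bs ! l \<noteq> 0})"
    by (auto simp: Dn_def)
  moreover have "open {x. x \<bullet> bs ! l \<noteq> 0}" for l
    by (intro open_Collect_neq continuous_intros)
  ultimately show ?thesis by auto
qed

lemma Dn_add: "x \<in> Dn i \<Longrightarrow> i < length bs \<Longrightarrow> x + c *\<^sub>R bs ! i \<in> Dn i"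
  unfolding Dn_def by (auto simp: inner_left_distrib orthonormal)

lemma Dn_hull_convex:
  assumes "x \<in> Dn i" "i < length bs" "y = x + c *\<^sub>R bs ! i"
  shows "closed_segment x y \<subseteq> Dn i"
proof
  fix w assume "w \<in> closed_segment x y"
  then obtain u where "w = (1 - u) *\<^sub>R x + u *\<^sub>R y" by (auto simp: in_segment)
  then have "w = x + (u * c) *\<^sub>R bs ! i"
    by (simp add: assms(3) algebra_simps)
  then show "w \<in> Dn i"
    using Dn_add [OF assms(1,2), of "u * c"] by simp
qed

lemma convex_V: "convex V"
  by (simp add: subspace_imp_convex)

text \<open>Translation against \<open>bs ! i\<close> keeps the other coordinates and preserves the
  negative side, and the amount \<open>\<bar>x \<bullet> bs ! i\<bar> + 1\<close> moves every point
  to that side.\<close>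

lemma push_down:
  assumes i: "i < length bs" and z: "cyc p V (Dn i \<union> {x. x \<bullet> bs ! i < 0}) z"
  shows "hmg p V (Dn i \<union> {x. x \<bullet> bs ! i < 0}) z 0"
proof -
  let ?b = "bs ! i" and ?E = "Dn i \<union> {x. x \<bullet> bs ! i < 0}"
  let ?g = "\<lambda>x. x - (\<bar>x \<bullet> ?b\<bar> + 1) *\<^sub>R ?b"
  have bb: "?b \<bullet> ?b = 1" using orthonormal [OF i i] by simp
  have gV: "?g x \<in> V" if "x \<in> V" for x
    using that i by (intro span_diff span_scale bs_in_V)
  have 1: "hmg p V ?E (cm p (\<lambda>x. x) z) (cm p ?g z)"
  proof (rule hmg_linear [OF z])
    show "continuous_on V ?g" by (intro continuous_intros)
    show "closed_segment x (?g x) \<subseteq> V" if "x \<in> V" for x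
      using that gV convex_V by (intro closed_segment_subset)
    show "closed_segment x (?g x) \<subseteq> ?E" if "x \<in> V" "x \<in> ?E" for x
    proof (cases "x \<in> Dn i")
      case True
      then show ?thesis
        using Dn_hull_convex [OF True i, of "?g x" "- (\<bar>x \<bullet> ?b\<bar> + 1)"] by (auto simp: algebra_simps)
    next
      case False
      then have x: "x \<bullet> ?b < 0" using that by simp
      moreover have "?g x \<bullet> ?b < 0"
        using x by (simp add: inner_diff_left bb)
      moreover have "convex {x. x \<bullet> ?b < 0}"
        using convex_halfspace_lt [of ?b 0] by (simp add: inner_commute)
      ultimately have "closed_segment x (?g x) \<subseteq> {x. x \<bullet> ?b < 0}"
        by (intro closed_segment_subset) auto
      then show ?thesis by blast
    qed
  qed simp
  have 2: "cm p (\<lambda>x. x) z = z"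
    by (rule cm_ident [OF cyc_ch [OF z]]) simp
  have 3: "hmg p V ?E (cm p ?g z) 0"
  proof (rule hmg_off, rule ch_cm [OF cyc_ch [OF z]])
    show "continuous_on V ?g" by (intro continuous_intros)
    have "?g x \<bullet> ?b < 0" for x
      by (simp add: inner_diff_left bb)
    then show "?g ` V \<subseteq> V \<inter> ?E"
      using gV by blast
  qed
  show ?thesis
    using hmg_trans [OF 1 3] by (simp only: 2)
qed

text \<open>Translation along \<open>bs ! i\<close> maps all of \<open>V\<close> into the positive
  half-space and keeps \<open>Dn i\<close>. It carries a null-homology of \<open>q\<close> into the
  half-space, where \<open>q\<close> is homotopic to its translate.\<close>

lemma push_up:
  assumes i: "i < length bs" and q: "cyc p (V \<inter> {x. 0 < x \<bullet> bs ! i}) (Dn i) q"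
    and h: "hmg p V (Dn i) q 0"
  shows "hmg p (V \<inter> {x. 0 < x \<bullet> bs ! i}) (Dn i) q 0"
proof -
  let ?b = "bs ! i" and ?A = "V \<inter> {x. 0 < x \<bullet> bs ! i}"
  let ?g = "\<lambda>x. x + (\<bar>x \<bullet> ?b\<bar> + 1) *\<^sub>R ?b"
  have bb: "?b \<bullet> ?b = 1" using orthonormal [OF i i] by simp
  have gV: "?g x \<in> ?A" if "x \<in> V" for x
  proof -
    have "0 < x \<bullet> ?b + \<bar>x \<bullet> ?b\<bar> + 1"
      using abs_ge_minus_self [of "x \<bullet> ?b"] by linarith
    then show ?thesis
      using that i by (simp add: inner_left_distrib bb span_add span_scale bs_in_V algebra_simps)
  qed
  have "convex {x. 0 < x \<bullet> ?b}"
    using convex_halfspace_gt [of 0 ?b] by (simp add: inner_commute)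
  then have convA: "convex ?A"
    by (intro convex_Int convex_V)
  have 1: "hmg p ?A (Dn i) (cm p (\<lambda>x. x) q) (cm p ?g q)"
  proof (rule hmg_linear [OF q])
    show "continuous_on ?A ?g" by (intro continuous_intros)
    show "closed_segment x (?g x) \<subseteq> ?A" if "x \<in> ?A" for x
      by (rule closed_segment_subset [OF that gV [OF IntD1 [OF that]] convA])
    show "closed_segment x (?g x) \<subseteq> Dn i" if "x \<in> Dn i" for x
      by (rule Dn_hull_convex [OF that i refl])
  qed simp
  have 2: "cm p (\<lambda>x. x) q = q"
    by (rule cm_ident [OF cyc_ch [OF q]]) simp
  have 3: "hmg p ?A (Dn i) (cm p ?g q) (cm p ?g 0)"
  proof (rule hmg_cm [OF h])
    show "continuous_on V ?g" by (intro continuous_intros)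
    show "?g ` V \<subseteq> ?A" using gV by blast
    show "?g ` (V \<inter> Dn i) \<subseteq> Dn i" using Dn_add [OF _ i] by blast
  qed
  show ?thesis
    using hmg_trans [OF 1 3] by (simp only: 2 cm_0)
qed

text \<open>Injectivity of the suspension step. If \<open>q\<close> is filled by a chain
  \<open>a\<close> in the positive half-space, then \<open>z + a\<close> has its boundary in the set
  to which \<open>push_down\<close> applies, and \<open>a\<close> itself avoids the
  subspace.\<close>

lemma null_if_upper_part_null:
  assumes i: "i < length bs" and z: "cyc (Suc p) V (Dn (Suc i)) z"
    and bz: "bd (Suc p) z = q + u"
    and q: "ch p (V \<inter> {x. 0 < x \<bullet> bs ! i}) q" and u: "ch p (V \<inter> (Dn i \<union> {x. x \<bullet> bs ! i < 0})) u"
    and h: "hmg p V (Dn i) q 0"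
  shows "hmg (Suc p) V (Dn (Suc i)) z 0"
proof -
  let ?A = "V \<inter> {x. 0 < x \<bullet> bs ! i}" and ?E = "Dn i \<union> {x. x \<bullet> bs ! i < 0}"
  have "bd p q = bd p u"
    using bd_bd [OF cyc_ch [OF z]] unfolding bz bd_add by (rule z2_eq_iff [THEN iffD2])
  then have "ch (p - 1) (?A \<inter> (V \<inter> ?E)) (bd p q)"
    using ch_bd [OF q] ch_bd [OF u] by (simp add: ch_Int)
  then have "ch (p - 1) (Dn i) (bd p q)"
    by (rule ch_mono) auto
  then have "cyc p ?A (Dn i) q"
    using q by (simp add: cyc_def)
  from push_up [OF i this h] obtain a d where a: "ch (Suc p) ?A a" and d: "ch p (?A \<inter> Dn i) d" and ad: "q + 0 = bd (Suc p) a + d"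
    by (rule hmgE)
  have "cyc (Suc p) V ?E (z + a)"
    unfolding cyc_def
  proof
    show "ch (Suc p) V (z + a)"
      using cyc_ch [OF z] ch_mono [OF a, of V] by (intro ch_add) auto
    have "bd (Suc p) (z + a) = u + d"
      using ad by (simp add: bd_add bz ac_simps)
    moreover have "ch p ?E u" "ch p ?E d"
      using ch_mono [OF u, of ?E] ch_mono [OF d, of ?E] by auto
    ultimately show "ch (Suc p - 1) ?E (bd (Suc p) (z + a))"
      by (simp add: ch_add)
  qed
  from push_down [OF i this] have "hmg (Suc p) V (Dn (Suc i)) (z + a) 0"
    by (rule hmg_mono) (auto simp: Dn_Suc)
  moreover have "hmg (Suc p) V (Dn (Suc i)) a 0"
    by (rule hmg_off, rule ch_mono [OF a]) (auto simp: Dn_Suc)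
  ultimately have "hmg (Suc p) V (Dn (Suc i)) (z + a + a) (0 + 0)"
    by (rule hmg_add)
  then show ?thesis by (simp add: ac_simps)
qed

end

lemma ch_empty: "ch p {} c \<Longrightarrow> c = 0"
proof -
  assume c: "ch p {} c"
  have "\<not> smp p ({}::'a set) s" for s
    using singular_simplex_empty [of "top_of_set ({}::'a set)" p s] by simp
  then have "keys c = {}"
    using c unfolding ch_def by blast
  then show "c = 0"
    using z2_expand [of c] by simp
qed

context frame
begin

text \<open>The boundary of \<open>Z (Suc i)\<close> consists of the cones over \<open>W i\<close>
  with apexes \<open>bs ! i\<close> and \<open>- bs ! i\<close>. The first lies only in the closed
  half-space, so it is shifted by \<open>bs ! i\<close> into the open one, and \<open>c\<close> is
  the trace of the shift. Projection along \<open>bs ! i\<close> sends its apex to 0 and fixes the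
  base, which identifies its class with that of \<open>Z i\<close>.\<close>

lemma Z_Suc_deform:
  assumes i: "i < length bs"
  obtains c q u where "ch (Suc i) (V \<inter> Dn (Suc i)) c" "bd (Suc i) (Z (Suc i) + c) = q + u"
    "ch i (V \<inter> {x. 0 < x \<bullet> bs ! i}) q" "ch i (V \<inter> (Dn i \<union> {x. x \<bullet> bs ! i < 0})) u"
    "cyc i V (Dn i) q" "hmg i V (Dn i) q (Z i)"
proof -
  let ?b = "bs ! i" and ?E = "Dn i \<union> {x. x \<bullet> bs ! i < 0}"
  have bb: "?b \<bullet> ?b = 1" using orthonormal [OF i i] by simp
  have hull: "x \<in> V \<and> 0 \<le> x \<bullet> ?b \<and> (x \<in> Dn i \<or> 0 < x \<bullet> ?b)"
    if "l \<in> keys (W i)" "x \<in> convex hull (set (l @ [?b]))" for l x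
    using W_hull_snoc [OF that(1) i, of 1 x] that(2) by simp
  have hull': "x \<in> V \<and> x \<bullet> ?b \<le> 0 \<and> (x \<in> Dn i \<or> x \<bullet> ?b < 0)"
    if "l \<in> keys (W i)" "x \<in> convex hull (set (l @ [- ?b]))" for l x
    using W_hull_snoc [OF that(1) i, of "-1" x] that(2) by simp
  have lenW: "length l = Suc i" if "l \<in> keys (snoc x (W i))" for l x
    using subsetD [OF keys_snoc that] W_length by auto
  define q0 where "q0 = aff_chain (snoc ?b (W i))"
  define r0 where "r0 = aff_chain (snoc (- ?b) (W i))"
  let ?A = "V \<inter> {x. 0 \<le> x \<bullet> ?b} \<inter> Dn (Suc i)"
  have q0: "ch i ?A q0"
    unfolding q0_def
  proof (rule ch_aff_chain, intro conjI)
    fix l assume l: "l \<in> keys (snoc ?b (W i))"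
    then show "length l = Suc i" by (rule lenW)
    obtain k where "k \<in> keys (W i)" "l = k @ [?b]"
      using subsetD [OF keys_snoc l] by auto
    then show "convex hull (set l) \<subseteq> ?A"
      using hull [of k] by (fastforce simp: Dn_Suc)
  qed
  have r0: "ch i (V \<inter> ?E) r0"
    unfolding r0_def
  proof (rule ch_aff_chain, intro conjI)
    fix l assume l: "l \<in> keys (snoc (- ?b) (W i))"
    then show "length l = Suc i" by (rule lenW)
    obtain k where "k \<in> keys (W i)" "l = k @ [- ?b]"
      using subsetD [OF keys_snoc l] by auto
    then show "convex hull (set l) \<subseteq> V \<inter> ?E"
      using hull' [of k] by fastforce
  qed
  have bq0: "bd i q0 = aff_chain (W i)"
    unfolding q0_def by (subst bd_aff_chain [OF lenW]) (simp_all add: ext_lb_snoc lb_W)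
  have RW: "ch (i - 1) (Dn i) (aff_chain (W i))"
  proof (cases i)
    case (Suc j)
    show ?thesis
    proof (rule ch_aff_chain, intro conjI)
      fix l assume l: "l \<in> keys (W i)"
      show "length l = Suc (i - 1)" using W_length [OF l] Suc by simp
      show "convex hull (set l) \<subseteq> Dn i" using W_hull [OF l] i by auto
    qed
  qed (simp add: aff_chain_sg)
  have cq0: "cyc i ?A (Dn i) q0"
    using q0 RW by (simp add: cyc_def bq0)
  let ?g = "\<lambda>x. x + 1 *\<^sub>R ?b"
  define q where "q = cm i ?g q0"
  have id: "cm i (\<lambda>x. x) q0 = q0"
    by (rule cm_ident [OF q0]) simp
  have gA: "0 < ?g x \<bullet> ?b" if "x \<in> ?A" for x
    using that bb by (simp add: inner_left_distrib)
  have gV: "?g x \<in> V" if "x \<in> V" for x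
    using that i by (intro span_add span_scale bs_in_V)
  have seg: "closed_segment x (?g x) \<subseteq> V \<inter> Dn (Suc i)" if x: "x \<in> ?A" for x
  proof -
    have "closed_segment x (?g x) \<subseteq> V"
      using x gV by (intro closed_segment_subset convex_V) auto
    moreover have "closed_segment x (?g x) \<subseteq> Dn (Suc i)"
    proof
      fix w assume "w \<in> closed_segment x (?g x)"
      then obtain u where u: "0 \<le> u" "w = (1 - u) *\<^sub>R x + u *\<^sub>R (?g x)" by (auto simp: in_segment)
      then have w: "w = x + u *\<^sub>R ?b"
        by (simp add: algebra_simps)
      have wb: "w \<bullet> ?b = x \<bullet> ?b + u" by (simp add: w inner_left_distrib bb)
      show "w \<in> Dn (Suc i)"
      proof (cases "x \<in> Dn i")
        case True
        then show ?thesis using Dn_add [OF True i, of u] by (simp add: w Dn_Suc)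
      next
        case False
        then have "0 < x \<bullet> ?b" using x by (auto simp: Dn_Suc)
        then show ?thesis using wb u by (simp add: Dn_Suc)
      qed
    qed
    ultimately show ?thesis by blast
  qed
  have "hmg i (V \<inter> Dn (Suc i)) (Dn i) (cm i (\<lambda>x. x) q0) (cm i ?g q0)"
  proof (rule hmg_linear [OF cq0])
    show "continuous_on ?A ?g" by (intro continuous_intros)
    show "closed_segment x (?g x) \<subseteq> V \<inter> Dn (Suc i)" if "x \<in> ?A" for x
      by (rule seg [OF that])
    show "closed_segment x (?g x) \<subseteq> Dn i" if "x \<in> Dn i" for x
      by (rule Dn_hull_convex [OF that i refl])
  qed simp
  then have h1: "hmg i (V \<inter> Dn (Suc i)) (Dn i) q0 q"
    by (simp only: id q_def)
  then obtain c d where c: "ch (Suc i) (V \<inter> Dn (Suc i)) c" and d: "ch i (V \<inter> Dn (Suc i) \<inter> Dn i) d"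
    and cd: "q0 + q = bd (Suc i) c + d"
    by (rule hmgE)
  have q: "ch i (V \<inter> {x. 0 < x \<bullet> ?b}) q"
    unfolding q_def using gA gV by (intro ch_cm [OF q0] continuous_intros) blast
  let ?pi = "\<lambda>x. x - (x \<bullet> ?b) *\<^sub>R ?b"
  have "hmg i V (Dn i) (cm i (\<lambda>x. x) q0) (cm i ?pi q0)"
  proof (rule hmg_linear [OF cq0])
    show "continuous_on ?A ?pi" by (intro continuous_intros)
    show "closed_segment x (?pi x) \<subseteq> V" if "x \<in> ?A" for x
      using that i by (intro closed_segment_subset convex_V span_diff span_scale bs_in_V) auto
    show "closed_segment x (?pi x) \<subseteq> Dn i" if "x \<in> Dn i" for x
      by (rule Dn_hull_convex [OF that i, of _ "- (x \<bullet> ?b)"]) simp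
  qed simp
  moreover have "cm i ?pi q0 = Z i"
  proof -
    have "linear ?pi"
      by (rule linearI) (simp_all add: algebra_simps)
    then have "cm i ?pi q0 = aff_chain (snoc (?pi ?b) (ext (\<lambda>l. sg (map ?pi l)) (W i)))"
      unfolding q0_def by (subst cm_aff_chain [OF _ lenW]) (simp_all add: ext_map_snoc)
    also have "ext (\<lambda>l. sg (map ?pi l)) (W i) = ext sg (W i)"
    proof (intro ext_cong refl)
      fix l assume l: "l \<in> keys (W i)"
      have "map ?pi l = l"
        using W_set [OF l] i by (intro map_idI) auto
      then show "sg (map ?pi l) = sg l" by simp
    qed
    finally show ?thesis by (simp add: bb Z_def)
  qed
  ultimately have h2: "hmg i V (Dn i) q0 (Z i)"
    by (simp only: id)
  have h3: "hmg i V (Dn i) q0 q"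
    by (rule hmg_mono [OF h1]) auto
  have "bd (Suc i) (Z (Suc i)) = aff_chain (W (Suc i))"
    unfolding Z_def
  proof (subst bd_aff_chain)
    show "length l = Suc (Suc i)" if "l \<in> keys (snoc 0 (W (Suc i)))" for l
      using subsetD [OF keys_snoc that] W_length by auto
  qed (simp_all add: ext_lb_snoc lb_W del: W.simps)
  then have bZ: "bd (Suc i) (Z (Suc i)) = q0 + r0"
    by (simp add: aff_chain_add q0_def r0_def)
  show ?thesis
  proof (rule that [of c q "r0 + d"])
    have "bd (Suc i) c = q0 + q + d"
      using cd by (simp add: ac_simps)
    then show "bd (Suc i) (Z (Suc i) + c) = q + (r0 + d)"
      by (simp add: bd_add bZ ac_simps)
    have "ch i (V \<inter> ?E) d"
      by (rule ch_mono [OF d]) auto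
    then show "ch i (V \<inter> ?E) (r0 + d)"
      using r0 by (simp add: ch_add)
    have "cyc i V (Dn i) q0"
      by (rule cyc_mono [OF cq0]) auto
    then show "cyc i V (Dn i) q"
      using h3 by (rule cyc_hmg)
    show "hmg i V (Dn i) q (Z i)"
      by (rule hmg_trans [OF hmg_sym [OF h3] h2])
  qed (rule c q)+
qed

lemma Z_ch: "i \<le> length bs \<Longrightarrow> ch i V (Z i)"
  unfolding Z_def
proof (rule ch_aff_chain, intro conjI)
  fix l assume i: "i \<le> length bs" and "l \<in> keys (snoc 0 (W i))"
  then obtain k where k: "k \<in> keys (W i)" "l = k @ [0]"
    using subsetD [OF keys_snoc] by fastforce
  then show "length l = Suc i" using W_length by auto
  have "set l \<subseteq> V"
    using W_set [OF k(1) i] by (auto simp: k span_zero)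
  then show "convex hull (set l) \<subseteq> V"
    by (intro hull_minimal convex_V)
qed

lemma Z_cyc: assumes i: "i \<le> length bs" shows "cyc i V (Dn i) (Z i)"
  unfolding cyc_def
proof
  show "ch (i - 1) (Dn i) (bd i (Z i))"
  proof (cases i)
    case (Suc j)
    have "bd i (Z i) = aff_chain (W i)"
      unfolding Z_def
    proof (subst bd_aff_chain)
      show "length l = Suc i" if "l \<in> keys (snoc 0 (W i))" for l
        using subsetD [OF keys_snoc that] W_length by auto
    qed (simp_all add: ext_lb_snoc lb_W del: W.simps)
    moreover have "ch (i - 1) (Dn i) (aff_chain (W i))"
    proof (rule ch_aff_chain, intro conjI)
      fix l assume l: "l \<in> keys (W i)"
      show "length l = Suc (i - 1)" using W_length [OF l] Suc by simp
      show "convex hull (set l) \<subseteq> Dn i" using W_hull [OF l] i by auto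
    qed
    ultimately show ?thesis by simp
  qed simp
qed (rule Z_ch [OF i])

lemma Dn_0: "Dn 0 = {}"
  by (simp add: Dn_def)

lemma Z_0: "Z 0 = sg (aff [0])"
  by (simp add: Z_def aff_chain_sg)

lemma cm_const_0: "cm 0 (\<lambda>x. 0) (sg s) = Z 0"
  unfolding Z_0 cm_sg by (rule arg_cong [where f = sg]) (auto simp: simplex_map_def aff_def fun_eq_iff)

lemma homology_V_0:
  assumes "ch 0 V z" shows "hmg 0 V {} z 0 \<or> hmg 0 V {} z (Z 0)"
proof -
  have "hmg 0 V {} (cm 0 (\<lambda>x. x) z) (cm 0 (\<lambda>x. 0) z)"
  proof (rule hmg_linear [of 0 V "{}"])
    show "closed_segment x 0 \<subseteq> V" if "x \<in> V" for x
      using that by (intro closed_segment_subset convex_V) (auto simp: span_zero)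
  qed (use assms in \<open>auto simp: cyc_def\<close>)
  moreover have "cm 0 (\<lambda>x. x) z = z"
    by (rule cm_ident [OF assms]) simp
  moreover have "cm 0 (\<lambda>x. 0::'a) z = 0 \<or> cm 0 (\<lambda>x. 0::'a) z = Z 0"
  proof -
    have "keys z \<subseteq> UNIV" by simp
    then show ?thesis
    proof (induction z rule: z2_induct [consumes 1])
      case (add a b)
      then show ?case unfolding cm_add by (metis add.left_neutral add.right_neutral z2_self)
    qed (simp_all only: cm_0 cm_const_0 simp_thms)
  qed
  ultimately show ?thesis by metis
qed

text \<open>The map to the origin makes every 1-simplex constant, so that its two end points cancel,
  but it fixes \<open>Z 0\<close>.\<close>

lemma Z_0_not_null: "\<not> hmg 0 V {} (Z 0) 0"
proof
  assume "hmg 0 V {} (Z 0) 0"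
  then obtain b d where "ch 0 {} d" and b: "ch (Suc 0) V b" "Z 0 + 0 = bd (Suc 0) b + d"
    by (auto elim: hmgE)
  then have Zb: "Z 0 = bd (Suc 0) b"
    using ch_empty by force
  have "bd (Suc 0) (cm (Suc 0) (\<lambda>x. 0::'a) c) = 0" for c :: "'a mod2_chain"
  proof -
    have "keys c \<subseteq> UNIV" by simp
    then show ?thesis
    proof (induction c rule: z2_induct [consumes 1])
      case (one s)
      have "singular_face (Suc 0) 0 (simplex_map (Suc 0) (\<lambda>x. 0::'a) s) = singular_face (Suc 0) 1 (simplex_map (Suc 0) (\<lambda>x. 0::'a) s)"
        using simplical_face_in_standard_simplex [of 1 0] simplical_face_in_standard_simplex [of 1 1]
        by (auto simp: singular_face_def simplex_map_def fun_eq_iff)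
      then show ?case
        by (simp add: bd_sg)
    qed (simp_all add: cm_add bd_add)
  qed
  then have "cm 0 (\<lambda>x. 0::'a) (Z 0) = 0"
    unfolding Zb by (simp flip: bd_cm_Suc [OF b(1)])
  then have "Z 0 = 0"
    unfolding Z_0 cm_const_0 .
  then have "keys (Z 0) = {}" by simp
  then show False by (simp add: Z_0)
qed

text \<open>Suspension: the part of the boundary in the positive half-space takes classes of
  \<open>(V, Dn (Suc i))\<close> to classes of \<open>(V, Dn i)\<close> one degree lower, and
  \<open>Z (Suc i)\<close> to \<open>Z i\<close>. Vanishing, generation and non-triviality are
  transported along it.\<close>

lemma homology_V_Dn:
  assumes "i \<le> length bs"
  shows "(\<forall>p z. p < i \<longrightarrow> cyc p V (Dn i) z \<longrightarrow> hmg p V (Dn i) z 0)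
    \<and> (\<forall>z. cyc i V (Dn i) z \<longrightarrow> hmg i V (Dn i) z 0 \<or> hmg i V (Dn i) z (Z i))
    \<and> \<not> hmg i V (Dn i) (Z i) 0"
  using assms
proof (induction i)
  case 0
  then show ?case
    using homology_V_0 Z_0_not_null by (auto simp: Dn_0 cyc_def)
next
  case (Suc i)
  let ?b = "bs ! i" and ?E = "V \<inter> (Dn i \<union> {x. x \<bullet> bs ! i < 0})" and ?H = "V \<inter> {x. 0 < x \<bullet> bs ! i}"
  let ?D = "Dn (Suc i)"
  have i: "i < length bs" using Suc.prems by simp
  have IH1: "\<And>p z. p < i \<Longrightarrow> cyc p V (Dn i) z \<Longrightarrow> hmg p V (Dn i) z 0"
    and IH2: "\<And>z. cyc i V (Dn i) z \<Longrightarrow> hmg i V (Dn i) z 0 \<or> hmg i V (Dn i) z (Z i)"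
    and IH3: "\<not> hmg i V (Dn i) (Z i) 0"
    using Suc.IH i by auto
  have VD: "V \<inter> ?D = ?E \<union> ?H" by (auto simp: Dn_Suc)
  have EH: "?E \<inter> ?H \<subseteq> V \<inter> Dn i" by auto
  have opn: "openin (top_of_set (?E \<union> ?H)) ?E" "openin (top_of_set (?E \<union> ?H)) ?H"
  proof -
    have "open (Dn i \<union> {x. x \<bullet> ?b < 0})"
      by (intro open_Un open_Dn open_Collect_less continuous_intros)
    moreover have "?E = (?E \<union> ?H) \<inter> (Dn i \<union> {x. x \<bullet> ?b < 0})" by auto
    ultimately show "openin (top_of_set (?E \<union> ?H)) ?E" by (metis openin_open)
    have "open {x. 0 < x \<bullet> ?b}"
      by (intro open_Collect_less continuous_intros)
    moreover have "?H = (?E \<union> ?H) \<inter> {x. 0 < x \<bullet> ?b}" by auto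
    ultimately show "openin (top_of_set (?E \<union> ?H)) ?H" by (metis openin_open)
  qed
  \<comment> \<open>A fine subdivision separates the boundary into \<open>q\<close> above and
    \<open>u\<close> below. Their boundaries agree and hence lie in the overlap, which is inside
    \<open>Dn i\<close>; so \<open>q\<close> is a relative cycle.\<close>
  have split: "\<exists>z' q u. hmg (Suc p) V ?D z z' \<and> cyc (Suc p) V ?D z' \<and> bd (Suc p) z' = q + u \<and>
        ch p ?H q \<and> ch p ?E u \<and> cyc p V (Dn i) q" if z: "cyc (Suc p) V ?D z" for p z
  proof -
    have "ch p (?E \<union> ?H) (bd (Suc p) z)"
      using cyc_bd [OF z] by (simp only: VD diff_Suc_1)
    then obtain N where "\<exists>x y. ch p ?E x \<and> ch p ?H y \<and> sd N p (bd (Suc p) z) = x + y"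
      using sd_small [OF opn] by (metis order_refl)
    then obtain u q where uq: "ch p ?E u" "ch p ?H q" "sd N p (bd (Suc p) z) = u + q"
      by blast
    let ?z = "sd N (Suc p) z"
    have h: "hmg (Suc p) V ?D z ?z"
      by (rule hmg_sd [OF z])
    have cz: "cyc (Suc p) V ?D ?z"
      by (rule cyc_hmg [OF z h])
    have b: "bd (Suc p) ?z = q + u"
      using bd_sd [OF cyc_ch [OF z], of N] uq(3) by (simp add: add.commute)
    have "bd p q = bd p u"
      using bd_bd [OF cyc_ch [OF cz]] unfolding b bd_add by (rule z2_eq_iff [THEN iffD2])
    then have "ch (p - 1) (?E \<inter> ?H) (bd p q)"
      unfolding ch_Int [of _ ?E ?H] using ch_bd [OF uq(2)] ch_bd [OF uq(1)] by simp
    then have "ch (p - 1) (Dn i) (bd p q)"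
      by (rule ch_mono) auto
    moreover have "ch p V q"
      by (rule ch_mono [OF uq(2)]) auto
    ultimately have "cyc p V (Dn i) q"
      by (simp add: cyc_def)
    with h cz b uq show ?thesis by blast
  qed
  obtain c q' u' where c: "ch (Suc i) (V \<inter> ?D) c" and bZ: "bd (Suc i) (Z (Suc i) + c) = q' + u'"
    and q': "ch i ?H q'" and u': "ch i ?E u'" and cq': "cyc i V (Dn i) q'" and hq': "hmg i V (Dn i) q' (Z i)"
    using Z_Suc_deform [OF i] by metis
  have hc: "hmg (Suc i) V ?D c 0"
    by (rule hmg_off [OF c])
  have hZc: "hmg (Suc i) V ?D (Z (Suc i) + c) (Z (Suc i))"
    using hmg_add [OF hmg_refl hc] by simp
  have cZc: "cyc (Suc i) V ?D (Z (Suc i) + c)"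
    by (rule cyc_hmg [OF Z_cyc [OF Suc.prems] hmg_sym [OF hZc]])
  show ?case
  proof (intro conjI allI impI notI)
    fix p z assume p: "p < Suc i" and z: "cyc p V ?D z"
    show "hmg p V ?D z 0"
    proof (cases p)
      case 0
      have "cyc p V (Dn i \<union> {x. x \<bullet> bs ! i < 0}) z"
        using cyc_ch [OF z] by (simp add: cyc_def 0)
      from push_down [OF i this] show ?thesis
        by (rule hmg_mono) (auto simp: Dn_Suc)
    next
      case (Suc p')
      obtain z' q u where 1: "hmg (Suc p') V ?D z z'" "cyc (Suc p') V ?D z'" "bd (Suc p') z' = q + u"
        "ch p' ?H q" "ch p' ?E u" "cyc p' V (Dn i) q"
        using split z unfolding Suc by metis
      have "hmg p' V (Dn i) q 0"
        using IH1 1(6) p Suc by simp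
      from null_if_upper_part_null [OF i 1(2-5) this] have "hmg (Suc p') V ?D z' 0" .
      from hmg_trans [OF 1(1) this] show ?thesis by (simp only: Suc)
    qed
  next
    fix z assume z: "cyc (Suc i) V ?D z"
    obtain z' q u where 1: "hmg (Suc i) V ?D z z'" "cyc (Suc i) V ?D z'" "bd (Suc i) z' = q + u"
      "ch i ?H q" "ch i ?E u" "cyc i V (Dn i) q"
      using split [OF z] by metis
    from IH2 [OF 1(6)] show "hmg (Suc i) V ?D z 0 \<or> hmg (Suc i) V ?D z (Z (Suc i))"
    proof
      assume "hmg i V (Dn i) q 0"
      from null_if_upper_part_null [OF i 1(2-5) this] have "hmg (Suc i) V ?D z' 0" .
      from hmg_trans [OF 1(1) this] show ?thesis ..
    next
      assume h: "hmg i V (Dn i) q (Z i)"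
      have "hmg (Suc i) V ?D (z' + (Z (Suc i) + c)) 0"
      proof (rule null_if_upper_part_null [OF i])
        show "cyc (Suc i) V ?D (z' + (Z (Suc i) + c))"
          by (rule cyc_add [OF 1(2) cZc])
        show "bd (Suc i) (z' + (Z (Suc i) + c)) = (q + q') + (u + u')"
          by (simp only: bd_add [of _ z'] bZ 1(3)) (simp add: ac_simps)
        show "ch i ?H (q + q')" "ch i ?E (u + u')"
          using 1(4,5) q' u' by (simp_all add: ch_add)
        show "hmg i V (Dn i) (q + q') 0"
          using hmg_add [OF h hq'] by simp
      qed
      then have "hmg (Suc i) V ?D z' (Z (Suc i) + c)"
        by (rule hmg_shift [THEN iffD2])
      from hmg_trans [OF hmg_trans [OF 1(1) this] hZc] show ?thesis ..
    qed
  next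
    assume "hmg (Suc i) V ?D (Z (Suc i)) 0"
    from hmg_trans [OF hZc this] obtain b x where b: "ch (Suc (Suc i)) V b" and x: "ch (Suc i) (V \<inter> ?D) x"
      and bx: "Z (Suc i) + c + 0 = bd (Suc (Suc i)) b + x"
      by (rule hmgE)
    obtain N where "\<exists>x1 x2. ch (Suc i) ?E x1 \<and> ch (Suc i) ?H x2 \<and> sd N (Suc i) x = x1 + x2"
      using sd_small [OF opn x [unfolded VD]] by (metis order_refl)
    then obtain x1 x2 where x1: "ch (Suc i) ?E x1" and x2: "ch (Suc i) ?H x2" and x12: "sd N (Suc i) x = x1 + x2"
      by blast
    \<comment> \<open>The null-homology leaves a chain \<open>x\<close> off the subspace with the
      same boundary as the generator. After subdivision its upper part \<open>x2\<close> bounds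
      \<open>q'\<close> modulo \<open>Dn i\<close>, against \<open>IH3\<close>.\<close>
    have "q' + u' = bd (Suc i) x"
      using bx bZ bd_bd [OF b] by (simp add: bd_add)
    then have "sd N i q' + sd N i u' = bd (Suc i) x1 + bd (Suc i) x2"
      using bd_sd [OF x, of N] by (simp add: x12 bd_add flip: sd_add)
    then have "sd N i u' = sd N i q' + (bd (Suc i) x1 + bd (Suc i) x2)"
      by (rule z2_cancel)
    then have eq: "sd N i q' + bd (Suc i) x2 = sd N i u' + bd (Suc i) x1"
      by (simp add: ac_simps)
    have "ch i ?H (sd N i q' + bd (Suc i) x2)"
      using ch_sd [OF q'] ch_bd_Suc [OF x2] by (rule ch_add)
    moreover have "ch i ?E (sd N i q' + bd (Suc i) x2)"
      unfolding eq using ch_sd [OF u'] ch_bd_Suc [OF x1] by (rule ch_add)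
    ultimately have "ch i (?E \<inter> ?H) (sd N i q' + bd (Suc i) x2)"
      unfolding ch_Int [of _ ?E ?H] by simp
    then have "ch i (V \<inter> Dn i) (sd N i q' + bd (Suc i) x2)"
      by (rule ch_mono [OF _ EH])
    moreover have "ch (Suc i) V x2"
      by (rule ch_mono [OF x2]) auto
    ultimately have "hmg i V (Dn i) (sd N i q') 0"
      by (intro hmgI [of _ _ x2 _ "sd N i q' + bd (Suc i) x2"]) (simp_all add: ac_simps)
    from hmg_trans [OF hmg_sym [OF hq'] hmg_trans [OF hmg_sd [OF cq'] this]] show False
      using IH3 by simp
  qed
qed

section \<open>The mod 2 degree and odd maps\<close>

abbreviation m :: nat where "m \<equiv> length bs"

text \<open>In degree \<open>m\<close> there are exactly two classes, 0 and that of
  \<open>Z m\<close>, so being nonzero is already an additive function.\<close>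

definition local_deg :: "'a mod2_chain \<Rightarrow> bit" where
  "local_deg z = (if hmg m V (Dn m) z 0 then 0 else 1)"

lemma null_below: "p < m \<Longrightarrow> cyc p V (Dn m) z \<Longrightarrow> hmg p V (Dn m) z 0"
  using homology_V_Dn [of m] by simp

lemma cyc_cases: "cyc m V (Dn m) z \<Longrightarrow> hmg m V (Dn m) z 0 \<or> hmg m V (Dn m) z (Z m)"
  using homology_V_Dn [of m] by simp

lemma Z_not_null: "\<not> hmg m V (Dn m) (Z m) 0"
  using homology_V_Dn [of m] by simp

lemma local_deg_Z: "local_deg (Z m) = 1"
  using Z_not_null by (simp add: local_deg_def)

lemma local_deg_hmg: "hmg m V (Dn m) z w \<Longrightarrow> local_deg z = local_deg w"
  unfolding local_deg_def using hmg_trans hmg_sym by metis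

lemma local_deg_0 [simp]: "local_deg 0 = 0"
  by (simp add: local_deg_def hmg_refl)

lemma local_deg_add:
  assumes "cyc m V (Dn m) z" "cyc m V (Dn m) w" shows "local_deg (z + w) = local_deg z + local_deg w"
proof -
  have Z: "local_deg (Z m + Z m) = 0" by simp
  from cyc_cases [OF assms(1)] show ?thesis
  proof
    assume z: "hmg m V (Dn m) z 0"
    from local_deg_hmg [OF hmg_add [OF z hmg_refl]] show ?thesis
      using local_deg_hmg [OF z] by simp
  next
    assume z: "hmg m V (Dn m) z (Z m)"
    from cyc_cases [OF assms(2)] show ?thesis
    proof
      assume w: "hmg m V (Dn m) w 0"
      from local_deg_hmg [OF hmg_add [OF hmg_refl w]] show ?thesis
        using local_deg_hmg [OF w] by simp
    next
      assume w: "hmg m V (Dn m) w (Z m)"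
      from local_deg_hmg [OF hmg_add [OF z w]] show ?thesis
        using local_deg_hmg [OF z] local_deg_hmg [OF w] by (simp add: local_deg_Z)
    qed
  qed
qed

lemma local_deg_eq_0_iff: "local_deg z = 0 \<longleftrightarrow> hmg m V (Dn m) z 0"
  by (simp add: local_deg_def)

lemma uminus_Dn: "x \<in> Dn i \<Longrightarrow> - x \<in> Dn i"
  by (simp add: Dn_def)

lemma ch_neg_V: "ch p V c \<Longrightarrow> ch p V (cm p uminus c)"
  by (erule ch_cm) (auto intro!: continuous_intros span_neg)

lemma ch_neg_Dn: "ch p (Dn i) c \<Longrightarrow> ch p (Dn i) (cm p uminus c)"
  by (erule ch_cm) (auto intro!: continuous_intros uminus_Dn)

lemma neg_neg: "ch p V c \<Longrightarrow> cm p uminus (cm p uminus c) = (c :: 'a mod2_chain)"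
  unfolding cm_compose by (erule cm_ident) simp

lemma hmg_neg: "hmg p V (Dn i) z w \<Longrightarrow> hmg p V (Dn i) (cm p uminus z) (cm p uminus w)"
  by (erule hmg_cm) (auto intro!: continuous_intros span_neg uminus_Dn)

lemma cyc_neg: "cyc p V (Dn i) z \<Longrightarrow> cyc p V (Dn i) (cm p uminus z)"
  by (erule cyc_cm) (auto intro!: continuous_intros span_neg uminus_Dn)

lemma local_deg_neg: assumes z: "cyc m V (Dn m) z" shows "local_deg (cm m uminus z) = local_deg z"
proof -
  have "hmg m V (Dn m) (cm m uminus z) 0" if "hmg m V (Dn m) z 0" for z
    using hmg_neg [OF that] by simp
  from this [of z] this [of "cm m uminus z"] show ?thesis
    unfolding local_deg_def neg_neg [OF cyc_ch [OF z]] by metis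
qed

lemma Z_neg: "cm i uminus (Z i) = Z i"
proof -
  have len: "length l = Suc i" if "l \<in> keys (snoc 0 (W i))" for l
    using subsetD [OF keys_snoc that] W_length by auto
  have "linear (uminus :: 'a \<Rightarrow> 'a)"
    by (rule linearI) simp_all
  then show ?thesis
    unfolding Z_def by (simp add: cm_aff_chain [OF _ len] ext_map_snoc W_uminus)
qed

text \<open>The cones over the hemispheres (\<open>h\<close>) and spheres (\<open>t\<close>) of the antipodal cell structure of a
  sphere, as mapped to \<open>V\<close> by an odd map.\<close>

definition odd_system :: "(nat \<Rightarrow> 'a mod2_chain) \<Rightarrow> (nat \<Rightarrow> 'a mod2_chain) \<Rightarrow> bool" where
  "odd_system h t \<longleftrightarrow> t 0 = Z 0 \<and> (\<forall>j\<in>{1..m}. ch j V (h j) \<and> t j = h j + cm j uminus (h j)) \<and>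
     (\<forall>j<m. ch j (Dn m) (bd (Suc j) (h (Suc j)) + t j))"

lemma odd_system_neg:
  assumes "odd_system h t" "j \<le> m" shows "cm j uminus (t j) = t j"
proof (cases "j = 0")
  case True
  then show ?thesis using assms Z_neg by (simp add: odd_system_def)
next
  case False
  then have "ch j V (h j)" "t j = h j + cm j uminus (h j)"
    using assms by (auto simp: odd_system_def)
  then show ?thesis
    by (simp add: cm_add neg_neg ac_simps)
qed

lemma odd_system_cyc:
  assumes "odd_system h t" "0 < m" shows "cyc m V (Dn m) (t m)"
proof -
  obtain q where q: "m = Suc q" using assms(2) by (cases m) auto
  have h: "ch (Suc q) V (h (Suc q))" and t: "t (Suc q) = h (Suc q) + cm (Suc q) uminus (h (Suc q))"
    using assms(1) q by (auto simp: odd_system_def)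
  define d where "d = bd (Suc q) (h (Suc q)) + t q"
  have d: "ch q (Dn m) d"
    using assms(1) q by (auto simp: odd_system_def d_def)
  have "bd (Suc q) (h (Suc q)) = d + t q"
    by (simp add: d_def ac_simps)
  then have "bd (Suc q) (t (Suc q)) = d + cm q uminus d"
    using odd_system_neg [OF assms(1), of q] q
    by (simp add: t bd_add bd_cm_Suc [OF h] cm_add ac_simps)
  moreover have "ch (Suc q) V (t (Suc q))"
    unfolding t using h ch_neg_V by blast
  ultimately show ?thesis
    using d ch_neg_Dn [OF d] by (simp add: cyc_def q ch_add)
qed

text \<open>The top cycles of two odd systems differ by \<open>y + cm m uminus y\<close> for a
  relative cycle \<open>y\<close>, whose degree is twice that of \<open>y\<close>. The cycle is
  built upwards: below degree \<open>m\<close> relative cycles are null, and the chain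
  \<open>b\<close> bounding in one degree is the correction \<open>a\<close> in the next.\<close>

lemma odd_system_unique:
  assumes 1: "odd_system h t" and 2: "odd_system h' t'" and m: "0 < m"
  shows "local_deg (t m) = local_deg (t' m)"
proof -
  have h: "ch j V (h j)" "ch j V (h' j)" and t: "t j = h j + cm j uminus (h j)" "t' j = h' j + cm j uminus (h' j)"
    if "1 \<le> j" "j \<le> m" for j
    using 1 2 that by (auto simp: odd_system_def)
  have off: "ch j (Dn m) (bd (Suc j) (h (Suc j)) + t j)" "ch j (Dn m) (bd (Suc j) (h' (Suc j)) + t' j)" if "j < m" for j
    using 1 2 that by (auto simp: odd_system_def)
  \<comment> \<open>The correction \<open>a + cm j uminus a\<close> is invariant under the antipode
    and drops out of the symmetrised sum.\<close>
  have sym: "h j + h' j + (a + cm j uminus a) + cm j uminus (h j + h' j + (a + cm j uminus a)) = t j + t' j"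
    if "1 \<le> j" "j \<le> m" "ch j V a" for j a
    using that by (simp add: t cm_add neg_neg ac_simps)
  have ex: "\<exists>a. ch j V a \<and> cyc j V (Dn m) (h j + h' j + (a + cm j uminus a))" if "1 \<le> j" "j \<le> m" for j
    using that
  proof (induction j rule: nat_induct_at_least)
    \<comment> \<open>Degree 1 takes the correction 0, because both systems start with the same
      \<open>Z 0\<close>.\<close>
    case base
    have "bd 1 (h 1 + h' 1) = (bd (Suc 0) (h (Suc 0)) + t 0) + (bd (Suc 0) (h' (Suc 0)) + t' 0)"
      using 1 2 by (simp add: odd_system_def bd_add ac_simps)
    moreover have "ch 0 (Dn m) \<dots>"
      using off [of 0] m by (simp add: ch_add)
    ultimately have "cyc 1 V (Dn m) (h 1 + h' 1)"
      using h [of 1] m by (simp add: cyc_def ch_add Suc_le_eq)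
    then show ?case
      by (intro exI [of _ 0]) simp
  next
    case (Suc j)
    then obtain a where a: "ch j V a" and y: "cyc j V (Dn m) (h j + h' j + (a + cm j uminus a))"
      by auto
    have jm: "j < m" using Suc by simp
    define y where "y = h j + h' j + (a + cm j uminus a)"
    from null_below [OF jm y] obtain b d where b: "ch (Suc j) V b" and d: "ch j (V \<inter> Dn m) d" and ybd: "y + 0 = bd (Suc j) b + d"
      unfolding y_def by (rule hmgE)
    have dd: "ch j (Dn m) d" using d by (simp add: ch_Int)
    have bdb: "bd (Suc j) b = y + d"
      using ybd by (simp add: ac_simps)
    have bsym: "bd (Suc j) (b + cm (Suc j) uminus b) = t j + t' j + (d + cm j uminus d)"
    proof -
      have "bd (Suc j) (b + cm (Suc j) uminus b) = (y + cm j uminus y) + (d + cm j uminus d)"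
        by (simp add: bd_add bd_cm_Suc [OF b] bdb cm_add ac_simps)
      then show ?thesis
        using sym [OF Suc(1) _ a] jm by (simp add: y_def)
    qed
    have "bd (Suc j) (h (Suc j) + h' (Suc j) + (b + cm (Suc j) uminus b)) =
        (bd (Suc j) (h (Suc j)) + t j) + (bd (Suc j) (h' (Suc j)) + t' j) + (d + cm j uminus d)"
      by (simp only: bd_add [of _ "_ + _"] bsym) (simp add: bd_add ac_simps)
    moreover have "ch j (Dn m) \<dots>"
      using off [OF jm] dd ch_neg_Dn [OF dd] by (simp add: ch_add)
    moreover have "ch (Suc j) V (h (Suc j) + h' (Suc j) + (b + cm (Suc j) uminus b))"
      using h [of "Suc j"] Suc.prems b ch_neg_V [OF b] by (simp add: ch_add)
    ultimately have "cyc (Suc j) V (Dn m) (h (Suc j) + h' (Suc j) + (b + cm (Suc j) uminus b))"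
      by (simp add: cyc_def)
    with b show ?case by blast
  qed
  obtain a where a: "ch m V a" and y: "cyc m V (Dn m) (h m + h' m + (a + cm m uminus a))"
    using ex [of m] m by auto
  have "local_deg (t m) + local_deg (t' m) = local_deg (t m + t' m)"
    using local_deg_add odd_system_cyc 1 2 m by simp
  also have "t m + t' m = h m + h' m + (a + cm m uminus a) + cm m uminus (h m + h' m + (a + cm m uminus a))"
    using sym [of m a] a m by simp
  also have "local_deg \<dots> = 0"
    using local_deg_add [OF y cyc_neg [OF y]] local_deg_neg [OF y] by simp
  finally show ?thesis
    by (cases "local_deg (t m)"; cases "local_deg (t' m)") simp_all
qed

text \<open>The half of the cone \<open>Z j\<close> on the side of
  \<open>bs ! (j - 1)\<close>.\<close>

definition model :: "nat \<Rightarrow> 'a mod2_chain" where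
  "model j = aff_chain (snoc 0 (snoc (bs ! (j - 1)) (W (j - 1))))"

lemma model_odd_system: "odd_system model Z"
  unfolding odd_system_def
proof (intro conjI ballI allI impI)
  fix j assume j: "j \<in> {1..m}"
  then obtain i where i: "j = Suc i" "i < m" by (cases j) auto
  have len: "length l = Suc (Suc i)" if "l \<in> keys (snoc 0 (snoc (bs ! i) (W i)))" for l
    using subsetD [OF keys_snoc that] keys_snoc [of "bs ! i" "W i"] W_length by fastforce
  show "ch j V (model j)"
    unfolding model_def i
  proof (rule ch_aff_chain, intro conjI)
    fix l assume l: "l \<in> keys (snoc 0 (snoc (bs ! (Suc i - 1)) (W (Suc i - 1))))"
    then show "length l = Suc (Suc i)" using len by simp
    obtain k where "k \<in> keys (snoc (bs ! i) (W i))" "l = k @ [0]"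
      using subsetD [OF keys_snoc l] by auto
    moreover from this obtain k' where "k' \<in> keys (W i)" "k = k' @ [bs ! i]"
      using subsetD [OF keys_snoc] by fastforce
    ultimately have "set l \<subseteq> V"
      using W_set [of k' i] i bs_in_V by (auto simp: span_zero)
    then show "convex hull (set l) \<subseteq> V"
      by (intro hull_minimal convex_V)
  qed
  have "linear (uminus :: 'a \<Rightarrow> 'a)"
    by (rule linearI) simp_all
  then have "cm j uminus (model j) = aff_chain (snoc 0 (snoc (- bs ! i) (W i)))"
    unfolding model_def i by (simp add: cm_aff_chain [OF _ len] ext_map_snoc W_uminus)
  then show "Z j = model j + cm j uminus (model j)"
    by (simp add: Z_def model_def i snoc_add aff_chain_add)
next
  fix j assume j: "j < m"
  have len: "length l = Suc (Suc j)" if "l \<in> keys (snoc 0 (snoc (bs ! j) (W j)))" for l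
    using subsetD [OF keys_snoc that] keys_snoc [of "bs ! j" "W j"] W_length by fastforce
  have "bd (Suc j) (model (Suc j)) = aff_chain (snoc 0 (W j) + snoc (bs ! j) (W j))"
    unfolding model_def by (simp add: bd_aff_chain [OF len] ext_lb_snoc lb_W)
  then have "bd (Suc j) (model (Suc j)) + Z j = aff_chain (snoc (bs ! j) (W j))"
    by (simp add: Z_def aff_chain_add ac_simps)
  moreover have "ch j (Dn m) (aff_chain (snoc (bs ! j) (W j)))"
  proof (rule ch_aff_chain, intro conjI)
    fix l assume l: "l \<in> keys (snoc (bs ! j) (W j))"
    obtain k where k: "k \<in> keys (W j)" "l = k @ [bs ! j]"
      using subsetD [OF keys_snoc l] by auto
    then show "length l = Suc j" using W_length by simp
    show "convex hull (set l) \<subseteq> Dn m"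
    proof
      fix x assume "x \<in> convex hull (set l)"
      then have "x \<in> Dn j \<or> 0 < x \<bullet> bs ! j"
        using W_hull_snoc [OF k(1) j, of 1 x] k(2) by simp
      then have "x \<in> Dn (Suc j)" by (auto simp: Dn_Suc)
      then show "x \<in> Dn m" using j less_le_trans [OF _ Suc_leI [OF j]] unfolding Dn_def by blast
    qed
  qed
  ultimately show "ch j (Dn m) (bd (Suc j) (model (Suc j)) + Z j)" by simp
qed simp

text \<open>A version of Borsuk's theorem that odd maps of spheres have odd degree.\<close>

theorem local_deg_odd_system: "odd_system h t \<Longrightarrow> 0 < m \<Longrightarrow> local_deg (t m) = 1"
  using odd_system_unique [OF _ model_odd_system] local_deg_Z by metis

end

text \<open>\<open>V\<close> is unbounded; a homology with compact support can be scaled into a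
  small ball.\<close>

lemma hmg_compact_support:
  assumes "hmg p A D z w"
  obtains K where "compact K" "K \<subseteq> A" "hmg p K D z w"
proof -
  obtain b d where b: "ch (Suc p) A b" and d: "ch p (A \<inter> D) d" and e: "z + w = bd (Suc p) b + d"
    using assms by (rule hmgE)
  obtain K1 where K1: "compact K1" "K1 \<subseteq> A" "ch (Suc p) K1 b"
    using ch_compact_support [OF b] .
  obtain K2 where K2: "compact K2" "K2 \<subseteq> A \<inter> D" "ch p K2 d"
    using ch_compact_support [OF d] .
  show ?thesis
  proof (rule that [of "K1 \<union> K2"])
    show "compact (K1 \<union> K2)" "K1 \<union> K2 \<subseteq> A"
      using K1 K2 by auto
    have "ch (Suc p) (K1 \<union> K2) b" "ch p ((K1 \<union> K2) \<inter> D) d"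
      by (rule ch_mono [OF K1(3)], simp) (rule ch_mono [OF K2(3)], use K2(2) in blast)
    then show "hmg p (K1 \<union> K2) D z w"
      using e by (rule hmgI)
  qed
qed

section \<open>Discs transverse to the diagonal\<close>

definition off_diag :: "('a \<times> 'a) set" where
  "off_diag = {(x, y). x \<noteq> y}"

context frame
begin

abbreviation S :: "'a set" where "S \<equiv> cball 0 1 \<inter> V"

lemma convex_S: "convex S"
  by (intro convex_Int convex_V convex_cball)

lemma compact_S: "compact S"
  by (intro compact_Int_closed compact_cball closed_span)

lemma zero_in_S: "0 \<in> S"
  by (simp add: span_zero)

lemma Dn_nonzero: "x \<in> Dn i \<Longrightarrow> x \<noteq> 0"
  by (auto simp: Dn_def)

lemma V_Dn: assumes "x \<in> V" "x \<noteq> 0" shows "x \<in> Dn m"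
proof (rule ccontr)
  assume "x \<notin> Dn m"
  then have "x \<bullet> b = 0" if "b \<in> set bs" for b
    using that by (auto simp: Dn_def in_set_conv_nth)
  then have "orthogonal x y" if "y \<in> V" for y
    using that by (intro orthogonal_to_span [of y "set bs" x]) (auto simp: orthogonal_def)
  from this [OF assms(1)] assms(2) show False
    by (simp add: orthogonal_def)
qed

lemma W_set_S: "l \<in> keys (W i) \<Longrightarrow> i \<le> m \<Longrightarrow> set l \<subseteq> S"
proof (induction i arbitrary: l)
  case (Suc i)
  obtain k c where k: "k \<in> keys (W i)" "c = 1 \<or> c = - 1" "l = k @ [c *\<^sub>R bs ! i]"
    using keys_W_Suc [OF Suc.prems(1)] by metis
  have "bs ! i \<in> Basis"
    using basis Suc.prems(2) by (simp add: subset_iff)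
  then have "c *\<^sub>R bs ! i \<in> S"
    using Suc.prems k(2) bs_in_V [of i] by auto
  then show ?case
    using Suc.IH [OF k(1)] Suc.prems k(3) by simp
qed simp

lemma Z_S: "i \<le> m \<Longrightarrow> ch i S (Z i)"
  unfolding Z_def
proof (rule ch_aff_chain, intro conjI)
  fix l assume i: "i \<le> m" and "l \<in> keys (snoc 0 (W i))"
  then obtain k where k: "k \<in> keys (W i)" "l = k @ [0]"
    using subsetD [OF keys_snoc] by fastforce
  then show "length l = Suc i" using W_length by auto
  have "set l \<subseteq> S"
    using W_set_S [OF k(1) i] by (auto simp: k span_zero)
  then show "convex hull (set l) \<subseteq> S"
    by (intro hull_minimal convex_S)
qed

lemma model_S: "j < m \<Longrightarrow> ch (Suc j) S (model (Suc j))"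
  unfolding model_def
proof (rule ch_aff_chain, intro conjI)
  fix l assume j: "j < m" and "l \<in> keys (snoc 0 (snoc (bs ! (Suc j - 1)) (W (Suc j - 1))))"
  then have "l \<in> keys (snoc 0 (snoc (bs ! j) (W j)))" by simp
  then obtain k where "k \<in> keys (snoc (bs ! j) (W j))" "l = k @ [0]"
    using subsetD [OF keys_snoc] by fastforce
  moreover from this obtain k' where k': "k' \<in> keys (W j)" "k = k' @ [bs ! j]"
    using subsetD [OF keys_snoc] by fastforce
  ultimately have l: "l = k' @ [bs ! j, 0]" by simp
  then show "length l = Suc (Suc j)" using W_length [OF k'(1)] by simp
  have "bs ! j \<in> Basis" using basis j by (simp add: subset_iff)
  then have "set l \<subseteq> S"
    using W_set_S [OF k'(1)] j bs_in_V [of j] by (auto simp: l span_zero)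
  then show "convex hull (set l) \<subseteq> S"
    by (intro hull_minimal convex_S)
qed

text \<open>An odd map carries the antipodal cells \<open>model\<close> of the standard ball to an
  odd system.\<close>

lemma local_deg_odd_map:
  assumes m: "0 < m" and c: "continuous_on S g" and V: "g ` S \<subseteq> V"
    and odd: "\<And>u. u \<in> S \<Longrightarrow> g (- u) = - g u" and nz: "\<And>u. u \<in> S \<Longrightarrow> u \<noteq> 0 \<Longrightarrow> g u \<noteq> 0"
  shows "local_deg (cm m g (Z m)) = 1"
proof (rule local_deg_odd_system [OF _ m, of "\<lambda>j. cm j g (model j)" "\<lambda>j. cm j g (Z j)"])
  have md: "odd_system model Z" by (rule model_odd_system)
  have g0: "g 0 = 0"
  proof -
    have "g 0 + g 0 = 0"
      using odd [OF zero_in_S] by (simp add: eq_neg_iff_add_eq_0)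
    then have "2 *\<^sub>R g 0 = 0" by (simp only: scaleR_2)
    then show ?thesis by simp
  qed
  show "odd_system (\<lambda>j. cm j g (model j)) (\<lambda>j. cm j g (Z j))"
    unfolding odd_system_def
  proof (intro conjI ballI allI impI)
    have "simplex_map 0 g (aff [0]) = aff [0::'a]"
      by (auto simp: simplex_map_def aff_def g0)
    then show "cm 0 g (Z 0) = Z 0"
      by (simp add: Z_0)
  next
    fix j assume "j \<in> {1..m}"
    then obtain i where i: "j = Suc i" "i < m" by (cases j) auto
    have mS: "ch j S (model j)" using model_S i by simp
    show "ch j V (cm j g (model j))"
      by (rule ch_cm [OF mS c V])
    have "cm j g (cm j uminus (model j)) = cm j uminus (cm j g (model j))"
      unfolding cm_compose by (rule cm_cong [OF mS]) (simp add: odd)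
    then show "cm j g (Z j) = cm j g (model j) + cm j uminus (cm j g (model j))"
      using md i by (simp add: odd_system_def cm_add)
  next
    fix j assume j: "j < m"
    have "bd (Suc j) (cm (Suc j) g (model (Suc j))) + cm j g (Z j) = cm j g (bd (Suc j) (model (Suc j)) + Z j)"
      by (simp add: bd_cm_Suc [OF model_S [OF j]] cm_add)
    moreover have "ch j (S \<inter> Dn m) (bd (Suc j) (model (Suc j)) + Z j)"
      using md j ch_bd_Suc [OF model_S [OF j]] Z_S [of j] unfolding ch_Int odd_system_def by (simp add: ch_Int ch_add)
    ultimately show "ch j (Dn m) (bd (Suc j) (cm (Suc j) g (model (Suc j))) + cm j g (Z j))"
    proof (simp only:, intro ch_cm)
      show "continuous_on (S \<inter> Dn m) g"
        by (rule continuous_on_subset [OF c]) blast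
      show "g ` (S \<inter> Dn m) \<subseteq> Dn m"
        using nz V V_Dn Dn_nonzero by blast
    qed
  qed
qed

text \<open>A small disc through \<open>(p, p)\<close> transverse to the diagonal.\<close>

definition fibre :: "'a \<Rightarrow> real \<Rightarrow> ('a \<times> 'a) mod2_chain" where
  "fibre p r = cm m (\<lambda>u. (p - r *\<^sub>R u, p + r *\<^sub>R u)) (Z m)"

definition fibres :: "('a \<times> real) list \<Rightarrow> ('a \<times> 'a) mod2_chain" where
  "fibres ps = (\<Sum>(p, r)\<leftarrow>ps. fibre p r)"

definition fibre_in :: "('a \<times> 'a) set \<Rightarrow> 'a \<Rightarrow> real \<Rightarrow> bool" where
  "fibre_in G p r \<longleftrightarrow> 0 < r \<and> (\<forall>u\<in>S. (p - r *\<^sub>R u, p + r *\<^sub>R u) \<in> G)"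

text \<open>Along the segment from \<open>(x, y)\<close> to
  \<open>(p - l (y - x), p + l (y - x))\<close> the difference of the coordinates is multiplied by
  positive numbers only, so the diagonal is not entered. Thus a cycle of the box is recovered from
  its image under the difference map, and a homology of that image in \<open>V\<close> is brought
  back by the same embedding of \<open>V\<close>.\<close>

lemma box_retract:
  assumes conv: "convex C" "convex C'" and CS: "C \<subseteq> S" "C' \<subseteq> S"
    and r: "0 < r" "ball p r \<inter> V \<subseteq> C" "ball p r \<inter> V \<subseteq> C'" and p: "p \<in> V"
    and z: "cyc j (C \<times> C') off_diag z" and h: "hmg j V (Dn m) (cm j (\<lambda>x. snd x - fst x) z) w" and e: "0 < e"
  shows "\<exists>l. 0 < l \<and> l < e \<and> hmg j (C \<times> C') off_diag z (cm j (\<lambda>u. (p - l *\<^sub>R u, p + l *\<^sub>R u)) w) \<and> fibre_in (C \<times> C') p l"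
proof -
  let ?\<delta> = "\<lambda>x::'a \<times> 'a. snd x - fst x"
  obtain K where K: "compact K" "K \<subseteq> V" "hmg j K (Dn m) (cm j ?\<delta> z) w"
    using hmg_compact_support [OF h] .
  obtain B where B: "0 < B" "\<And>x. x \<in> K \<Longrightarrow> norm x \<le> B"
    using compact_imp_bounded [OF K(1)] by (metis bounded_pos)
  \<comment> \<open>Scaling by \<open>l\<close> has to bring into the ball of radius
    \<open>r\<close> both the support \<open>K\<close> of the homology, of norm at most
    \<open>B\<close>, and all differences of points of the unit ball, of norm at most 2. The extra
    factor 2 makes the inequality strict.\<close>
  define l where "l = min (e / 2) (r / (2 * (B + 2)))"
  have "l \<le> e / 2" unfolding l_def by (rule min.cobounded1)
  then have l0: "0 < l" "l < e" using e r(1) B(1) by (simp_all add: l_def)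
  have l1: "l * t < r" if "t \<le> B + 2" for t
  proof -
    have "l * t \<le> l * (B + 2)" using that l0 by simp
    also have "\<dots> \<le> r / (2 * (B + 2)) * (B + 2)"
      using B by (intro mult_right_mono) (auto simp: l_def)
    also have "\<dots> = r / 2" using B(1) by (simp add: field_simps)
    also have "\<dots> < r" using r(1) by simp
    finally show ?thesis .
  qed
  let ?k = "\<lambda>u. (p - l *\<^sub>R u, p + l *\<^sub>R u)"
  have kin: "?k u \<in> C \<times> C'" if "u \<in> V" "norm u \<le> B + 2" for u
  proof -
    have "p - l *\<^sub>R u \<in> V" "p + l *\<^sub>R u \<in> V"
      using p that by (auto intro: span_add span_diff span_scale)
    moreover have "dist p (p - l *\<^sub>R u) < r" "dist p (p + l *\<^sub>R u) < r"
      using l1 [OF that(2)] l0 by (simp_all add: dist_norm)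
    ultimately show ?thesis using r by auto
  qed
  have d: "?\<delta> x \<in> V" "norm (?\<delta> x) \<le> B + 2" if "x \<in> C \<times> C'" for x
  proof -
    have x: "fst x \<in> S" "snd x \<in> S" using that CS by auto
    then show "?\<delta> x \<in> V" by (auto intro: span_diff)
    have "norm (?\<delta> x) \<le> 1 + 1"
      using x by (intro order_trans [OF norm_triangle_ineq4] add_mono) auto
    then show "norm (?\<delta> x) \<le> B + 2" using B by simp
  qed
  have 1: "hmg j (C \<times> C') off_diag (cm j (\<lambda>x. x) z) (cm j (?k \<circ> ?\<delta>) z)"
  proof (rule hmg_linear [OF z])
    show "continuous_on (C \<times> C') (?k \<circ> ?\<delta>)"
      unfolding o_def by (intro continuous_intros)
    show "closed_segment x ((?k \<circ> ?\<delta>) x) \<subseteq> C \<times> C'" if "x \<in> C \<times> C'" for x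
      using that kin [OF d] by (intro closed_segment_subset convex_Times conv) auto
    show "closed_segment x ((?k \<circ> ?\<delta>) x) \<subseteq> off_diag" if x: "x \<in> off_diag" for x
    proof
      fix w assume "w \<in> closed_segment x ((?k \<circ> ?\<delta>) x)"
      then obtain t where t: "0 \<le> t" "t \<le> 1" and w: "w = (1 - t) *\<^sub>R x + t *\<^sub>R (?k (?\<delta> x))"
        by (auto simp: in_segment)
      have "snd w - fst w = ((1 - t) + (t * l + t * l)) *\<^sub>R ?\<delta> x"
      proof -
        have "((1 - t) *\<^sub>R b + t *\<^sub>R (p + l *\<^sub>R v)) - ((1 - t) *\<^sub>R a + t *\<^sub>R (p - l *\<^sub>R v)) =
            (1 - t) *\<^sub>R (b - a) + ((t * l) *\<^sub>R v + (t * l) *\<^sub>R v)" for a b v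
          by (simp add: algebra_simps)
        from this [of "snd x" "?\<delta> x" "fst x"] show ?thesis
          unfolding w scaleR_left_distrib by simp
      qed
      moreover have "(1 - t) + (t * l + t * l) \<noteq> 0"
      proof (cases "t = 1")
        case False
        then have "0 < 1 - t" using t by simp
        moreover have "0 \<le> t * l" using t l0 by simp
        ultimately show ?thesis by linarith
      qed (use l0 in simp)
      moreover have "?\<delta> x \<noteq> 0" using x by (auto simp: off_diag_def)
      ultimately have "snd w - fst w \<noteq> 0" by simp
      then show "w \<in> off_diag" by (auto simp: off_diag_def split: prod.split)
    qed
  qed simp
  have 2: "cm j (\<lambda>x. x) z = z"
    by (rule cm_ident [OF cyc_ch [OF z]]) simp
  have 3: "hmg j (C \<times> C') off_diag (cm j ?k (cm j ?\<delta> z)) (cm j ?k w)"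
  proof (rule hmg_cm [OF K(3)])
    show "continuous_on K ?k" by (intro continuous_intros)
    show "?k ` K \<subseteq> C \<times> C'"
      using kin K(2) B by (force simp del: mem_Times_iff)
    show "?k ` (K \<inter> Dn m) \<subseteq> off_diag"
      using l0 Dn_nonzero by (auto simp: off_diag_def algebra_simps scaleR_2 [symmetric] add_eq_0_iff)
  qed
  have "hmg j (C \<times> C') off_diag z (cm j ?k w)"
    using hmg_trans [OF 1 [unfolded 2] 3 [unfolded cm_compose]] .
  moreover have "fibre_in (C \<times> C') p l"
    unfolding fibre_in_def using l0 kin B by auto
  ultimately show ?thesis using l0 by blast
qed

end

section \<open>Relative homology of the diagonal\<close>

context frame
begin

definition box :: "'a set \<Rightarrow> 'a set \<Rightarrow> ('a \<times> 'a) set" where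
  "box C C' = (C \<inter> S) \<times> (C' \<inter> S)"

text \<open>Vanishing below \<open>m\<close> is included because Mayer-Vietoris consumes it on
  intersections. The size bound \<open>e\<close> depends on the centre, since later it comes from
  the continuity of charts at single points.\<close>

definition fibre_generated :: "('a \<times> 'a) set \<Rightarrow> bool" where
  "fibre_generated G \<longleftrightarrow>
     (\<forall>j z. j < m \<longrightarrow> cyc j G off_diag z \<longrightarrow> hmg j G off_diag z 0) \<and>
     (\<forall>z e. cyc m G off_diag z \<longrightarrow> (\<forall>p. 0 < e p) \<longrightarrow>
        (\<exists>ps. hmg m G off_diag z (fibres ps) \<and> (\<forall>(p, l)\<in>set ps. fibre_in G p l \<and> l < e p)))"

lemma fibre_generatedD:
  assumes "fibre_generated G"
  shows "j < m \<Longrightarrow> cyc j G off_diag z \<Longrightarrow> hmg j G off_diag z 0"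
    and "cyc m G off_diag z \<Longrightarrow> (\<And>p. 0 < e p) \<Longrightarrow>
        \<exists>ps. hmg m G off_diag z (fibres ps) \<and> (\<forall>(p, l)\<in>set ps. fibre_in G p l \<and> l < e p)"
  using assms unfolding fibre_generated_def by blast+

lemma fibres_append: "fibres (ps @ qs) = fibres ps + fibres qs"
  by (simp add: fibres_def)

lemma fibres_Nil [simp]: "fibres [] = 0"
  by (simp add: fibres_def)

lemma fibre_in_mono: "fibre_in G p l \<Longrightarrow> G \<subseteq> H \<Longrightarrow> fibre_in H p l"
  unfolding fibre_in_def by blast

text \<open>The point \<open>q\<close> may lie on the boundary of the unit ball, so the centre is
  moved to \<open>(1 - u) q\<close>. The ball of radius \<open>u\<close> about it stays in the unit
  ball because its centre has norm at most \<open>1 - u\<close>, and in \<open>C\<close> because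
  \<open>2 u < d\<close>.\<close>

lemma interior_point:
  assumes "open C" "q \<in> C \<inter> S"
  obtains p r where "p \<in> V" "0 < r" "ball p r \<inter> V \<subseteq> C \<inter> S"
proof -
  obtain d where d: "0 < d" "ball q d \<subseteq> C"
    using assms by (meson IntD1 openE)
  define u where "u = min (1/2) (d / 3)"
  have u: "0 < u" "u \<le> 1/2" "u < d / 2" using d by (auto simp: u_def min_def)
  have q: "norm q \<le> 1" "q \<in> V" using assms by auto
  let ?p = "(1 - u) *\<^sub>R q"
  have nqp: "dist q ?p \<le> u"
    using q u by (simp add: dist_norm algebra_simps mult_left_le)
  have np: "norm ?p \<le> 1 - u"
    using q u by (simp add: mult_left_le)
  show ?thesis
  proof (rule that [of ?p u])
    show "?p \<in> V" using q by (intro span_scale)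
    show "ball ?p u \<inter> V \<subseteq> C \<inter> S"
    proof
      fix x assume x: "x \<in> ball ?p u \<inter> V"
      have "dist q x < d"
        using dist_triangle [of q x ?p] nqp x u by simp
      then have "x \<in> C" using d by auto
      moreover have "norm x \<le> 1"
        using norm_triangle_sub [of x ?p] np x by (simp add: dist_norm norm_minus_commute)
      ultimately show "x \<in> C \<inter> S" using x by simp
    qed
  qed (rule u)
qed

text \<open>A box that misses the diagonal has only null classes. Otherwise its cycles are deformed
  to a small disc at a point interior to both factors, and the homology of \<open>(V, Dn m)\<close>
  decides between one disc and none.\<close>

lemma fibre_generated_box:
  assumes C: "open C" "convex C" "open C'" "convex C'"
  shows "fibre_generated (box C C')"
proof (cases "C \<inter> C' \<inter> S = {}")
  case True
  then have "box C C' \<inter> off_diag = box C C'"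
    by (auto simp: box_def off_diag_def)
  then have "hmg j (box C C') off_diag z 0" if "cyc j (box C C') off_diag z" for j z
    using cyc_ch [OF that] by (intro hmg_off) simp
  then show ?thesis
    unfolding fibre_generated_def by (intro conjI allI impI exI [of _ "[]"]) simp_all
next
  case False
  then obtain q where q: "q \<in> (C \<inter> C') \<inter> S" by blast
  obtain p r where p: "p \<in> V" "0 < r" "ball p r \<inter> V \<subseteq> (C \<inter> C') \<inter> S"
    using interior_point [OF open_Int [OF C(1,3)] q] .
  let ?\<delta> = "\<lambda>x::'a \<times> 'a. snd x - fst x"
  have ret: "\<exists>l. 0 < l \<and> l < e \<and> hmg j (box C C') off_diag z (cm j (\<lambda>u. (p - l *\<^sub>R u, p + l *\<^sub>R u)) w) \<and> fibre_in (box C C') p l"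
    if "cyc j (box C C') off_diag z" "hmg j V (Dn m) (cm j ?\<delta> z) w" "0 < e" for j z w e
    using that unfolding box_def
    by (intro box_retract [OF _ _ _ _ p(2) _ _ p(1)]) (use C p(3) in \<open>auto intro: convex_Int convex_S\<close>)
  have dz: "cyc j V (Dn m) (cm j ?\<delta> z)" if "cyc j (box C C') off_diag z" for j z
  proof (rule cyc_cm [OF that])
    show "continuous_on (box C C') ?\<delta>" by (intro continuous_intros)
    show "?\<delta> ` box C C' \<subseteq> V" by (auto simp: box_def intro: span_diff)
    show "?\<delta> ` (box C C' \<inter> off_diag) \<subseteq> Dn m"
      by (auto simp: box_def off_diag_def intro!: V_Dn span_diff)
  qed
  show ?thesis
    unfolding fibre_generated_def
  proof (intro conjI allI impI)
    fix j z assume "j < m" and z: "cyc j (box C C') off_diag z"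
    from ret [OF z null_below [OF this(1) dz [OF z]] zero_less_one] show "hmg j (box C C') off_diag z 0"
      by auto
  next
    fix z and e :: "'a \<Rightarrow> real" assume z: "cyc m (box C C') off_diag z" and e: "\<forall>p. 0 < e p"
    then have ep: "0 < e p" by simp
    from cyc_cases [OF dz [OF z]]
    show "\<exists>ps. hmg m (box C C') off_diag z (fibres ps) \<and> (\<forall>(p, l)\<in>set ps. fibre_in (box C C') p l \<and> l < e p)"
    proof
      assume "hmg m V (Dn m) (cm m ?\<delta> z) 0"
      from ret [OF z this ep] have "hmg m (box C C') off_diag z 0" by auto
      then show ?thesis by (intro exI [of _ "[]"]) simp
    next
      assume "hmg m V (Dn m) (cm m ?\<delta> z) (Z m)"
      from ret [OF z this ep] obtain l where "l < e p" "hmg m (box C C') off_diag z (fibre p l)" "fibre_in (box C C') p l"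
        unfolding fibre_def by blast
      then show ?thesis
        by (intro exI [of _ "[(p, l)]"]) (simp add: fibres_def)
    qed
  qed
qed

lemma openin_box: "open C \<Longrightarrow> open C' \<Longrightarrow> openin (top_of_set (S \<times> S)) (box C C')"
proof -
  assume "open C" "open C'"
  then have "open (C \<times> C')" by (rule open_Times)
  moreover have "box C C' = (S \<times> S) \<inter> (C \<times> C')" by (auto simp: box_def)
  ultimately show ?thesis unfolding openin_open by blast
qed

lemma fibre_generated_Un:
  assumes A: "openin (top_of_set (S \<times> S)) A" and B: "openin (top_of_set (S \<times> S)) B"
    and gA: "fibre_generated A" and gB: "fibre_generated B" and gAB: "fibre_generated (A \<inter> B)"
  shows "fibre_generated (A \<union> B)"
proof -
  have sub: "A \<union> B \<subseteq> S \<times> S"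
    using openin_imp_subset [OF A] openin_imp_subset [OF B] by blast
  have o: "openin (top_of_set (A \<union> B)) A" "openin (top_of_set (A \<union> B)) B"
    using openin_restrict [OF A sub] openin_restrict [OF B sub] by (simp_all add: Int_absorb2)
  have split: "\<exists>a b. cyc j A off_diag a \<and> cyc j B off_diag b \<and> hmg j (A \<union> B) off_diag z (a + b)"
    if jm: "j \<le> m" and zj: "cyc j (A \<union> B) off_diag z" for j z
  proof -
    have van: "j = 0 \<or> (\<forall>w. cyc (j - 1) (A \<inter> B) off_diag w \<longrightarrow> hmg (j - 1) (A \<inter> B) off_diag w 0)"
      using fibre_generatedD(1) [OF gAB] jm by (cases j) auto
    obtain a b where "cyc j A off_diag a" "cyc j B off_diag b" "hmg j (A \<union> B) off_diag z (a + b)"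
      using Mayer_Vietoris_split [OF o zj van] .
    then show ?thesis by blast
  qed
  have mono: "hmg j (A \<union> B) off_diag z w" if "hmg j A off_diag z w \<or> hmg j B off_diag z w" for j z w
    using that hmg_mono [of j A off_diag z w "A \<union> B" off_diag] hmg_mono [of j B off_diag z w "A \<union> B" off_diag] by auto
  show ?thesis
    unfolding fibre_generated_def
  proof (intro conjI allI impI)
    fix j z assume j: "j < m" and z: "cyc j (A \<union> B) off_diag z"
    obtain a b where a: "cyc j A off_diag a" and b: "cyc j B off_diag b" and h: "hmg j (A \<union> B) off_diag z (a + b)"
      using split [OF less_imp_le [OF j] z] by (elim exE conjE) (rule that)
    have "hmg j (A \<union> B) off_diag (a + b) (0 + 0)"
      using fibre_generatedD(1) [OF gA j a] fibre_generatedD(1) [OF gB j b] mono by (intro hmg_add) blast+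
    from hmg_trans [OF h this] show "hmg j (A \<union> B) off_diag z 0" by simp
  next
    fix z and e :: "'a \<Rightarrow> real" assume z: "cyc m (A \<union> B) off_diag z" and e: "\<forall>p. 0 < e p"
    then have e': "\<And>p. 0 < e p" by blast
    obtain a b where a: "cyc m A off_diag a" and b: "cyc m B off_diag b" and h: "hmg m (A \<union> B) off_diag z (a + b)"
      using split [OF order_refl z] by (elim exE conjE) (rule that)
    obtain ps where ps: "hmg m A off_diag a (fibres ps)" "\<forall>(p, l)\<in>set ps. fibre_in A p l \<and> l < e p"
      using fibre_generatedD(2) [OF gA a, of e, OF e'] by (elim exE conjE) (rule that)
    obtain qs where qs: "hmg m B off_diag b (fibres qs)" "\<forall>(p, l)\<in>set qs. fibre_in B p l \<and> l < e p"
      using fibre_generatedD(2) [OF gB b, of e, OF e'] by (elim exE conjE) (rule that)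
    have "hmg m (A \<union> B) off_diag (a + b) (fibres (ps @ qs))"
      unfolding fibres_append using ps(1) qs(1) mono by (intro hmg_add) blast+
    moreover have "\<forall>(p, l)\<in>set (ps @ qs). fibre_in (A \<union> B) p l \<and> l < e p"
      using ps(2) qs(2) fibre_in_mono [of A _ _ "A \<union> B"] fibre_in_mono [of B _ _ "A \<union> B"] by (auto simp: split_beta)
    ultimately show "\<exists>ps. hmg m (A \<union> B) off_diag z (fibres ps) \<and> (\<forall>(p, l)\<in>set ps. fibre_in (A \<union> B) p l \<and> l < e p)"
      using hmg_trans [OF h] by blast
  qed
qed

text \<open>Boxes are closed under intersection, so the overlap of a union of boxes with one more
  box is a union of boxes over the same index set. The induction hypothesis is therefore used twice,
  with different boxes.\<close>

lemma fibre_generated_Union_boxes: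
  assumes "finite I" "\<And>i. i \<in> I \<Longrightarrow> open (C i) \<and> convex (C i) \<and> open (C' i) \<and> convex (C' i)"
  shows "fibre_generated (\<Union>i\<in>I. box (C i) (C' i))"
  using assms
proof (induction I arbitrary: C C' rule: finite_induct)
  case empty
  have "z = 0" if "ch j {} z" for j and z :: "('a \<times> 'a) mod2_chain"
    using that by (rule ch_empty)
  then have shuf: "z = 0" if "cyc j {} off_diag z" for j and z :: "('a \<times> 'a) mod2_chain"
    using cyc_ch [OF that] .
  have "fibre_generated {}"
    unfolding fibre_generated_def
  proof (intro conjI allI impI exI [of _ "[]"])
    fix z :: "('a \<times> 'a) mod2_chain" assume "cyc m {} off_diag z"
    from shuf [OF this] show "hmg m {} off_diag z (fibres [])" by (simp add: hmg_refl)
  next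
    fix j and z :: "('a \<times> 'a) mod2_chain" assume "cyc j {} off_diag z"
    from shuf [OF this] show "hmg j {} off_diag z 0" by (simp add: hmg_refl)
  qed simp
  then show ?case by simp
next
  case (insert k I)
  let ?A = "\<Union>i\<in>I. box (C i) (C' i)" and ?B = "box (C k) (C' k)"
  have eq: "?A \<inter> ?B = (\<Union>i\<in>I. box (C i \<inter> C k) (C' i \<inter> C' k))"
    by (auto simp: box_def)
  have "fibre_generated (?A \<union> ?B)"
  proof (rule fibre_generated_Un)
    show "openin (top_of_set (S \<times> S)) ?A" "openin (top_of_set (S \<times> S)) ?B"
      using insert.prems by (auto intro!: openin_Union openin_box)
    show "fibre_generated ?A"
      by (rule insert.IH) (simp add: insert.prems)
    show "fibre_generated ?B"
      using insert.prems by (intro fibre_generated_box) auto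
    show "fibre_generated (?A \<inter> ?B)"
      unfolding eq by (rule insert.IH) (use insert.prems in \<open>auto intro: convex_Int\<close>)
  qed
  then show ?case by (simp add: Un_commute)
qed

lemma Union_boxes_cover:
  assumes G: "openin (top_of_set (S \<times> S)) G" and K: "compact K" "K \<subseteq> G"
  obtains H where "K \<subseteq> H" "H \<subseteq> G" "fibre_generated H"
proof -
  obtain T where T: "open T" "G = (S \<times> S) \<inter> T"
    using G unfolding openin_open by blast
  have "\<exists>r>0. ball (fst x) r \<times> ball (snd x) r \<subseteq> T" if "x \<in> K" for x
  proof -
    have "x \<in> T" using that K T by blast
    then obtain A B where AB: "open A" "open B" "x \<in> A \<times> B" "A \<times> B \<subseteq> T"
      using T(1) by (metis open_prod_elim)
    obtain r1 where r1: "0 < r1" "ball (fst x) r1 \<subseteq> A"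
      using AB by (metis mem_Times_iff openE)
    obtain r2 where r2: "0 < r2" "ball (snd x) r2 \<subseteq> B"
      using AB by (metis mem_Times_iff openE)
    have "ball (fst x) (min r1 r2) \<times> ball (snd x) (min r1 r2) \<subseteq> T"
      using r1(2) r2(2) AB(4) by fastforce
    then show ?thesis using r1(1) r2(1) by (intro exI [of _ "min r1 r2"]) simp
  qed
  then obtain r where r: "\<And>x. x \<in> K \<Longrightarrow> 0 < r x" "\<And>x. x \<in> K \<Longrightarrow> ball (fst x) (r x) \<times> ball (snd x) (r x) \<subseteq> T"
    by metis
  have "K \<subseteq> (\<Union>x\<in>K. ball (fst x) (r x) \<times> ball (snd x) (r x))"
    using r(1) by force
  then obtain F where F: "F \<subseteq> K" "finite F" "K \<subseteq> (\<Union>x\<in>F. ball (fst x) (r x) \<times> ball (snd x) (r x))"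
    by (rule compactE_image [OF K(1), of K "\<lambda>x. ball (fst x) (r x) \<times> ball (snd x) (r x)", rotated])
      (auto intro: open_Times that)
  show ?thesis
  proof (rule that)
    show "fibre_generated (\<Union>x\<in>F. box (ball (fst x) (r x)) (ball (snd x) (r x)))"
      by (rule fibre_generated_Union_boxes [OF F(2)]) auto
    show "K \<subseteq> (\<Union>x\<in>F. box (ball (fst x) (r x)) (ball (snd x) (r x)))"
    proof
      fix y assume y: "y \<in> K"
      then obtain x where "x \<in> F" "y \<in> ball (fst x) (r x) \<times> ball (snd x) (r x)"
        using F(3) by blast
      moreover have "y \<in> S \<times> S" using y K T by blast
      ultimately show "y \<in> (\<Union>x\<in>F. box (ball (fst x) (r x)) (ball (snd x) (r x)))"
        unfolding box_def by blast
    qed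
    show "(\<Union>x\<in>F. box (ball (fst x) (r x)) (ball (snd x) (r x))) \<subseteq> G"
      unfolding T(2) box_def using r(2) F(1) by blast
  qed
qed

lemma fibre_generated_open:
  assumes G: "openin (top_of_set (S \<times> S)) G"
  shows "fibre_generated G"
proof -
  have ex: "\<exists>H. H \<subseteq> G \<and> fibre_generated H \<and> cyc j H off_diag z" if z: "cyc j G off_diag z" for j z
  proof -
    obtain K where K: "compact K" "K \<subseteq> G" "ch j K z"
      using ch_compact_support [OF cyc_ch [OF z]] .
    obtain H where "K \<subseteq> H" "H \<subseteq> G" "fibre_generated H"
      using Union_boxes_cover [OF G K(1,2)] .
    moreover from this have "cyc j H off_diag z"
      using ch_mono [OF K(3)] by (intro cyc_restrict [OF z])
    ultimately show ?thesis by blast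
  qed
  show ?thesis
    unfolding fibre_generated_def
  proof (intro conjI allI impI)
    fix j z assume j: "j < m" and z: "cyc j G off_diag z"
    obtain H where H: "H \<subseteq> G" "fibre_generated H" "cyc j H off_diag z"
      using ex [OF z] by (elim exE conjE) (rule that)
    show "hmg j G off_diag z 0"
      using fibre_generatedD(1) [OF H(2) j H(3)] H(1) by (rule hmg_mono) simp
  next
    fix z and e :: "'a \<Rightarrow> real" assume z: "cyc m G off_diag z" and e: "\<forall>p. 0 < e p"
    obtain H where H: "H \<subseteq> G" "fibre_generated H" "cyc m H off_diag z"
      using ex [OF z] by (elim exE conjE) (rule that)
    obtain ps where ps: "hmg m H off_diag z (fibres ps)" "\<forall>(p, l)\<in>set ps. fibre_in H p l \<and> l < e p"
      using fibre_generatedD(2) [OF H(2,3), of e, OF spec [OF e]] by (elim exE conjE) (rule that)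
    have "hmg m G off_diag z (fibres ps)"
      using ps(1) H(1) by (rule hmg_mono) simp
    moreover have "\<forall>(p, l)\<in>set ps. fibre_in G p l \<and> l < e p"
      using ps(2) fibre_in_mono [OF _ H(1)] by auto
    ultimately show "\<exists>ps. hmg m G off_diag z (fibres ps) \<and> (\<forall>(p, l)\<in>set ps. fibre_in G p l \<and> l < e p)"
      by blast
  qed
qed

end

text \<open>A relative cohomology class, as a functional on relative cycles.\<close>

definition cls :: "nat \<Rightarrow> 'a::topological_space set \<Rightarrow> 'a set \<Rightarrow> ('a mod2_chain \<Rightarrow> bit) \<Rightarrow> bool" where
  "cls p A D f \<longleftrightarrow>
     (\<forall>z w. cyc p A D z \<longrightarrow> cyc p A D w \<longrightarrow> f (z + w) = f z + f w) \<and>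
     (\<forall>z. cyc p A D z \<longrightarrow> hmg p A D z 0 \<longrightarrow> f z = 0)"

lemma cls_add: "cls p A D f \<Longrightarrow> cyc p A D z \<Longrightarrow> cyc p A D w \<Longrightarrow> f (z + w) = f z + f w"
  by (simp add: cls_def)

lemma cls_null: "cls p A D f \<Longrightarrow> cyc p A D z \<Longrightarrow> hmg p A D z 0 \<Longrightarrow> f z = 0"
  by (simp add: cls_def)

lemma bit_add_eq_0: "(a::bit) + b = 0 \<longleftrightarrow> a = b"
  by (cases a; cases b) simp_all

lemma cls_hmg:
  assumes "cls p A D f" "cyc p A D z" "hmg p A D z w" shows "f z = f w"
proof -
  have w: "cyc p A D w" using assms(2,3) by (rule cyc_hmg)
  have "hmg p A D (z + w) 0"
    using assms(3) by (rule hmg_shift [THEN iffD1])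
  then have "f z + f w = 0"
    using cls_null [OF assms(1) cyc_add [OF assms(2) w]] cls_add [OF assms(1,2) w] by simp
  then show ?thesis by (simp only: bit_add_eq_0)
qed

text \<open>By \<open>van\<close> every cycle splits as \<open>a + b\<close>, and two splittings
  differ by a class of the intersection, where \<open>f\<close> and \<open>g\<close> agree; so
  \<open>f a + g b\<close> is well defined. The map \<open>T\<close> is carried along to pass on
  invariance under the exchange of factors.\<close>

lemma glue_cls:
  assumes oA: "openin (top_of_set (A \<union> B)) A" and oB: "openin (top_of_set (A \<union> B)) B"
    and f: "cls p A D f" and g: "cls p B D g"
    and van: "p = 0 \<or> (\<forall>w. cyc (p - 1) (A \<inter> B) D w \<longrightarrow> hmg (p - 1) (A \<inter> B) D w 0)"
    and agree: "\<And>w. cyc p (A \<inter> B) D w \<Longrightarrow> f w = g w"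
    and T: "continuous_on (A \<union> B) T" "T ` A \<subseteq> A" "T ` B \<subseteq> B" "T ` ((A \<union> B) \<inter> D) \<subseteq> D"
    and Tf: "\<And>z. cyc p A D z \<Longrightarrow> f (cm p T z) = f z" and Tg: "\<And>z. cyc p B D z \<Longrightarrow> g (cm p T z) = g z"
  obtains h where "cls p (A \<union> B) D h" "\<And>z. cyc p A D z \<Longrightarrow> h z = f z" "\<And>z. cyc p B D z \<Longrightarrow> h z = g z"
    "\<And>z. cyc p (A \<union> B) D z \<Longrightarrow> h (cm p T z) = h z"
proof -
  define Rl where "Rl z d \<longleftrightarrow> (\<exists>a b. cyc p A D a \<and> cyc p B D b \<and> hmg p (A \<union> B) D z (a + b) \<and> d = f a + g b)" for z d
  have RlI: "Rl z (f a + g b)" if "cyc p A D a" "cyc p B D b" "hmg p (A \<union> B) D z (a + b)" for z a b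
    using that unfolding Rl_def by (intro exI conjI) (assumption | rule refl)+
  have ex: "\<exists>d. Rl z d" if z: "cyc p (A \<union> B) D z" for z
  proof -
    obtain a b where "cyc p A D a" "cyc p B D b" "hmg p (A \<union> B) D z (a + b)"
      using Mayer_Vietoris_split [OF oA oB z van] .
    from RlI [OF this] show ?thesis ..
  qed
  have uniq: "d = d'" if aff_chain: "Rl z d" "Rl z d'" for z d d'
  proof -
    obtain a b where a: "cyc p A D a" and b: "cyc p B D b" and h: "hmg p (A \<union> B) D z (a + b)" and d: "d = f a + g b"
      using aff_chain(1) unfolding Rl_def by (elim exE conjE) (rule that)
    obtain a' b' where a': "cyc p A D a'" and b': "cyc p B D b'" and h': "hmg p (A \<union> B) D z (a' + b')" and d': "d' = f a' + g b'"
      using aff_chain(2) unfolding Rl_def by (elim exE conjE) (rule that)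
    have aa: "cyc p A D (a + a')" and bb: "cyc p B D (b + b')"
      using a a' b b' by (simp_all add: cyc_add)
    have "hmg p (A \<union> B) D (a + b + (a' + b')) 0"
      using hmg_trans [OF hmg_sym [OF h] h'] by (rule hmg_shift [THEN iffD1])
    then have "hmg p (A \<union> B) D (a + a' + (b + b')) 0"
      by (simp add: ac_simps)
    then have "hmg p (A \<union> B) D (a + a') (b + b')"
      by (rule hmg_shift [THEN iffD2])
    then obtain w where w: "cyc p (A \<inter> B) D w" "hmg p A D (a + a') w" "hmg p B D (b + b') w"
      using Mayer_Vietoris_join [OF oA oB aa bb] by metis
    have "f (a + a') = g (b + b')"
      using cls_hmg [OF f aa w(2)] cls_hmg [OF g bb w(3)] agree [OF w(1)] by simp
    then have "f a + f a' = g b + g b'"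
      using cls_add [OF f a a'] cls_add [OF g b b'] by simp
    then show ?thesis
      unfolding d d' by (cases "f a"; cases "f a'"; cases "g b"; cases "g b'") simp_all
  qed
  define h where "h z = (THE d. Rl z d)" for z
  have h: "h z = d" if "Rl z d" for z d
    unfolding h_def using that uniq by blast
  have Rh: "Rl z (h z)" if "cyc p (A \<union> B) D z" for z
    using ex [OF that] h by metis
  have f0: "f 0 = 0" and g0: "g 0 = 0"
    using cls_null [OF f cyc_0 hmg_refl] cls_null [OF g cyc_0 hmg_refl] by simp_all
  show ?thesis
  proof (rule that)
    show "h z = f z" if z: "cyc p A D z" for z
    proof -
      have "hmg p (A \<union> B) D z (z + 0)" by (simp add: hmg_refl)
      from h [OF RlI [OF z cyc_0 this]] show ?thesis by (simp only: g0 add_0_right)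
    qed
    show "h z = g z" if z: "cyc p B D z" for z
    proof -
      have "hmg p (A \<union> B) D z (0 + z)" by (simp add: hmg_refl)
      from h [OF RlI [OF cyc_0 z this]] show ?thesis by (simp only: f0 add_0_left)
    qed
    show "cls p (A \<union> B) D h"
      unfolding cls_def
    proof (intro conjI allI impI)
      fix z w assume z: "cyc p (A \<union> B) D z" and w: "cyc p (A \<union> B) D w"
      obtain a b where a: "cyc p A D a" and b: "cyc p B D b" and 1: "hmg p (A \<union> B) D z (a + b)" and d: "h z = f a + g b"
        using Rh [OF z] unfolding Rl_def by (elim exE conjE) (rule that)
      obtain a' b' where a': "cyc p A D a'" and b': "cyc p B D b'" and 2: "hmg p (A \<union> B) D w (a' + b')" and d': "h w = f a' + g b'"
        using Rh [OF w] unfolding Rl_def by (elim exE conjE) (rule that)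
      have "hmg p (A \<union> B) D (z + w) (a + a' + (b + b'))"
        using hmg_add [OF 1 2] by (simp add: ac_simps)
      from h [OF RlI [OF cyc_add [OF a a'] cyc_add [OF b b'] this]]
      show "h (z + w) = h z + h w"
        unfolding d d' cls_add [OF f a a'] cls_add [OF g b b'] by (simp only: ac_simps)
    next
      fix z assume "hmg p (A \<union> B) D z 0"
      then have "hmg p (A \<union> B) D z (0 + 0)" by simp
      from h [OF RlI [OF cyc_0 cyc_0 this]] show "h z = 0" by (simp only: f0 g0 add_0_left)
    qed
    show "h (cm p T z) = h z" if z: "cyc p (A \<union> B) D z" for z
    proof -
      obtain a b where a: "cyc p A D a" and b: "cyc p B D b" and 1: "hmg p (A \<union> B) D z (a + b)" and d: "h z = f a + g b"
        using Rh [OF z] unfolding Rl_def by (elim exE conjE) (rule that)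
      have Ta: "cyc p A D (cm p T a)"
        using T by (intro cyc_cm [OF a]) (auto intro: continuous_on_subset)
      have Tb: "cyc p B D (cm p T b)"
        using T by (intro cyc_cm [OF b]) (auto intro: continuous_on_subset)
      have "hmg p (A \<union> B) D (cm p T z) (cm p T a + cm p T b)"
        unfolding cm_add [symmetric] using T by (intro hmg_cm [OF 1]) auto
      from h [OF RlI [OF Ta Tb this]] show ?thesis
        by (simp only: d Tf [OF a] Tg [OF b])
    qed
  qed
qed

section \<open>Charts and the degree measured in a chart\<close>

context frame
begin

text \<open>The image is relatively open in the closed ball \<open>S\<close> and may contain points
  of its boundary sphere, so boundary points of \<open>M\<close> have charts of the same form as
  interior ones.\<close>

definition chart :: "'b::euclidean_space set \<Rightarrow> 'b set \<Rightarrow> ('b \<Rightarrow> 'a) \<Rightarrow> ('a \<Rightarrow> 'b) \<Rightarrow> bool" where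
  "chart M U \<phi> \<psi> \<longleftrightarrow> openin (top_of_set M) U \<and> homeomorphism U (\<phi> ` U) \<phi> \<psi> \<and> openin (top_of_set S) (\<phi> ` U)"

definition chart_deg :: "('b \<Rightarrow> 'a) \<Rightarrow> ('b \<times> 'b) mod2_chain \<Rightarrow> bit" where
  "chart_deg \<phi> z = local_deg (cm m (\<lambda>x. \<phi> (snd x) - \<phi> (fst x)) z)"

definition chart_fibre :: "('a \<Rightarrow> 'b) \<Rightarrow> 'a \<Rightarrow> real \<Rightarrow> ('b \<times> 'b) mod2_chain" where
  "chart_fibre \<psi> p l = cm m (map_prod \<psi> \<psi>) (fibre p l)"

lemma chartD:
  assumes "chart M U \<phi> \<psi>"
  shows "openin (top_of_set M) U" "U \<subseteq> M" "continuous_on U \<phi>" "continuous_on (\<phi> ` U) \<psi>"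
    "\<And>x. x \<in> U \<Longrightarrow> \<psi> (\<phi> x) = x" "\<phi> ` U \<subseteq> S" "openin (top_of_set S) (\<phi> ` U)" "homeomorphism U (\<phi> ` U) \<phi> \<psi>"
    "\<And>x. x \<in> U \<Longrightarrow> \<phi> x \<in> S" "inj_on \<phi> U"
  using assms openin_imp_subset unfolding chart_def homeomorphism_def by (blast, blast, blast, blast, blast, blast, blast, simp add: homeomorphism_def, blast, metis inj_onI)

lemma continuous_chart_diff:
  assumes "chart M U \<phi> \<psi>"
  shows "continuous_on (U \<times> U) (\<lambda>x. \<phi> (snd x) - \<phi> (fst x))"
  using chartD(3) [OF assms]
  by (auto intro!: continuous_intros continuous_on_compose2 [of U \<phi> "U \<times> U"])

lemma chart_diff_V: "chart M U \<phi> \<psi> \<Longrightarrow> (\<lambda>x. \<phi> (snd x) - \<phi> (fst x)) ` (U \<times> U) \<subseteq> V"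
  using chartD(9) by (fastforce intro: span_diff)

lemma chart_diff_Dn:
  assumes "chart M U \<phi> \<psi>"
  shows "(\<lambda>x. \<phi> (snd x) - \<phi> (fst x)) ` (U \<times> U \<inter> off_diag) \<subseteq> Dn m"
proof (clarify, rule V_Dn)
  fix x y assume xy: "x \<in> U" "y \<in> U" "(x, y) \<in> off_diag"
  show "\<phi> (snd (x, y)) - \<phi> (fst (x, y)) \<in> V"
    using chartD(9) [OF assms] xy by (auto intro: span_diff)
  show "\<phi> (snd (x, y)) - \<phi> (fst (x, y)) \<noteq> 0"
    using inj_onD [OF chartD(10) [OF assms], of y x] xy by (auto simp: off_diag_def)
qed

lemma cyc_chart_diff:
  assumes "chart M U \<phi> \<psi>" "cyc j (U \<times> U) off_diag z"
  shows "cyc j V (Dn m) (cm j (\<lambda>x. \<phi> (snd x) - \<phi> (fst x)) z)"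
  by (rule cyc_cm [OF assms(2) continuous_chart_diff [OF assms(1)] chart_diff_V [OF assms(1)] chart_diff_Dn [OF assms(1)]])

lemma cls_chart_deg: assumes "chart M U \<phi> \<psi>" shows "cls m (U \<times> U) off_diag (chart_deg \<phi>)"
  unfolding cls_def
proof (intro conjI allI impI)
  fix z w assume "cyc m (U \<times> U) off_diag z" "cyc m (U \<times> U) off_diag w"
  then show "chart_deg \<phi> (z + w) = chart_deg \<phi> z + chart_deg \<phi> w"
    unfolding chart_deg_def cm_add using cyc_chart_diff [OF assms] by (intro local_deg_add)
next
  fix z assume "hmg m (U \<times> U) off_diag z 0"
  from hmg_cm [OF this continuous_chart_diff [OF assms] chart_diff_V [OF assms] chart_diff_Dn [OF assms]]
  show "chart_deg \<phi> z = 0"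
    unfolding chart_deg_def by (simp add: local_deg_eq_0_iff)
qed

lemma chart_deg_swap:
  assumes "chart M U \<phi> \<psi>" "cyc m (U \<times> U) off_diag z"
  shows "chart_deg \<phi> (cm m prod.swap z) = chart_deg \<phi> z"
proof -
  let ?d = "\<lambda>x. \<phi> (snd x) - \<phi> (fst x)"
  have "cm m ?d (cm m prod.swap z) = cm m uminus (cm m ?d z)"
    unfolding cm_compose by (rule cm_cong [OF cyc_ch [OF assms(2)]]) simp
  then show ?thesis
    unfolding chart_deg_def using local_deg_neg [OF cyc_chart_diff [OF assms]] by simp
qed

text \<open>Read in the second chart, the disc becomes \<open>u \<mapsto> \<phi>' (\<psi> (p + l u))
  - \<phi>' (\<psi> (p - l u))\<close>, which is odd by its form and, by injectivity, zero only at
  the origin.\<close>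

lemma chart_deg_chart_fibre:
  assumes m: "0 < m" and a: "chart M U \<phi> \<psi>" and b: "chart M U' \<phi>' \<psi>'"
    and l: "fibre_in (\<phi> ` U \<times> \<phi> ` U) p l" and U': "\<And>u. u \<in> S \<Longrightarrow> (\<psi> (p - l *\<^sub>R u), \<psi> (p + l *\<^sub>R u)) \<in> U' \<times> U'"
  shows "chart_deg \<phi>' (chart_fibre \<psi> p l) = 1"
proof -
  let ?g = "\<lambda>u. \<phi>' (\<psi> (p + l *\<^sub>R u)) - \<phi>' (\<psi> (p - l *\<^sub>R u))"
  have in1: "p + l *\<^sub>R u \<in> \<phi> ` U" "p - l *\<^sub>R u \<in> \<phi> ` U" if "u \<in> S" for u
    using l that unfolding fibre_in_def by auto
  have in2: "\<psi> (p + l *\<^sub>R u) \<in> U'" "\<psi> (p - l *\<^sub>R u) \<in> U'" if "u \<in> S" for u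
    using U' [OF that] by auto
  have "local_deg (cm m ?g (Z m)) = 1"
  proof (rule local_deg_odd_map [OF m])
    have 1: "continuous_on S (\<lambda>u. \<psi> (p + l *\<^sub>R u))"
      by (rule continuous_on_compose2 [OF chartD(4) [OF a]]) (use in1 in \<open>auto intro!: continuous_intros\<close>)
    have 2: "continuous_on S (\<lambda>u. \<psi> (p - l *\<^sub>R u))"
      by (rule continuous_on_compose2 [OF chartD(4) [OF a]]) (use in1 in \<open>auto intro!: continuous_intros\<close>)
    have 3: "continuous_on S (\<lambda>u. \<phi>' (\<psi> (p + l *\<^sub>R u)))"
      by (rule continuous_on_compose2 [OF chartD(3) [OF b] 1]) (use in2 in auto)
    have 4: "continuous_on S (\<lambda>u. \<phi>' (\<psi> (p - l *\<^sub>R u)))"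
      by (rule continuous_on_compose2 [OF chartD(3) [OF b] 2]) (use in2 in auto)
    show "continuous_on S ?g"
      by (rule continuous_on_diff [OF 3 4])
    show "?g ` S \<subseteq> V"
      using in2 chartD(9) [OF b] by (fastforce intro: span_diff)
    show "?g (- u) = - ?g u" for u by simp
    show "?g u \<noteq> 0" if "u \<in> S" "u \<noteq> 0" for u
    proof
      assume "?g u = 0"
      then have "\<psi> (p + l *\<^sub>R u) = \<psi> (p - l *\<^sub>R u)"
        using inj_onD [OF chartD(10) [OF b]] in2 [OF that(1)] by simp
      then have "p + l *\<^sub>R u = p - l *\<^sub>R u"
        using in1 [OF that(1)] chartD(5) [OF a] by (metis imageE)
      then have "2 *\<^sub>R (l *\<^sub>R u) = 0" unfolding scaleR_2 by (simp add: algebra_simps)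
      then show False using that(2) l unfolding fibre_in_def by simp
    qed
  qed
  moreover have "cm m (\<lambda>x. \<phi>' (snd x) - \<phi>' (fst x)) (chart_fibre \<psi> p l) = cm m ?g (Z m)"
    unfolding chart_fibre_def fibre_def cm_compose by (simp add: o_def)
  ultimately show ?thesis by (simp add: chart_deg_def)
qed

lemma small_fibre:
  assumes a: "chart M U \<phi> \<psi>" and T: "openin (top_of_set (M \<times> M)) T" and p: "p \<in> \<phi> ` U" "(\<psi> p, \<psi> p) \<in> T"
  obtains e where "0 < e" "\<And>l u. fibre_in (\<phi> ` U \<times> \<phi> ` U) p l \<Longrightarrow> l < e \<Longrightarrow> u \<in> S \<Longrightarrow> (\<psi> (p - l *\<^sub>R u), \<psi> (p + l *\<^sub>R u)) \<in> T"
proof -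
  have UM: "U \<subseteq> M" by (rule chartD(2) [OF a])
  have \<psi>U: "\<psi> x \<in> U" if "x \<in> \<phi> ` U" for x
    using that chartD(5) [OF a] by auto
  obtain T' where T': "open T'" "T = (M \<times> M) \<inter> T'"
    using T unfolding openin_open by blast
  have "(\<psi> p, \<psi> p) \<in> T'" using p T' by simp
  then obtain A B where AB: "open A" "open B" "(\<psi> p, \<psi> p) \<in> A \<times> B" "A \<times> B \<subseteq> T'"
    using T'(1) by (metis open_prod_elim)
  have "open (A \<inter> B)" "\<psi> p \<in> A \<inter> B" using AB by auto
  then obtain r where r: "0 < r" "ball (\<psi> p) r \<subseteq> A \<inter> B"
    by (meson openE)
  obtain e where e: "0 < e" "\<And>x. x \<in> \<phi> ` U \<Longrightarrow> dist x p < e \<Longrightarrow> dist (\<psi> x) (\<psi> p) < r"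
    using chartD(4) [OF a] p(1) r(1) unfolding continuous_on_iff by metis
  show ?thesis
  proof (rule that [OF e(1)])
    fix l u assume l: "fibre_in (\<phi> ` U \<times> \<phi> ` U) p l" "l < e" and u: "u \<in> S"
    have l0: "0 < l" using l(1) by (simp add: fibre_in_def)
    have "l * norm u \<le> l * 1"
      using u l0 by (intro mult_left_mono) auto
    then have lu: "l * norm u < e" using l(2) by simp
    have i: "p - l *\<^sub>R u \<in> \<phi> ` U" "p + l *\<^sub>R u \<in> \<phi> ` U"
      using l(1) u unfolding fibre_in_def by auto
    have "dist (\<psi> (p - l *\<^sub>R u)) (\<psi> p) < r" "dist (\<psi> (p + l *\<^sub>R u)) (\<psi> p) < r"
      using e(2) [OF i(1)] e(2) [OF i(2)] lu l0 by (simp_all add: dist_norm)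
    then have "\<psi> (p - l *\<^sub>R u) \<in> A" "\<psi> (p + l *\<^sub>R u) \<in> B"
      using r(2) by (auto simp: dist_commute)
    then show "(\<psi> (p - l *\<^sub>R u), \<psi> (p + l *\<^sub>R u)) \<in> T"
      using AB(4) \<psi>U [OF i(1)] \<psi>U [OF i(2)] UM T'(2) by blast
  qed
qed

end

lemma open_off_diag: "open (off_diag :: ('a::t2_space \<times> 'a) set)"
proof -
  have eq: "(off_diag :: ('a \<times> 'a) set) = - {y. \<exists>x. y = (x, x)}" by (auto simp: off_diag_def)
  show ?thesis unfolding eq by (rule open_Compl [OF closed_diagonal])
qed

context frame
begin

definition chart_fibres :: "('a \<Rightarrow> 'b) \<Rightarrow> ('a \<times> real) list \<Rightarrow> ('b \<times> 'b) mod2_chain" where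
  "chart_fibres \<psi> ps = (\<Sum>(p, l)\<leftarrow>ps. chart_fibre \<psi> p l)"

lemma cm_fibres: "cm m (map_prod \<psi> \<psi>) (fibres ps) = chart_fibres \<psi> ps"
  by (induction ps) (auto simp: fibres_def chart_fibres_def chart_fibre_def cm_add)

lemma continuous_on_map_prod: "continuous_on A f \<Longrightarrow> continuous_on (A \<times> A) (map_prod f f)"
  unfolding map_prod_def split_def
  by (intro continuous_on_Pair) (auto intro: continuous_on_compose2 [OF _ continuous_on_fst] continuous_on_compose2 [OF _ continuous_on_snd])

lemma homeomorphism_prod:
  assumes "homeomorphism A B f g"
  shows "homeomorphism (A \<times> A) (B \<times> B) (map_prod f f) (map_prod g g)"
proof (rule homeomorphismI)
  note h = assms [unfolded homeomorphism_def]
  show "continuous_on (A \<times> A) (map_prod f f)" "continuous_on (B \<times> B) (map_prod g g)"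
    using h by (simp_all add: continuous_on_map_prod)
  show "map_prod f f ` (A \<times> A) \<subseteq> B \<times> B" "map_prod g g ` (B \<times> B) \<subseteq> A \<times> A"
    using h by auto
  show "map_prod g g (map_prod f f x) = x" if "x \<in> A \<times> A" for x
    using h that by auto
  show "map_prod f f (map_prod g g x) = x" if "x \<in> B \<times> B" for x
    using h that by auto
qed

lemma openin_chart_prod:
  assumes a: "chart M U \<phi> \<psi>" and G: "openin (top_of_set (U \<times> U)) G"
  shows "openin (top_of_set (S \<times> S)) (map_prod \<phi> \<phi> ` G)"
proof -
  have "openin (top_of_set (\<phi> ` U \<times> \<phi> ` U)) (map_prod \<phi> \<phi> ` G)"
    by (rule homeomorphism_imp_open_map [OF homeomorphism_prod [OF chartD(8) [OF a]] G])
  moreover have "openin (top_of_set (S \<times> S)) (\<phi> ` U \<times> \<phi> ` U)"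
    using chartD(7) [OF a] by (intro openin_Times)
  ultimately show ?thesis by (rule openin_trans)
qed

lemma chart_transfer:
  assumes a: "chart M U \<phi> \<psi>" and G: "G \<subseteq> U \<times> U" and z: "cyc j G off_diag z"
  shows "cyc j (map_prod \<phi> \<phi> ` G) off_diag (cm j (map_prod \<phi> \<phi>) z)"
    and "hmg j (map_prod \<phi> \<phi> ` G) off_diag (cm j (map_prod \<phi> \<phi>) z) w \<Longrightarrow> hmg j G off_diag z (cm j (map_prod \<psi> \<psi>) w)"
proof -
  note h = homeomorphism_prod [OF chartD(8) [OF a]]
  have c1: "continuous_on G (map_prod \<phi> \<phi>)"
    using h G unfolding homeomorphism_def by (meson continuous_on_subset)
  have sub: "map_prod \<phi> \<phi> ` G \<subseteq> \<phi> ` U \<times> \<phi> ` U" using G by auto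
  have c2: "continuous_on (map_prod \<phi> \<phi> ` G) (map_prod \<psi> \<psi>)"
    using h sub unfolding homeomorphism_def by (meson continuous_on_subset)
  have inv: "map_prod \<psi> \<psi> (map_prod \<phi> \<phi> x) = x" if "x \<in> G" for x
    using that G chartD(5) [OF a] by auto
  show "cyc j (map_prod \<phi> \<phi> ` G) off_diag (cm j (map_prod \<phi> \<phi>) z)"
  proof (rule cyc_cm [OF z c1])
    show "map_prod \<phi> \<phi> ` (G \<inter> off_diag) \<subseteq> off_diag"
      using G chartD(10) [OF a] by (auto simp: off_diag_def dest!: inj_onD)
  qed simp
  have id: "cm j (map_prod \<psi> \<psi>) (cm j (map_prod \<phi> \<phi>) z) = z"
    unfolding cm_compose by (rule cm_ident [OF cyc_ch [OF z]]) (simp add: inv del: map_prod_simp)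
  show "hmg j G off_diag z (cm j (map_prod \<psi> \<psi>) w)" if w: "hmg j (map_prod \<phi> \<phi> ` G) off_diag (cm j (map_prod \<phi> \<phi>) z) w"
  proof -
    have "hmg j G off_diag (cm j (map_prod \<psi> \<psi>) (cm j (map_prod \<phi> \<phi>) z)) (cm j (map_prod \<psi> \<psi>) w)"
    proof (rule hmg_cm [OF w c2])
      show "map_prod \<psi> \<psi> ` map_prod \<phi> \<phi> ` G \<subseteq> G"
        unfolding image_image using inv by (simp add: image_subset_iff del: map_prod_simp)
      show "map_prod \<psi> \<psi> ` (map_prod \<phi> \<phi> ` G \<inter> off_diag) \<subseteq> off_diag"
      proof (rule image_subsetI)
        fix w assume w: "w \<in> map_prod \<phi> \<phi> ` G \<inter> off_diag"
        from IntD1 [OF w] obtain x where x: "w = map_prod \<phi> \<phi> x" "x \<in> G" by (rule imageE)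
        obtain a b where ab: "x = (a, b)" by (cases x)
        have "a \<noteq> b" using IntD2 [OF w] by (auto simp: x ab off_diag_def)
        then show "map_prod \<psi> \<psi> w \<in> off_diag"
          unfolding x(1) inv [OF x(2)] by (simp add: ab off_diag_def)
      qed
    qed
    then show ?thesis unfolding id .
  qed
qed

lemma chart_null_below:
  assumes a: "chart M U \<phi> \<psi>" and G: "openin (top_of_set (U \<times> U)) G" and j: "j < m" and z: "cyc j G off_diag z"
  shows "hmg j G off_diag z 0"
proof -
  have sub: "G \<subseteq> U \<times> U" using G by (rule openin_imp_subset)
  note t = chart_transfer [OF a sub z]
  have "hmg j (map_prod \<phi> \<phi> ` G) off_diag (cm j (map_prod \<phi> \<phi>) z) 0"
    by (rule fibre_generatedD(1) [OF fibre_generated_open [OF openin_chart_prod [OF a G]] j t(1)])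
  from t(2) [OF this] show ?thesis by simp
qed

lemma chart_fibre_generated:
  assumes a: "chart M U \<phi> \<psi>" and G: "openin (top_of_set (U \<times> U)) G" and z: "cyc m G off_diag z" and e: "\<And>p. 0 < e p"
  obtains ps where "hmg m G off_diag z (chart_fibres \<psi> ps)" "\<And>p l. (p, l) \<in> set ps \<Longrightarrow> fibre_in (map_prod \<phi> \<phi> ` G) p l \<and> l < e p"
proof -
  have sub: "G \<subseteq> U \<times> U" using G by (rule openin_imp_subset)
  note t = chart_transfer [OF a sub z]
  obtain ps where ps: "hmg m (map_prod \<phi> \<phi> ` G) off_diag (cm m (map_prod \<phi> \<phi>) z) (fibres ps)"
    "\<forall>(p, l)\<in>set ps. fibre_in (map_prod \<phi> \<phi> ` G) p l \<and> l < e p"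
    using fibre_generatedD(2) [OF fibre_generated_open [OF openin_chart_prod [OF a G]] t(1), of e, OF e]
    by (elim exE conjE) (rule that)
  show ?thesis
    using that [OF t(2) [OF ps(1), unfolded cm_fibres]] ps(2) by blast
qed

lemma fibre_inD: "fibre_in G p l \<Longrightarrow> u \<in> S \<Longrightarrow> (p - l *\<^sub>R u, p + l *\<^sub>R u) \<in> G"
  "fibre_in G p l \<Longrightarrow> 0 < l" "fibre_in G p l \<Longrightarrow> (p, p) \<in> G"
proof -
  show 1: "fibre_in G p l \<Longrightarrow> u \<in> S \<Longrightarrow> (p - l *\<^sub>R u, p + l *\<^sub>R u) \<in> G" for u
    by (simp add: fibre_in_def)
  show "fibre_in G p l \<Longrightarrow> 0 < l" by (simp add: fibre_in_def)
  show "fibre_in G p l \<Longrightarrow> (p, p) \<in> G" using 1 [OF _ zero_in_S] by simp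
qed

lemma cyc_chart_fibre:
  assumes a: "chart M U \<phi> \<psi>" and l: "fibre_in (\<phi> ` U \<times> \<phi> ` U) p l"
    and T: "\<And>u. u \<in> S \<Longrightarrow> (\<psi> (p - l *\<^sub>R u), \<psi> (p + l *\<^sub>R u)) \<in> T"
  shows "cyc m T off_diag (chart_fibre \<psi> p l)"
proof -
  let ?k = "\<lambda>u. (\<psi> (p - l *\<^sub>R u), \<psi> (p + l *\<^sub>R u))"
  have in1: "p + l *\<^sub>R u \<in> \<phi> ` U" "p - l *\<^sub>R u \<in> \<phi> ` U" if "u \<in> S" for u
    using fibre_inD(1) [OF l that] by auto
  have "cyc m S (Dn m) (Z m)"
    by (rule cyc_restrict [OF Z_cyc Z_S]) simp_all
  then have "cyc m T off_diag (cm m ?k (Z m))"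
  proof (rule cyc_cm)
    show "continuous_on S ?k"
      by (intro continuous_on_Pair continuous_on_compose2 [OF chartD(4) [OF a]]) (use in1 in \<open>auto intro!: continuous_intros\<close>)
    show "?k ` S \<subseteq> T" using T by blast
    show "?k ` (S \<inter> Dn m) \<subseteq> off_diag"
    proof clarify
      fix u assume u: "u \<in> cball 0 1" "u \<in> V" "u \<in> Dn m"
      then have uS: "u \<in> S" by simp
      have "\<psi> (p - l *\<^sub>R u) \<noteq> \<psi> (p + l *\<^sub>R u)"
      proof
        assume "\<psi> (p - l *\<^sub>R u) = \<psi> (p + l *\<^sub>R u)"
        then have "p + l *\<^sub>R u = p - l *\<^sub>R u"
          using in1 [OF uS] chartD(5) [OF a] by (metis imageE)
        then have "2 *\<^sub>R (l *\<^sub>R u) = 0" unfolding scaleR_2 by (simp add: algebra_simps)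
        then show False using Dn_nonzero [OF u(3)] fibre_inD(2) [OF l] by simp
      qed
      then show "?k u \<in> off_diag" by (simp add: off_diag_def)
    qed
  qed
  then show ?thesis
    unfolding chart_fibre_def fibre_def cm_compose by (simp add: o_def)
qed

lemma cls_eq_on_chart_fibres:
  assumes f: "cls m G off_diag f" and g: "cls m G off_diag g"
    and "\<And>p l. (p, l) \<in> set ps \<Longrightarrow> cyc m G off_diag (chart_fibre \<psi> p l) \<and> f (chart_fibre \<psi> p l) = g (chart_fibre \<psi> p l)"
  shows "f (chart_fibres \<psi> ps) = g (chart_fibres \<psi> ps) \<and> cyc m G off_diag (chart_fibres \<psi> ps)"
  using assms(3)
proof (induction ps)
  case Nil
  show ?case
    using cls_null [OF f cyc_0 hmg_refl] cls_null [OF g cyc_0 hmg_refl] by (simp add: chart_fibres_def)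
next
  case (Cons x ps)
  obtain p l where x: "x = (p, l)" by fastforce
  have 1: "f (chart_fibres \<psi> ps) = g (chart_fibres \<psi> ps)" "cyc m G off_diag (chart_fibres \<psi> ps)"
    using Cons by auto
  have 2: "cyc m G off_diag (chart_fibre \<psi> p l)" "f (chart_fibre \<psi> p l) = g (chart_fibre \<psi> p l)"
    using Cons.prems x by auto
  have "chart_fibres \<psi> (x # ps) = chart_fibre \<psi> p l + chart_fibres \<psi> ps"
    by (simp add: chart_fibres_def x)
  then show ?case
    using cls_add [OF f 2(1) 1(2)] cls_add [OF g 2(1) 1(2)] 1 2 cyc_add by simp
qed

lemma cls_mono: "cls p A D f \<Longrightarrow> A' \<subseteq> A \<Longrightarrow> cls p A' D f"
  unfolding cls_def by (meson cyc_mono hmg_mono order_refl)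

text \<open>Relative cycles over a chart are homologous to sums of discs as small as desired, and on
  these both functionals take the value 1.\<close>

lemma chart_agree:
  assumes m: "0 < m" and a: "chart M U \<phi> \<psi>" and G: "openin (top_of_set (U \<times> U)) G" and f: "cls m G off_diag f"
    and e: "\<And>p. p \<in> \<phi> ` U \<Longrightarrow> (\<psi> p, \<psi> p) \<in> G \<Longrightarrow> \<exists>e>0. \<forall>l. fibre_in (\<phi> ` U \<times> \<phi> ` U) p l \<longrightarrow> l < e \<longrightarrow> f (chart_fibre \<psi> p l) = 1"
    and w: "cyc m G off_diag w"
  shows "f w = chart_deg \<phi> w"
proof -
  have sub: "G \<subseteq> U \<times> U" using G by (rule openin_imp_subset)
  have g: "cls m G off_diag (chart_deg \<phi>)"
    by (rule cls_mono [OF cls_chart_deg [OF a] sub])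
  have "\<exists>e>0. p \<in> \<phi> ` U \<longrightarrow> (\<psi> p, \<psi> p) \<in> G \<longrightarrow> (\<forall>l. fibre_in (\<phi> ` U \<times> \<phi> ` U) p l \<longrightarrow> l < e \<longrightarrow> f (chart_fibre \<psi> p l) = 1)" for p
    using e [of p] zero_less_one by blast
  then obtain e where e0: "\<And>p. 0 < e p"
    and e1: "\<And>p l. p \<in> \<phi> ` U \<Longrightarrow> (\<psi> p, \<psi> p) \<in> G \<Longrightarrow> fibre_in (\<phi> ` U \<times> \<phi> ` U) p l \<Longrightarrow> l < e p \<Longrightarrow> f (chart_fibre \<psi> p l) = 1"
    by metis
  obtain ps where ps: "hmg m G off_diag w (chart_fibres \<psi> ps)"
    and psl: "\<And>p l. (p, l) \<in> set ps \<Longrightarrow> fibre_in (map_prod \<phi> \<phi> ` G) p l \<and> l < e p"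
    using chart_fibre_generated [OF a G w, of e, OF e0] by metis
  have "f (chart_fibres \<psi> ps) = chart_deg \<phi> (chart_fibres \<psi> ps)"
  proof (rule cls_eq_on_chart_fibres [OF f g, THEN conjunct1])
    fix p l assume "(p, l) \<in> set ps"
    then have l: "fibre_in (map_prod \<phi> \<phi> ` G) p l" "l < e p" using psl by blast+
    have inG: "(\<psi> x, \<psi> y) \<in> G" if "(x, y) \<in> map_prod \<phi> \<phi> ` G" for x y
      using that sub chartD(5) [OF a] by auto
    have l': "fibre_in (\<phi> ` U \<times> \<phi> ` U) p l"
      using l(1) by (rule fibre_in_mono) (use sub in auto)
    have p: "p \<in> \<phi> ` U" "(\<psi> p, \<psi> p) \<in> G"
      using fibre_inD(3) [OF l'] inG [OF fibre_inD(3) [OF l(1)]] by auto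
    have fin: "(\<psi> (p - l *\<^sub>R u), \<psi> (p + l *\<^sub>R u)) \<in> G" if "u \<in> S" for u
      by (rule inG [OF fibre_inD(1) [OF l(1) that]])
    have "cyc m G off_diag (chart_fibre \<psi> p l)"
      by (rule cyc_chart_fibre [OF a l' fin])
    moreover have "f (chart_fibre \<psi> p l) = 1"
      by (rule e1 [OF p l' l(2)])
    moreover have "chart_deg \<phi> (chart_fibre \<psi> p l) = 1"
      using fin sub by (intro chart_deg_chart_fibre [OF m a a l']) blast
    ultimately show "cyc m G off_diag (chart_fibre \<psi> p l) \<and> f (chart_fibre \<psi> p l) = chart_deg \<phi> (chart_fibre \<psi> p l)" by simp
  qed
  then show ?thesis
    using cls_hmg [OF f w ps] cls_hmg [OF g w ps] by simp
qed

theorem thom_class: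
  fixes M :: "'b::euclidean_space set" and n :: nat
  assumes m: "0 < m" and ch: "\<And>i. i < n \<Longrightarrow> chart M (U i) (\<phi> i) (\<psi> i)" and M: "M = (\<Union>i<n. U i)"
  obtains D where "cls m (M \<times> M) off_diag D"
    "\<And>i z. i < n \<Longrightarrow> cyc m (U i \<times> U i) off_diag z \<Longrightarrow> D z = chart_deg (\<phi> i) z"
    "\<And>z. cyc m (M \<times> M) off_diag z \<Longrightarrow> D (cm m prod.swap z) = D z"
    "\<And>z. ch m ((M \<times> M) \<inter> off_diag) z \<Longrightarrow> D z = 0"
proof -
  define A where "A r = (\<Union>i<r. U i \<times> U i)" for r
  have UM: "openin (top_of_set M) (U i)" "U i \<subseteq> M" if "i < n" for i
    using chartD(1,2) [OF ch [OF that]] by auto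
  have UU: "openin (top_of_set (M \<times> M)) (U i \<times> U i)" if "i < n" for i
    using UM [OF that] by (intro openin_Times)
  have oA: "openin (top_of_set (M \<times> M)) (A r)" if "r \<le> n" for r
    unfolding A_def
  proof (rule openin_Union, clarify)
    fix i assume "i < r"
    then have "i < n" using that by simp
    then show "openin (top_of_set (M \<times> M)) (U i \<times> U i)" by (rule UU)
  qed
  have A_sub: "A r \<subseteq> M \<times> M" if "r \<le> n" for r
    using oA [OF that] by (rule openin_imp_subset)
  have swap: "continuous_on X (prod.swap :: 'b \<times> 'b \<Rightarrow> 'b \<times> 'b)" for X
    by (rule continuous_on_swap)
  have swoff: "prod.swap ` (X \<inter> off_diag) \<subseteq> off_diag" for X :: "('b \<times> 'b) set"
    by (auto simp: off_diag_def)
  \<comment> \<open>The last clause speaks of the discs of all charts, glued or not: it is what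
    \<open>chart_agree\<close> asks for when the next chart is attached.\<close>
  have glue_ex: "\<exists>D. cls m (A r) off_diag D \<and> (\<forall>i<r. \<forall>z. cyc m (U i \<times> U i) off_diag z \<longrightarrow> D z = chart_deg (\<phi> i) z) \<and>
      (\<forall>z. cyc m (A r) off_diag z \<longrightarrow> D (cm m prod.swap z) = D z) \<and>
      (\<forall>i<n. \<forall>p\<in>\<phi> i ` U i. (\<psi> i p, \<psi> i p) \<in> A r \<longrightarrow>
         (\<exists>e>0. \<forall>l. fibre_in (\<phi> i ` U i \<times> \<phi> i ` U i) p l \<longrightarrow> l < e \<longrightarrow> D (chart_fibre (\<psi> i) p l) = 1))" if "r \<le> n" for r
    using that
  proof (induction r)
    case 0
    have "cls m (A 0) off_diag (\<lambda>z. 0)" by (simp add: cls_def)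
    then show ?case
      by (intro exI [of _ "\<lambda>z. 0"]) (simp add: A_def)
  next
    case (Suc r)
    then have r: "r < n" and r': "r \<le> n" by auto
    obtain D where D: "cls m (A r) off_diag D"
      and Dd: "\<forall>i<r. \<forall>z. cyc m (U i \<times> U i) off_diag z \<longrightarrow> D z = chart_deg (\<phi> i) z"
      and Ds: "\<forall>z. cyc m (A r) off_diag z \<longrightarrow> D (cm m prod.swap z) = D z"
      and De: "\<forall>i<n. \<forall>p\<in>\<phi> i ` U i. (\<psi> i p, \<psi> i p) \<in> A r \<longrightarrow>
         (\<exists>e>0. \<forall>l. fibre_in (\<phi> i ` U i \<times> \<phi> i ` U i) p l \<longrightarrow> l < e \<longrightarrow> D (chart_fibre (\<psi> i) p l) = 1)"
      using Suc.IH [OF r'] by (elim exE conjE) (rule that)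
    let ?B = "U r \<times> U r"
    note cr = ch [OF r]
    have AS: "A (Suc r) = A r \<union> ?B"
      by (auto simp: A_def less_Suc_eq)
    have sub: "A r \<union> ?B \<subseteq> M \<times> M"
      using A_sub [OF r'] UM [OF r] by auto
    have o: "openin (top_of_set (A r \<union> ?B)) (A r)" "openin (top_of_set (A r \<union> ?B)) ?B"
      using openin_restrict [OF oA [OF r'] sub] openin_restrict [OF UU [OF r] sub] by (simp_all add: Int_absorb2)
    have G: "openin (top_of_set ?B) (A r \<inter> ?B)"
      using UM [OF r] by (intro openin_restrict [OF oA [OF r']]) auto
    have van: "m = 0 \<or> (\<forall>w. cyc (m - 1) (A r \<inter> ?B) off_diag w \<longrightarrow> hmg (m - 1) (A r \<inter> ?B) off_diag w 0)"
      using chart_null_below [OF cr G] m by simp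
    have agree: "D w = chart_deg (\<phi> r) w" if w: "cyc m (A r \<inter> ?B) off_diag w" for w
    proof (rule chart_agree [OF m cr G _ _ w])
      show "cls m (A r \<inter> ?B) off_diag D" by (rule cls_mono [OF D]) auto
      show "\<exists>e>0. \<forall>l. fibre_in (\<phi> r ` U r \<times> \<phi> r ` U r) p l \<longrightarrow> l < e \<longrightarrow> D (chart_fibre (\<psi> r) p l) = 1"
        if "p \<in> \<phi> r ` U r" "(\<psi> r p, \<psi> r p) \<in> A r \<inter> ?B" for p
        using De [rule_format, OF r that(1) IntD1 [OF that(2)]] by (elim exE conjE) (intro exI conjI)
    qed
    have sA: "prod.swap ` A r \<subseteq> A r" and sB: "prod.swap ` ?B \<subseteq> ?B"
      by (auto simp: A_def)
    obtain h where h: "cls m (A r \<union> ?B) off_diag h" and hA: "\<And>z. cyc m (A r) off_diag z \<Longrightarrow> h z = D z"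
      and hB: "\<And>z. cyc m ?B off_diag z \<Longrightarrow> h z = chart_deg (\<phi> r) z"
      and hs: "\<And>z. cyc m (A r \<union> ?B) off_diag z \<Longrightarrow> h (cm m prod.swap z) = h z"
      using glue_cls [OF o D cls_chart_deg [OF cr] van agree swap sA sB swoff Ds [rule_format] chart_deg_swap [OF cr]] by metis
    have "\<exists>e>0. \<forall>l. fibre_in (\<phi> i ` U i \<times> \<phi> i ` U i) p l \<longrightarrow> l < e \<longrightarrow> h (chart_fibre (\<psi> i) p l) = 1"
      if i: "i < n" and p: "p \<in> \<phi> i ` U i" "(\<psi> i p, \<psi> i p) \<in> A r \<union> ?B" for i p
    \<comment> \<open>A small disc lies wholly in a part that contains its centre. There the glued
      class is either \<open>D\<close> or the degree in chart \<open>r\<close>, and the latter is 1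
      even though the disc comes from chart \<open>i\<close>.\<close>
    proof (cases "(\<psi> i p, \<psi> i p) \<in> A r")
      case True
      obtain e1 where e1: "0 < e1" "\<And>l. fibre_in (\<phi> i ` U i \<times> \<phi> i ` U i) p l \<Longrightarrow> l < e1 \<Longrightarrow> D (chart_fibre (\<psi> i) p l) = 1"
        using De i p(1) True by blast
      obtain e2 where e2: "0 < e2" "\<And>l u. fibre_in (\<phi> i ` U i \<times> \<phi> i ` U i) p l \<Longrightarrow> l < e2 \<Longrightarrow> u \<in> S \<Longrightarrow>
          (\<psi> i (p - l *\<^sub>R u), \<psi> i (p + l *\<^sub>R u)) \<in> A r"
        using small_fibre [OF ch [OF i] oA [OF r'] p(1) True] by metis
      have "h (chart_fibre (\<psi> i) p l) = 1" if l: "fibre_in (\<phi> i ` U i \<times> \<phi> i ` U i) p l" "l < min e1 e2" for l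
      proof -
        have "cyc m (A r) off_diag (chart_fibre (\<psi> i) p l)"
          using e2(2) [OF l(1)] l(2) by (intro cyc_chart_fibre [OF ch [OF i] l(1)]) simp
        then show ?thesis using hA e1(2) [OF l(1)] l(2) by simp
      qed
      then show ?thesis using e1(1) e2(1) by (intro exI [of _ "min e1 e2"]) simp
    next
      case False
      then have B: "(\<psi> i p, \<psi> i p) \<in> ?B" using p(2) by simp
      obtain e2 where e2: "0 < e2" "\<And>l u. fibre_in (\<phi> i ` U i \<times> \<phi> i ` U i) p l \<Longrightarrow> l < e2 \<Longrightarrow> u \<in> S \<Longrightarrow>
          (\<psi> i (p - l *\<^sub>R u), \<psi> i (p + l *\<^sub>R u)) \<in> ?B"
        using small_fibre [OF ch [OF i] UU [OF r] p(1) B] by metis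
      have "h (chart_fibre (\<psi> i) p l) = 1" if l: "fibre_in (\<phi> i ` U i \<times> \<phi> i ` U i) p l" "l < e2" for l
      proof -
        have "cyc m ?B off_diag (chart_fibre (\<psi> i) p l)"
          by (rule cyc_chart_fibre [OF ch [OF i] l(1) e2(2) [OF l]])
        moreover have "chart_deg (\<phi> r) (chart_fibre (\<psi> i) p l) = 1"
          by (rule chart_deg_chart_fibre [OF m ch [OF i] cr l(1) e2(2) [OF l]])
        ultimately show ?thesis using hB by simp
      qed
      then show ?thesis using e2(1) by blast
    qed
    moreover have "h z = chart_deg (\<phi> i) z" if i: "i < Suc r" and z: "cyc m (U i \<times> U i) off_diag z" for i z
    proof (cases "i = r")
      case True
      then show ?thesis using hB z by simp
    next
      case False
      then have ir: "i < r" using i by simp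
      have "cyc m (A r) off_diag z"
        using z by (rule cyc_mono) (use ir in \<open>auto simp: A_def\<close>)
      then show ?thesis using hA Dd ir z by simp
    qed
    ultimately show ?case
      unfolding AS using h hs by blast
  qed
  obtain D where D: "cls m (A n) off_diag D"
      and Dd: "\<forall>i<n. \<forall>z. cyc m (U i \<times> U i) off_diag z \<longrightarrow> D z = chart_deg (\<phi> i) z"
      and Ds: "\<forall>z. cyc m (A n) off_diag z \<longrightarrow> D (cm m prod.swap z) = D z"
    using glue_ex [OF order_refl] by (elim exE conjE) (rule that)
  \<comment> \<open>The squares of the charts cover the diagonal but not all of
    \<open>M \<times> M\<close>. The complement of the diagonal is glued on as a last open set, with
    the zero class.\<close>
  let ?B = "(M \<times> M) \<inter> off_diag"
  have eq: "A n \<union> ?B = M \<times> M"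
    using A_sub [of n] unfolding A_def off_diag_def M by auto
  have o: "openin (top_of_set (A n \<union> ?B)) (A n)" "openin (top_of_set (A n \<union> ?B)) ?B"
    unfolding eq using oA [of n] open_off_diag by (auto simp: openin_open_Int)
  have offz: "hmg j X off_diag z 0" if "cyc j X off_diag z" "X \<subseteq> off_diag" for j z and X :: "('b \<times> 'b) set"
    using that cyc_ch [OF that(1)] by (intro hmg_off) (simp add: Int_absorb2)
  have D0: "D w = 0" if w: "cyc m (A n \<inter> ?B) off_diag w" for w
  proof -
    have "hmg m (A n \<inter> ?B) off_diag w 0" by (rule offz [OF w]) auto
    then have "hmg m (A n) off_diag w 0" by (rule hmg_mono) auto
    moreover have "cyc m (A n) off_diag w" by (rule cyc_mono [OF w]) auto
    ultimately show ?thesis using cls_null [OF D] by blast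
  qed
  have van: "m = 0 \<or> (\<forall>w. cyc (m - 1) (A n \<inter> ?B) off_diag w \<longrightarrow> hmg (m - 1) (A n \<inter> ?B) off_diag w 0)"
    using offz by auto
  have c0: "cls m ?B off_diag (\<lambda>z. 0)" by (simp add: cls_def)
  have sA: "prod.swap ` A n \<subseteq> A n" and sB: "prod.swap ` ?B \<subseteq> ?B"
    by (auto simp: A_def off_diag_def)
  obtain h where h: "cls m (A n \<union> ?B) off_diag h" and hA: "\<And>z. cyc m (A n) off_diag z \<Longrightarrow> h z = D z"
    and hB: "\<And>z. cyc m ?B off_diag z \<Longrightarrow> h z = 0"
    and hs: "\<And>z. cyc m (A n \<union> ?B) off_diag z \<Longrightarrow> h (cm m prod.swap z) = h z"
    using glue_cls [OF o D c0 van D0 swap sA sB swoff Ds [rule_format]] by metis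
  show ?thesis
  proof (rule that [OF h [unfolded eq] _ hs [unfolded eq]])
    fix i z assume i: "i < n" and z: "cyc m (U i \<times> U i) off_diag z"
    have "cyc m (A n) off_diag z"
      using z by (rule cyc_mono) (use i in \<open>auto simp: A_def\<close>)
    then show "h z = chart_deg (\<phi> i) z" using hA Dd i z by simp
  next
    fix z assume z: "ch m ?B z"
    have "cyc m ?B off_diag z"
      unfolding cyc_def using z ch_bd [OF z] by (simp add: ch_Int)
    then show "h z = 0" by (rule hB)
  qed
qed

end

section \<open>Joins of hexagons\<close>

text \<open>A generator is a product cell, given by the ordered vertices of its two factors. Either
  list may be empty, in keeping with the augmented boundary.\<close>

type_synonym 'v tensor = "('v list \<times> 'v list) z2"

definition tensor_app :: "'v list \<Rightarrow> 'v list \<Rightarrow> 'v tensor \<Rightarrow> 'v tensor" where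
  "tensor_app a b c = ext (\<lambda>(us, ws). sg (us @ a, ws @ b)) c"

definition tensor_bd :: "'v tensor \<Rightarrow> 'v tensor" where
  "tensor_bd c = ext (\<lambda>(us, ws). ext (\<lambda>u. sg (u, ws)) (lb us) + ext (\<lambda>w. sg (us, w)) (lb ws)) c"

definition tensor_swap :: "'v tensor \<Rightarrow> 'v tensor" where
  "tensor_swap c = ext (\<lambda>(us, ws). sg (ws, us)) c"

definition tensor_shuf :: "'v tensor \<Rightarrow> ('v \<times> 'v) list z2" where
  "tensor_shuf c = ext (\<lambda>(us, ws). shuf us ws) c"

lemma tensor_app_add: "tensor_app a b (c + d) = tensor_app a b c + tensor_app a b d"
  by (simp add: tensor_app_def ext_add)

lemma tensor_app_0 [simp]: "tensor_app a b 0 = 0"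
  by (simp add: tensor_app_def)

lemma tensor_app_sg [simp]: "tensor_app a b (sg (us, ws)) = sg (us @ a, ws @ b)"
  by (simp add: tensor_app_def)

lemma tensor_bd_add: "tensor_bd (c + d) = tensor_bd c + tensor_bd d"
  by (simp add: tensor_bd_def ext_add)

lemma tensor_bd_0 [simp]: "tensor_bd 0 = 0"
  by (simp add: tensor_bd_def)

lemma tensor_swap_add: "tensor_swap (c + d) = tensor_swap c + tensor_swap d"
  by (simp add: tensor_swap_def ext_add)

lemma tensor_shuf_add: "tensor_shuf (c + d) = tensor_shuf c + tensor_shuf d"
  by (simp add: tensor_shuf_def ext_add)

lemma tensor_shuf_0 [simp]: "tensor_shuf 0 = 0"
  by (simp add: tensor_shuf_def)

lemma tensor_induct [case_names zero one add]:
  fixes c :: "'v tensor"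
  assumes "P 0" "\<And>us ws. P (sg (us, ws))" "\<And>a b. P a \<Longrightarrow> P b \<Longrightarrow> P (a + b)"
  shows "P c"
proof -
  have "keys c \<subseteq> UNIV" by simp
  then show ?thesis
    by (induction c rule: z2_induct) (use assms in auto)
qed

lemma tensor_swap_tensor_app: "tensor_swap (tensor_app a b c) = tensor_app b a (tensor_swap c)"
  by (induction c rule: tensor_induct) (simp_all add: tensor_swap_def tensor_app_add ext_add tensor_app_def)

lemma tensor_bd_sg: "tensor_bd (sg (us, ws)) = ext (\<lambda>u. sg (u, ws)) (lb us) + ext (\<lambda>w. sg (us, w)) (lb ws)"
  by (simp add: tensor_bd_def)

lemma tensor_app_ext1: "tensor_app a b (ext (\<lambda>u. sg (u, ws)) c) = ext (\<lambda>u. sg (u @ a, ws @ b)) c"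
  by (simp add: tensor_app_def ext_ext)

lemma tensor_app_ext2: "tensor_app a b (ext (\<lambda>w. sg (us, w)) c) = ext (\<lambda>w. sg (us @ a, w @ b)) c"
  by (simp add: tensor_app_def ext_ext)

text \<open>Appending a vertex to each factor is the join with an edge; the two extra terms are the
  joins with the ends of that edge.\<close>

lemma tensor_bd_tensor_app: "tensor_bd (tensor_app [p] [q] c) = tensor_app [p] [q] (tensor_bd c) + tensor_app [] [q] c + tensor_app [p] [] c"
  by (induction c rule: tensor_induct)
    (simp_all add: tensor_bd_add tensor_app_add tensor_bd_sg lb_snoc ext_add ext_ext tensor_app_ext1 tensor_app_ext2 ac_simps)

lemma tensor_bd_apx1: "tensor_bd (tensor_app [p] [] c) = tensor_app [p] [] (tensor_bd c) + c"
  by (induction c rule: tensor_induct)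
    (simp_all add: tensor_bd_add tensor_app_add tensor_bd_sg lb_snoc ext_add ext_ext tensor_app_ext1 tensor_app_ext2 ac_simps)

lemma ext_lb_tensor_shuf:
  "ext lb (tensor_shuf c) = tensor_shuf (tensor_bd c) + ext (\<lambda>(us, ws). if length us = 1 \<and> length ws = 1 then sg [] else 0) c"
  by (induction c rule: tensor_induct)
    (simp_all add: tensor_shuf_def tensor_bd_add tensor_bd_sg ext_add lb_shuf ext_ext ac_simps del: One_nat_def)

lemma tensor_shuf_tensor_swap: "tensor_shuf (tensor_swap c) = ext (\<lambda>l. sg (map prod.swap l)) (tensor_shuf c)"
proof (induction c rule: tensor_induct)
  case (one us ws)
  show ?case using shuf_swap [of ws us] by (simp add: tensor_shuf_def tensor_swap_def)
qed (simp_all add: tensor_shuf_def tensor_swap_def ext_add)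

text \<open>The deleted join of three points with themselves is a hexagon, and swapping the factors
  is its antipodal map.\<close>

definition hexagon :: "nat \<Rightarrow> (nat \<times> nat) tensor \<Rightarrow> (nat \<times> nat) tensor" where
  "hexagon i c = tensor_app [(i, 1)] [(i, 2)] c + tensor_app [(i, 1)] [(i, 3)] c + tensor_app [(i, 2)] [(i, 1)] c
            + tensor_app [(i, 2)] [(i, 3)] c + tensor_app [(i, 3)] [(i, 1)] c + tensor_app [(i, 3)] [(i, 2)] c"

text \<open>Three consecutive edges of the hexagon, a path from the vertex 1 of the first factor to
  its antipode, the vertex 1 of the second factor.\<close>

definition half_hexagon :: "nat \<Rightarrow> (nat \<times> nat) tensor \<Rightarrow> (nat \<times> nat) tensor" where
  "half_hexagon i c = tensor_app [(i, 1)] [(i, 2)] c + tensor_app [(i, 3)] [(i, 2)] c + tensor_app [(i, 3)] [(i, 1)] c"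

definition cone1 :: "nat \<Rightarrow> (nat \<times> nat) tensor \<Rightarrow> (nat \<times> nat) tensor" where
  "cone1 i c = tensor_app [(i, 1)] [] c"

lemma tensor_bd_hexagon: "tensor_bd (hexagon i c) = hexagon i (tensor_bd c)"
  by (simp add: hexagon_def tensor_bd_add tensor_bd_tensor_app ac_simps)

lemma tensor_bd_half_hexagon: "tensor_bd (half_hexagon i c) = half_hexagon i (tensor_bd c) + cone1 i c + tensor_app [] [(i, 1)] c"
  by (simp add: half_hexagon_def cone1_def tensor_bd_add tensor_bd_tensor_app ac_simps)

lemma tensor_bd_cone1: "tensor_bd (cone1 i c) = cone1 i (tensor_bd c) + c"
  by (simp add: cone1_def tensor_bd_apx1)

lemma tensor_swap_hexagon: "tensor_swap (hexagon i c) = hexagon i (tensor_swap c)"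
  by (simp add: hexagon_def tensor_swap_add tensor_swap_tensor_app ac_simps)

lemma hexagon_half_hexagon: "tensor_swap c = c \<Longrightarrow> half_hexagon i c + tensor_swap (half_hexagon i c) = hexagon i c"
  by (simp add: half_hexagon_def hexagon_def tensor_swap_add tensor_swap_tensor_app ac_simps)

lemma hexagon_add: "hexagon i (c + d) = hexagon i c + hexagon i d"
  by (simp add: hexagon_def tensor_app_add ac_simps)

text \<open>Coordinate 1 is reserved for the apex pair, so the \<open>j\<close> hexagons occupy the
  coordinates from 2 to \<open>j + 1\<close>.\<close>

primrec hexagons :: "nat \<Rightarrow> (nat \<times> nat) tensor \<Rightarrow> (nat \<times> nat) tensor" where
  "hexagons 0 c = c"
| "hexagons (Suc j) c = hexagon (j + 2) (hexagons j c)"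

lemma tensor_bd_hexagons: "tensor_bd (hexagons j c) = hexagons j (tensor_bd c)"
  by (induction j) (simp_all add: tensor_bd_hexagon)

lemma tensor_swap_hexagons: "tensor_swap (hexagons j c) = hexagons j (tensor_swap c)"
  by (induction j) (simp_all add: tensor_swap_hexagon)

lemma hexagons_add: "hexagons j (c + d) = hexagons j c + hexagons j d"
  by (induction j) (simp_all add: hexagon_add)

abbreviation base_pair :: "(nat \<times> nat) tensor" where
  "base_pair \<equiv> sg ([(1, 1)], [(1, 1)])"

text \<open>Cells of the antipodal cell structure of the iterated join of hexagons, coned from the pair
  \<open>((1, 1), (1, 1))\<close>.\<close>

definition hemisphere :: "nat \<Rightarrow> (nat \<times> nat) tensor" where
  "hemisphere j = (if even j then half_hexagon (j div 2 + 1) (hexagons (j div 2 - 1) base_pair)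
             else cone1 (j div 2 + 2) (hexagons (j div 2) base_pair))"

definition sphere_stage :: "nat \<Rightarrow> (nat \<times> nat) tensor" where
  "sphere_stage j = (if j = 0 then base_pair else hemisphere j + tensor_swap (hemisphere j))"

lemma tensor_swap_base: "tensor_swap (hexagons j base_pair) = hexagons j base_pair"
  by (simp add: tensor_swap_hexagons) (simp add: tensor_swap_def)

lemma sphere_stage_even: "sphere_stage (2 * j) = hexagons j base_pair"
proof (cases j)
  case (Suc i)
  have "hemisphere (2 * Suc i) = half_hexagon (i + 2) (hexagons i base_pair)"
    by (simp add: hemisphere_def)
  then show ?thesis
    using hexagon_half_hexagon [OF tensor_swap_base, of "i + 2" i] by (simp add: sphere_stage_def Suc)
qed (simp add: sphere_stage_def)

lemma hemisphere_odd: "hemisphere (Suc (2 * j)) = cone1 (j + 2) (hexagons j base_pair)"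
  by (simp add: hemisphere_def)

lemma hemisphere_even: "hemisphere (2 * Suc j) = half_hexagon (j + 2) (hexagons j base_pair)"
  by (simp add: hemisphere_def)

lemma sphere_stage_odd: "sphere_stage (Suc (2 * j)) = cone1 (j + 2) (hexagons j base_pair) + tensor_app [] [(j + 2, 1)] (hexagons j base_pair)"
proof -
  have "tensor_swap (cone1 (j + 2) (hexagons j base_pair)) = tensor_app [] [(j + 2, 1)] (hexagons j base_pair)"
    by (simp only: cone1_def tensor_swap_tensor_app tensor_swap_base)
  then show ?thesis
    by (simp add: sphere_stage_def hemisphere_odd)
qed

text \<open>Each hemisphere is bounded by the sphere one stage lower. What remains stems from the
  boundary of \<open>base_pair\<close>, in which the common vertex is gone from one factor; these
  cells avoid the diagonal.\<close>

lemma tensor_bd_hemisphere: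
  "tensor_bd (hemisphere (Suc j)) + sphere_stage j =
    (if even j then cone1 (j div 2 + 2) (hexagons (j div 2) (tensor_bd base_pair))
     else half_hexagon (j div 2 + 2) (hexagons (j div 2) (tensor_bd base_pair)))"
proof (cases "even j")
  case True
  then obtain i where j: "j = 2 * i" by (elim evenE)
  show ?thesis
    unfolding j hemisphere_odd sphere_stage_even tensor_bd_cone1 tensor_bd_hexagons by (simp add: add.assoc)
next
  case False
  then obtain i where j: "j = Suc (2 * i)" by (elim oddE) simp
  have e: "Suc (Suc (2 * i)) = 2 * Suc i" by simp
  show ?thesis
    unfolding j sphere_stage_odd e hemisphere_even tensor_bd_half_hexagon tensor_bd_hexagons by (simp add: ac_simps)
qed

text \<open>Certifies the position of a product cell: it avoids the diagonal when \<open>I\<close> is empty, and both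
  factors lie in the star of the apex \<open>(1, 1)\<close> when \<open>B = {1}\<close>.\<close>

definition face_pair :: "nat \<Rightarrow> nat \<Rightarrow> (nat \<times> nat) set \<Rightarrow> nat set \<Rightarrow> (nat \<times> nat) list \<times> (nat \<times> nat) list \<Rightarrow> bool" where
  "face_pair j L I B = (\<lambda>(us, ws). distinct (map fst us) \<and> distinct (map fst ws) \<and>
     set us \<subseteq> {1..j + 1} \<times> {1..3} \<and> set ws \<subseteq> {1..j + 1} \<times> {1..3} \<and> set us \<inter> set ws = I \<and>
     (\<forall>a. (1, a) \<in> set us \<union> set ws \<longrightarrow> a \<in> B) \<and> length us + length ws = L)"

definition face_pairs :: "nat \<Rightarrow> nat \<Rightarrow> (nat \<times> nat) set \<Rightarrow> nat set \<Rightarrow> (nat \<times> nat) tensor \<Rightarrow> bool" where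
  "face_pairs j L I B c \<longleftrightarrow> (\<forall>x\<in>keys c. face_pair j L I B x)"

lemma face_pairs_add: "face_pairs j L I B c \<Longrightarrow> face_pairs j L I B d \<Longrightarrow> face_pairs j L I B (c + d)"
  by (auto simp: face_pairs_def keys_z2_add)

lemma face_pairs_sg: "face_pairs j L I B (sg x) \<longleftrightarrow> face_pair j L I B x"
  by (simp add: face_pairs_def)

lemma keys_tensor_app: "keys (tensor_app a b c) \<subseteq> (\<lambda>(us, ws). (us @ a, ws @ b)) ` keys c"
proof -
  let ?g = "\<lambda>(us, ws). (us @ a, ws @ b)"
  have "tensor_app a b c = ext (\<lambda>x. sg (?g x)) c"
    unfolding tensor_app_def by (rule ext_cong) auto
  moreover have "keys (ext (\<lambda>x. sg (?g x)) c) \<subseteq> ?g ` keys c"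
    using keys_ext [of "\<lambda>x. sg (?g x)" c] by (simp add: UNION_singleton_eq_range)
  ultimately show ?thesis by simp
qed

lemma face_pair_snoc:
  assumes t: "face_pair j L I B (us, ws)" and ab: "a \<in> {1..3}" "b \<in> {1..3}"
  shows "a \<noteq> b \<Longrightarrow> face_pair (Suc j) (L + 2) I B (us @ [(j + 2, a)], ws @ [(j + 2, b)])"
    and "face_pair (Suc j) (Suc L) I B (us @ [(j + 2, a)], ws)"
    and "face_pair (Suc j) (Suc L) I B (us, ws @ [(j + 2, b)])"
proof -
  have f: "(j + 2, x) \<notin> set us" "(j + 2, x) \<notin> set ws" "j + 2 \<notin> fst ` set us" "j + 2 \<notin> fst ` set ws" for x
    using t by (auto simp: face_pair_def)
  show "a \<noteq> b \<Longrightarrow> face_pair (Suc j) (L + 2) I B (us @ [(j + 2, a)], ws @ [(j + 2, b)])"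
    "face_pair (Suc j) (Suc L) I B (us @ [(j + 2, a)], ws)"
    "face_pair (Suc j) (Suc L) I B (us, ws @ [(j + 2, b)])"
    using t ab f by (auto simp: face_pair_def)
qed

lemma face_pairs_tensor_app:
  assumes "face_pairs j L I B c" "a \<in> {1..3}" "b \<in> {1..3}"
  shows "a \<noteq> b \<Longrightarrow> face_pairs (Suc j) (L + 2) I B (tensor_app [(j + 2, a)] [(j + 2, b)] c)"
    and "face_pairs (Suc j) (Suc L) I B (tensor_app [(j + 2, a)] [] c)"
    and "face_pairs (Suc j) (Suc L) I B (tensor_app [] [(j + 2, b)] c)"
proof -
  have t: "face_pair j L I B (us, ws)" if "(us, ws) \<in> keys c" for us ws
    using assms(1) that by (auto simp: face_pairs_def)
  show "a \<noteq> b \<Longrightarrow> face_pairs (Suc j) (L + 2) I B (tensor_app [(j + 2, a)] [(j + 2, b)] c)"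
    using keys_tensor_app [of "[(j + 2, a)]" "[(j + 2, b)]" c] face_pair_snoc(1) [OF t assms(2,3)] unfolding face_pairs_def by fastforce
  show "face_pairs (Suc j) (Suc L) I B (tensor_app [(j + 2, a)] [] c)"
    using keys_tensor_app [of "[(j + 2, a)]" "[]" c] face_pair_snoc(2) [OF t assms(2,3)] unfolding face_pairs_def by fastforce
  show "face_pairs (Suc j) (Suc L) I B (tensor_app [] [(j + 2, b)] c)"
    using keys_tensor_app [of "[]" "[(j + 2, b)]" c] face_pair_snoc(3) [OF t assms(2,3)] unfolding face_pairs_def by fastforce
qed

lemma face_pairs_hexagon: "face_pairs j L I B c \<Longrightarrow> face_pairs (Suc j) (L + 2) I B (hexagon (j + 2) c)"
  unfolding hexagon_def by (intro face_pairs_add face_pairs_tensor_app) auto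

lemma face_pairs_half_hexagon: "face_pairs j L I B c \<Longrightarrow> face_pairs (Suc j) (L + 2) I B (half_hexagon (j + 2) c)"
  unfolding half_hexagon_def by (intro face_pairs_add face_pairs_tensor_app) auto

lemma face_pairs_cone1: "face_pairs j L I B c \<Longrightarrow> face_pairs (Suc j) (Suc L) I B (cone1 (j + 2) c)"
  unfolding cone1_def by (intro face_pairs_tensor_app [where b = 1]) auto

lemma face_pairs_hexagons: "face_pairs 0 L I B c \<Longrightarrow> face_pairs j (L + 2 * j) I B (hexagons j c)"
proof (induction j)
  case (Suc j)
  then show ?case using face_pairs_hexagon [of j "L + 2 * j" I B "hexagons j c"] by simp
qed simp

lemma face_pairs_base: "face_pairs 0 2 {(1, 1)} {1} base_pair"
  by (simp add: face_pairs_sg face_pair_def)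

lemma tensor_bd_base_pair: "tensor_bd base_pair = sg ([], [(1, 1)]) + sg ([(1, 1)], [])"
  by (simp add: tensor_bd_sg)

lemma face_pairs_tensor_bd_base: "face_pairs 0 1 {} {1} (tensor_bd base_pair)"
  unfolding tensor_bd_base_pair by (intro face_pairs_add) (simp_all add: face_pairs_sg face_pair_def)

text \<open>A product cell with \<open>L\<close> vertices in its two factors together has dimension
  \<open>L - 2\<close>, and every second stage enters a new coordinate.\<close>

lemma face_pairs_hemisphere: "face_pairs (j div 2 + 1) (Suc j + 2) {(1, 1)} {1} (hemisphere (Suc j))"
proof (cases "even j")
  case True
  then obtain i where j: "j = 2 * i" by (elim evenE)
  show ?thesis
    using face_pairs_cone1 [OF face_pairs_hexagons [OF face_pairs_base, of i]] unfolding j hemisphere_odd by simp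
next
  case False
  then obtain i where j: "j = Suc (2 * i)" by (elim oddE) simp
  have e: "Suc (Suc (2 * i)) = 2 * Suc i" by simp
  show ?thesis
    using face_pairs_half_hexagon [OF face_pairs_hexagons [OF face_pairs_base, of i]] unfolding j e hemisphere_even by simp
qed

lemma face_pairs_tensor_bd_hemisphere: "face_pairs (j div 2 + 1) (j + 2) {} {1} (tensor_bd (hemisphere (Suc j)) + sphere_stage j)"
proof (cases "even j")
  case True
  then show ?thesis
    using face_pairs_cone1 [OF face_pairs_hexagons [OF face_pairs_tensor_bd_base, of "j div 2"]] unfolding tensor_bd_hemisphere by simp
next
  case False
  then have "1 + 2 * (j div 2) = j" by simp
  then show ?thesis
    using False face_pairs_half_hexagon [OF face_pairs_hexagons [OF face_pairs_tensor_bd_base, of "j div 2"]] unfolding tensor_bd_hemisphere by simp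
qed

lemma lb_map: "lb (map f l) = ext (\<lambda>l. sg (map f l)) (lb l)"
  by (induction l) (simp_all add: pre_def ext_add ext_ext)

text \<open>A simplex of the join has at most one vertex over each coordinate, which is injectivity
  of \<open>fst\<close>. Conversely, missing coordinates are filled with the point 1, which exists
  as \<open>1 \<le> n\<close>.\<close>

lemma join_power_iff:
  assumes "1 \<le> n"
  shows "\<sigma> \<in> join_power n k \<longleftrightarrow> \<sigma> \<noteq> {} \<and> \<sigma> \<subseteq> {1..k+1} \<times> {1..n} \<and> inj_on fst \<sigma>"
proof
  assume "\<sigma> \<in> join_power n k"
  then obtain a where a: "\<sigma> \<noteq> {}" "\<forall>i\<in>{1..k+1}. a i \<in> {1..n}" "\<sigma> \<subseteq> (\<lambda>i. (i, a i)) ` {1..k+1}"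
    unfolding join_power_def k_faces_def by blast
  have "(\<lambda>i. (i, a i)) ` {1..k+1} \<subseteq> {1..k+1} \<times> {1..n}"
    using a(2) by auto
  moreover have "inj_on fst ((\<lambda>i. (i, a i)) ` {1..k+1})"
    by (auto simp: inj_on_def)
  ultimately show "\<sigma> \<noteq> {} \<and> \<sigma> \<subseteq> {1..k+1} \<times> {1..n} \<and> inj_on fst \<sigma>"
    using a by (meson inj_on_subset subset_trans)
next
  assume \<sigma>: "\<sigma> \<noteq> {} \<and> \<sigma> \<subseteq> {1..k+1} \<times> {1..n} \<and> inj_on fst \<sigma>"
  define a where "a i = (if \<exists>x. (i, x) \<in> \<sigma> then SOME x. (i, x) \<in> \<sigma> else 1)" for i
  have ai: "(i, a i) \<in> \<sigma>" if "(i, x) \<in> \<sigma>" for i x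
    unfolding a_def using that someI [of "\<lambda>x. (i, x) \<in> \<sigma>" x] by auto
  have "a i \<in> {1..n}" for i
  proof (cases "\<exists>x. (i, x) \<in> \<sigma>")
    case True
    then show ?thesis using ai \<sigma> by blast
  qed (use assms in \<open>simp add: a_def\<close>)
  moreover have "\<sigma> \<subseteq> (\<lambda>i. (i, a i)) ` {1..k+1}"
  proof clarify
    fix i x assume x: "(i, x) \<in> \<sigma>"
    then have "x = a i"
      using inj_onD [of fst \<sigma> "(i, x)" "(i, a i)"] \<sigma> ai [OF x] by simp
    then show "(i, x) \<in> (\<lambda>i. (i, a i)) ` {1..k+1}"
      using x \<sigma> by blast
  qed
  ultimately show "\<sigma> \<in> join_power n k"
    using \<sigma> unfolding join_power_def k_faces_def by blast
qed

lemma finite_join_power: "1 \<le> n \<Longrightarrow> finite (join_power n k)"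
proof (rule finite_subset)
  show "1 \<le> n \<Longrightarrow> join_power n k \<subseteq> Pow ({1..k+1} \<times> {1..n})"
    using join_power_iff by blast
qed simp

section \<open>Product cells in a geometric realization\<close>

locale realization =
  fixes n k :: nat and v :: "nat \<times> nat \<Rightarrow> 'b::euclidean_space"
  assumes n3: "3 \<le> n" and real: "geometric_realization (join_power n k) v"
begin

abbreviation apex :: 'b where "apex \<equiv> v (1, 1)"

text \<open>The closed star of the vertex \<open>(1, 1)\<close>. All product cells built from
  \<open>base_pair\<close> lie in its square, which allows them to be shrunk towards the
  apex.\<close>

definition star :: "'b set" where
  "star = (\<Union>\<sigma>\<in>{\<sigma>\<in>join_power n k. (1, 1) \<in> \<sigma>}. convex hull (v ` \<sigma>))"

definition pair_chain :: "(nat \<times> nat) tensor \<Rightarrow> ('b \<times> 'b) mod2_chain" where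
  "pair_chain c = aff_chain (ext (\<lambda>l. sg (map (map_prod v v) l)) (tensor_shuf c))"

lemma n_pos: "1 \<le> n" using n3 by simp

lemma hulls_disjoint:
  assumes "\<sigma> \<in> join_power n k" "\<tau> \<in> join_power n k" "\<sigma> \<inter> \<tau> = {}"
  shows "convex hull (v ` \<sigma>) \<inter> convex hull (v ` \<tau>) = {}"
  using real assms unfolding geometric_realization_def by (metis image_empty convex_hull_empty)

lemma star_subset_body: "star \<subseteq> body (join_power n k) v"
  by (auto simp: star_def body_def)

lemma compact_hull_face: "\<sigma> \<in> join_power n k \<Longrightarrow> compact (convex hull (v ` \<sigma>))"
proof -
  assume "\<sigma> \<in> join_power n k"
  then have "\<sigma> \<subseteq> {1..k+1} \<times> {1..n}" using join_power_iff [OF n_pos] by blast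
  then have "finite \<sigma>" by (rule finite_subset) simp
  then show ?thesis by (intro compact_convex_hull finite_imp_compact) simp
qed

lemma compact_star: "compact star"
  unfolding star_def using finite_join_power [OF n_pos] compact_hull_face by (intro compact_UN) auto

lemma compact_body: "compact (body (join_power n k) v)"
  unfolding body_def using finite_join_power [OF n_pos] compact_hull_face by (intro compact_UN) auto

lemma apex_in_star: "apex \<in> star"
proof -
  have "{(1, 1)} \<in> join_power n k"
    using n_pos by (simp add: join_power_iff)
  then show ?thesis by (force simp: star_def)
qed

lemma star_shrink:
  assumes x: "x \<in> star" and t: "0 \<le> t" "t \<le> 1"
  shows "apex + t *\<^sub>R (x - apex) \<in> star"
proof -
  obtain \<sigma> where \<sigma>: "\<sigma> \<in> join_power n k" "(1, 1) \<in> \<sigma>" "x \<in> convex hull (v ` \<sigma>)"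
    using x by (auto simp: star_def)
  have "apex \<in> convex hull (v ` \<sigma>)"
    using \<sigma>(2) by (intro hull_inc) simp
  then have "(1 - t) *\<^sub>R apex + t *\<^sub>R x \<in> convex hull (v ` \<sigma>)"
    using \<sigma>(3) t by (intro convexD_alt convex_convex_hull)
  moreover have "(1 - t) *\<^sub>R apex + t *\<^sub>R x = apex + t *\<^sub>R (x - apex)"
    by (simp add: algebra_simps)
  ultimately show ?thesis using \<sigma> by (auto simp: star_def)
qed

lemma pair_chain_add: "pair_chain (c + d) = pair_chain c + pair_chain d"
  by (simp add: pair_chain_def tensor_shuf_add ext_add aff_chain_add)

lemma keys_tensor_shuf:
  assumes "face_pairs j (p + 2) I B c" "l \<in> keys (tensor_shuf c)"
  obtains us ws where "face_pair j (p + 2) I B (us, ws)" "l \<in> keys (shuf us ws)" "us \<noteq> []" "ws \<noteq> []"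
    "length l = Suc p" "set l \<subseteq> set us \<times> set ws"
proof -
  obtain us ws where uw: "(us, ws) \<in> keys c" "l \<in> keys (shuf us ws)"
    using subsetD [OF keys_ext assms(2) [unfolded tensor_shuf_def]] by auto
  have t: "face_pair j (p + 2) I B (us, ws)"
    using assms(1) uw(1) by (auto simp: face_pairs_def)
  have "us \<noteq> []" "ws \<noteq> []"
    using uw(2) by auto
  moreover have "length l = Suc p" "set l \<subseteq> set us \<times> set ws"
    using keys_shuf [OF uw(2)] t by (auto simp: face_pair_def)
  ultimately show ?thesis using that t uw(2) by blast
qed

lemma keys_pair_chain_list:
  assumes "face_pairs j (p + 2) I B c" "l' \<in> keys (ext (\<lambda>l. sg (map (map_prod v v) l)) (tensor_shuf c))"
  obtains l where "l \<in> keys (tensor_shuf c)" "l' = map (map_prod v v) l"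
  using subsetD [OF keys_ext assms(2)] that by auto

lemma pair_chain_length:
  assumes "face_pairs j (p + 2) I B c" "l \<in> keys (ext (\<lambda>l. sg (map (map_prod v v) l)) (tensor_shuf c))"
  shows "length l = Suc p"
  using keys_pair_chain_list [OF assms] keys_tensor_shuf [OF assms(1)] by (metis length_map)

lemma bd_pair_chain:
  assumes "face_pairs j (p + 2) I B c" shows "bd p (pair_chain c) = pair_chain (tensor_bd c)"
proof -
  let ?g = "\<lambda>l. sg (map (map_prod v v) l)"
  have "bd p (pair_chain c) = aff_chain (ext lb (ext ?g (tensor_shuf c)))"
    unfolding pair_chain_def by (rule bd_aff_chain) (rule pair_chain_length [OF assms])
  also have "ext lb (ext ?g (tensor_shuf c)) = ext ?g (ext lb (tensor_shuf c))"
    by (simp add: ext_ext lb_map)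
  also have "aff_chain \<dots> = pair_chain (tensor_bd c) + aff_chain (ext ?g (ext (\<lambda>(us, ws). if length us = 1 \<and> length ws = 1 then sg [] else 0) c))"
    by (simp add: ext_lb_tensor_shuf ext_add aff_chain_add pair_chain_def del: One_nat_def)
  also have "aff_chain (ext ?g (ext (\<lambda>(us, ws). if length us = 1 \<and> length ws = 1 then sg [] else 0) c)) = 0"
    by (induction c rule: tensor_induct) (simp_all add: ext_add aff_chain_add aff_chain_sg del: One_nat_def)
  finally show ?thesis by simp
qed

lemma linear_swap: "linear (prod.swap :: 'b \<times> 'b \<Rightarrow> 'b \<times> 'b)"
  by (rule linearI) auto

lemma cm_swap_pair_chain:
  assumes "face_pairs j (p + 2) I B c" shows "cm p prod.swap (pair_chain c) = pair_chain (tensor_swap c)"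
proof -
  have "cm p prod.swap (pair_chain c) = aff_chain (ext (\<lambda>l. sg (map prod.swap l)) (ext (\<lambda>l. sg (map (map_prod v v) l)) (tensor_shuf c)))"
    unfolding pair_chain_def by (rule cm_aff_chain [OF linear_swap]) (rule pair_chain_length [OF assms])
  moreover have "prod.swap (map_prod v v x) = map_prod v v (prod.swap x)" for x
    by (cases x) simp
  ultimately show ?thesis
    by (simp add: pair_chain_def tensor_shuf_tensor_swap ext_ext o_def)
qed

lemma ch_pair_chain:
  assumes c: "face_pairs j (p + 2) I B c"
    and T: "\<And>us ws. face_pair j (p + 2) I B (us, ws) \<Longrightarrow> us \<noteq> [] \<Longrightarrow> ws \<noteq> [] \<Longrightarrow>
        (convex hull (v ` set us)) \<times> (convex hull (v ` set ws)) \<subseteq> T"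
  shows "ch p T (pair_chain c)"
  unfolding pair_chain_def
proof (rule ch_aff_chain, intro conjI)
  fix l' assume l': "l' \<in> keys (ext (\<lambda>l. sg (map (map_prod v v) l)) (tensor_shuf c))"
  show "length l' = Suc p" by (rule pair_chain_length [OF c l'])
  obtain l where l: "l \<in> keys (tensor_shuf c)" "l' = map (map_prod v v) l"
    using keys_pair_chain_list [OF c l'] .
  obtain us ws where uw: "face_pair j (p + 2) I B (us, ws)" "us \<noteq> []" "ws \<noteq> []" "set l \<subseteq> set us \<times> set ws"
    using keys_tensor_shuf [OF c l(1)] by metis
  have "set l' \<subseteq> (convex hull (v ` set us)) \<times> (convex hull (v ` set ws))"
    using uw(4) by (auto simp: l(2) intro!: hull_inc)
  then have "convex hull (set l') \<subseteq> (convex hull (v ` set us)) \<times> (convex hull (v ` set ws))"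
    by (intro hull_minimal convex_Times convex_convex_hull)
  then show "convex hull (set l') \<subseteq> T"
    using T [OF uw(1-3)] by blast
qed

lemma face_pair_face:
  assumes t: "face_pair j L I B (us, ws)" and j: "j \<le> k"
  shows "us \<noteq> [] \<Longrightarrow> set us \<in> join_power n k" "ws \<noteq> [] \<Longrightarrow> set ws \<in> join_power n k"
    "B = {1} \<Longrightarrow> insert (1, 1) (set us) \<in> join_power n k" "B = {1} \<Longrightarrow> insert (1, 1) (set ws) \<in> join_power n k"
proof -
  have sub: "{1..j + 1} \<times> {1..3} \<subseteq> {1..k + 1} \<times> {1..n}"
    using j n3 by auto
  have s: "set us \<subseteq> {1..k + 1} \<times> {1..n}" "set ws \<subseteq> {1..k + 1} \<times> {1..n}"
    using t sub unfolding face_pair_def by blast+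
  have i: "inj_on fst (set us)" "inj_on fst (set ws)"
    using t by (auto simp: face_pair_def distinct_map)
  show "us \<noteq> [] \<Longrightarrow> set us \<in> join_power n k" "ws \<noteq> [] \<Longrightarrow> set ws \<in> join_power n k"
    using s i by (simp_all add: join_power_iff [OF n_pos])
  show "insert (1, 1) (set us) \<in> join_power n k" if "B = {1}"
  proof -
    have "inj_on fst (insert (1, 1) (set us))"
      using i(1) t that by (fastforce simp: face_pair_def inj_on_def)
    then show ?thesis using s(1) n_pos by (simp add: join_power_iff [OF n_pos])
  qed
  show "insert (1, 1) (set ws) \<in> join_power n k" if "B = {1}"
  proof -
    have "inj_on fst (insert (1, 1) (set ws))"
      using i(2) t that by (fastforce simp: face_pair_def inj_on_def)
    then show ?thesis using s(2) n_pos by (simp add: join_power_iff [OF n_pos])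
  qed
qed

lemma hull_in_star:
  assumes "insert (1, 1) (set us) \<in> join_power n k" shows "convex hull (v ` set us) \<subseteq> star"
proof -
  have "convex hull (v ` set us) \<subseteq> convex hull (v ` insert (1, 1) (set us))"
    by (intro hull_mono) blast
  then show ?thesis using assms unfolding star_def by blast
qed

lemma ch_pair_chain_star:
  assumes "face_pairs j (p + 2) I {1} c" "j \<le> k" shows "ch p (star \<times> star) (pair_chain c)"
proof (rule ch_pair_chain [OF assms(1)])
  fix us ws assume t: "face_pair j (p + 2) I {1} (us, ws)"
  show "(convex hull (v ` set us)) \<times> (convex hull (v ` set ws)) \<subseteq> star \<times> star"
    by (rule Sigma_mono [OF hull_in_star [OF face_pair_face(3) [OF t assms(2) refl]]
          hull_in_star [OF face_pair_face(4) [OF t assms(2) refl]]])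
qed

lemma ch_pair_chain_off_diag:
  assumes "face_pairs j (p + 2) {} B c" "j \<le> k" shows "ch p off_diag (pair_chain c)"
proof (rule ch_pair_chain [OF assms(1)])
  fix us ws assume t: "face_pair j (p + 2) {} B (us, ws)" "us \<noteq> []" "ws \<noteq> []"
  have "set us \<inter> set ws = {}" using t(1) by (simp add: face_pair_def)
  then have "convex hull (v ` set us) \<inter> convex hull (v ` set ws) = {}"
    using face_pair_face [OF t(1) assms(2)] t by (intro hulls_disjoint) auto
  then show "(convex hull (v ` set us)) \<times> (convex hull (v ` set ws)) \<subseteq> off_diag"
    by (auto simp: off_diag_def)
qed

lemma ch_pair_chain_body:
  assumes "face_pairs j (p + 2) I B c" "j \<le> k"
  shows "ch p (body (join_power n k) v \<times> body (join_power n k) v) (pair_chain c)"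
proof (rule ch_pair_chain [OF assms(1)])
  fix us ws assume t: "face_pair j (p + 2) I B (us, ws)" "us \<noteq> []" "ws \<noteq> []"
  show "(convex hull (v ` set us)) \<times> (convex hull (v ` set ws)) \<subseteq> body (join_power n k) v \<times> body (join_power n k) v"
    using face_pair_face [OF t(1) assms(2)] t unfolding body_def by (intro Sigma_mono) blast+
qed

lemma pair_chain_base: "pair_chain base_pair = sg (aff [(apex, apex)])"
  by (simp add: pair_chain_def tensor_shuf_def aff_chain_sg)

end

locale setting = frame bs + realization n k v
  for bs :: "'a::euclidean_space list" and n k :: nat and v :: "nat \<times> nat \<Rightarrow> 'b::euclidean_space" +
  assumes m2k: "length bs = 2 * k" and k1: "1 \<le> k"
begin

text \<open>The images of the hemispheres under \<open>g\<close> form an odd system: exchanging the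
  factors acts as the antipode, and cells off the diagonal go into \<open>Dn m\<close>. The last
  stage, of dimension \<open>2 * k\<close>, is the cone over the join of all \<open>k\<close>
  hexagons.\<close>

theorem local_degree:
  assumes c: "continuous_on (star \<times> star) g" and V: "g ` (star \<times> star) \<subseteq> V"
    and odd: "\<And>x. x \<in> star \<times> star \<Longrightarrow> g (prod.swap x) = - g x"
    and nz: "\<And>x. x \<in> star \<times> star \<Longrightarrow> x \<in> off_diag \<Longrightarrow> g x \<noteq> 0"
  shows "local_deg (cm m g (pair_chain (hexagons k base_pair))) = 1"
proof -
  \<comment> \<open>Stage \<open>Suc j\<close> uses the coordinates up to
    \<open>j div 2 + 2\<close>, and these must not exceed \<open>k + 1\<close>.\<close>
  have stage: "j div 2 + 1 \<le> k" if "j < m" for j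
    using that m2k by linarith
  have hemisphere: "face_pairs ((j - 1) div 2 + 1) (j + 2) {(1, 1)} {1} (hemisphere j)" if "1 \<le> j" for j
    using face_pairs_hemisphere [of "j - 1"] that by simp
  have hemisphere_star: "ch j (star \<times> star) (pair_chain (hemisphere j))" if "1 \<le> j" "j \<le> m" for j
    using hemisphere [OF that(1)] by (rule ch_pair_chain_star) (use stage [of "j - 1"] that in simp)
  have ap: "(apex, apex) \<in> star \<times> star"
    using apex_in_star by simp
  have "g (apex, apex) + g (apex, apex) = 0"
    using odd [OF ap] by (simp add: eq_neg_iff_add_eq_0)
  then have "2 *\<^sub>R g (apex, apex) = 0" by (simp only: scaleR_2)
  then have g0: "g (apex, apex) = 0" by simp
  have "odd_system (\<lambda>j. cm j g (pair_chain (hemisphere j))) (\<lambda>j. cm j g (pair_chain (sphere_stage j)))"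
    unfolding odd_system_def
  proof (intro conjI ballI allI impI)
    have "simplex_map 0 g (aff [(apex, apex)]) = aff [0::'a]"
    proof
      fix x
      have "x 0 = 1" if "x \<in> standard_simplex 0" using that by (simp add: standard_simplex_0)
      then show "simplex_map 0 g (aff [(apex, apex)]) x = aff [0::'a] x"
        using g0 by (simp add: simplex_map_def aff_def restrict_def)
    qed
    then show "cm 0 g (pair_chain (sphere_stage 0)) = Z 0"
      unfolding sphere_stage_def Z_0 if_P [OF refl] pair_chain_base cm_sg by (simp only:)
  next
    fix j assume j: "j \<in> {1..m}"
    note hs = hemisphere_star [of j]
    show "ch j V (cm j g (pair_chain (hemisphere j)))"
      using hs j c V by (intro ch_cm) auto
    have "cm j g (cm j prod.swap (pair_chain (hemisphere j))) = cm j uminus (cm j g (pair_chain (hemisphere j)))"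
      unfolding cm_compose
    proof (rule cm_cong)
      show "ch j (star \<times> star) (pair_chain (hemisphere j))" using hs j by simp
      show "(g \<circ> prod.swap) x = (uminus \<circ> g) x" if "x \<in> star \<times> star" for x
        using odd [OF that] by simp
    qed
    then show "cm j g (pair_chain (sphere_stage j)) = cm j g (pair_chain (hemisphere j)) + cm j uminus (cm j g (pair_chain (hemisphere j)))"
      using j cm_swap_pair_chain [OF hemisphere, of j] by (simp add: sphere_stage_def pair_chain_add cm_add)
  next
    fix j assume j: "j < m"
    have hs: "ch (Suc j) (star \<times> star) (pair_chain (hemisphere (Suc j)))"
      using hemisphere_star j by simp
    have b: "bd (Suc j) (pair_chain (hemisphere (Suc j))) = pair_chain (tensor_bd (hemisphere (Suc j)))"
      by (rule bd_pair_chain) (use hemisphere [of "Suc j"] in simp)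
    have "bd (Suc j) (cm (Suc j) g (pair_chain (hemisphere (Suc j)))) + cm j g (pair_chain (sphere_stage j)) = cm j g (pair_chain (tensor_bd (hemisphere (Suc j)) + sphere_stage j))"
      by (simp add: bd_cm_Suc [OF hs] b pair_chain_add cm_add)
    moreover have "ch j (star \<times> star \<inter> off_diag) (pair_chain (tensor_bd (hemisphere (Suc j)) + sphere_stage j))"
      unfolding ch_Int
      by (intro conjI ch_pair_chain_star [OF face_pairs_tensor_bd_hemisphere stage [OF j]] ch_pair_chain_off_diag [OF face_pairs_tensor_bd_hemisphere stage [OF j]])
    ultimately show "ch j (Dn m) (bd (Suc j) (cm (Suc j) g (pair_chain (hemisphere (Suc j)))) + cm j g (pair_chain (sphere_stage j)))"
    proof (simp only:, intro ch_cm)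
      show "continuous_on (star \<times> star \<inter> off_diag) g"
        by (rule continuous_on_subset [OF c]) blast
      show "g ` (star \<times> star \<inter> off_diag) \<subseteq> Dn m"
        using nz V V_Dn by blast
    qed
  qed
  then have "local_deg (cm m g (pair_chain (sphere_stage m))) = 1"
    by (rule local_deg_odd_system) (use m2k k1 in simp)
  then show ?thesis
    using sphere_stage_even [of k] by (simp add: m2k)
qed

end

section \<open>Octahedral chains\<close>

definition setchain :: "'a set \<Rightarrow> 'a z2" where
  "setchain A = (\<Sum>x\<in>A. sg x)"

lemma keys_setchain: "finite A \<Longrightarrow> keys (setchain A) = A"
  unfolding setchain_def by (induction A rule: finite_induct) (auto simp: keys_z2_add)

text \<open>Each face is listed by increasing coordinate. The common order lets faces shared by
  several octahedra match as lists and cancel.\<close>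

definition olists :: "nat \<Rightarrow> (nat \<Rightarrow> nat set) \<Rightarrow> (nat \<times> nat) list set" where
  "olists j P = {map (\<lambda>i. (i, a i)) [1..<Suc j] | a. \<forall>i\<in>{1..j}. a i \<in> P i}"

definition oct_chain :: "nat \<Rightarrow> (nat \<Rightarrow> nat set) \<Rightarrow> (nat \<times> nat) list z2" where
  "oct_chain j P = setchain (olists j P)"

lemma olists_0: "olists 0 P = {[]}"
  by (auto simp: olists_def)

lemma olists_Suc: "olists (Suc j) P = (\<Union>x\<in>P (Suc j). (\<lambda>l. l @ [(Suc j, x)]) ` olists j P)"
proof (intro Set.set_eqI iffI)
  fix l assume "l \<in> olists (Suc j) P"
  then obtain a where a: "l = map (\<lambda>i. (i, a i)) [1..<Suc (Suc j)]" "\<forall>i\<in>{1..Suc j}. a i \<in> P i"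
    unfolding olists_def by blast
  then have "l = map (\<lambda>i. (i, a i)) [1..<Suc j] @ [(Suc j, a (Suc j))]" "a (Suc j) \<in> P (Suc j)"
    "map (\<lambda>i. (i, a i)) [1..<Suc j] \<in> olists j P"
    unfolding olists_def by auto
  then show "l \<in> (\<Union>x\<in>P (Suc j). (\<lambda>l. l @ [(Suc j, x)]) ` olists j P)" by blast
next
  fix l assume "l \<in> (\<Union>x\<in>P (Suc j). (\<lambda>l. l @ [(Suc j, x)]) ` olists j P)"
  then obtain x a where x: "x \<in> P (Suc j)" and a: "l = map (\<lambda>i. (i, a i)) [1..<Suc j] @ [(Suc j, x)]" "\<forall>i\<in>{1..j}. a i \<in> P i"
    unfolding olists_def by blast
  let ?b = "a(Suc j := x)"
  have "map (\<lambda>i. (i, a i)) [1..<Suc j] = map (\<lambda>i. (i, ?b i)) [1..<Suc j]"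
    by (rule map_cong) auto
  then have "l = map (\<lambda>i. (i, ?b i)) [1..<Suc (Suc j)]"
    using a(1) by simp
  moreover have "\<forall>i\<in>{1..Suc j}. ?b i \<in> P i"
    using a(2) x by (auto simp: le_Suc_eq)
  ultimately show "l \<in> olists (Suc j) P"
    unfolding olists_def by blast
qed

lemma finite_olists: "(\<And>i. i \<in> {1..j} \<Longrightarrow> finite (P i)) \<Longrightarrow> finite (olists j P)"
  by (induction j) (auto simp: olists_0 olists_Suc)

lemma oct_chain_0: "oct_chain 0 P = sg []"
  by (simp add: oct_chain_def olists_0 setchain_def)

lemma oct_chain_Suc:
  assumes "\<And>i. i \<in> {1..Suc j} \<Longrightarrow> finite (P i)"
  shows "oct_chain (Suc j) P = (\<Sum>x\<in>P (Suc j). snoc (Suc j, x) (oct_chain j P))"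
proof -
  have f: "finite (P (Suc j))" "finite (olists j P)"
    using assms by (auto intro: finite_olists)
  have "oct_chain (Suc j) P = (\<Sum>x\<in>P (Suc j). \<Sum>l\<in>(\<lambda>l. l @ [(Suc j, x)]) ` olists j P. sg l)"
    unfolding oct_chain_def setchain_def olists_Suc using f by (intro sum.UNION_disjoint) auto
  also have "\<dots> = (\<Sum>x\<in>P (Suc j). snoc (Suc j, x) (oct_chain j P))"
    by (intro sum.cong refl) (simp add: oct_chain_def setchain_def snoc_def ext_sum sum.reindex inj_on_def)
  finally show ?thesis .
qed

lemma oct_chain_cong: "(\<And>i. i \<in> {1..j} \<Longrightarrow> P i = Q i) \<Longrightarrow> oct_chain j P = oct_chain j Q"
  unfolding oct_chain_def olists_def by (intro arg_cong [where f = setchain]) auto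

lemma oct_chain_length:
  assumes "\<And>i. i \<in> {1..j} \<Longrightarrow> finite (P i)" "l \<in> keys (oct_chain j P)" shows "length l = j"
proof -
  have "l \<in> olists j P"
    using assms(2) keys_setchain [OF finite_olists [OF assms(1)]] by (simp add: oct_chain_def)
  then show ?thesis by (auto simp: olists_def)
qed

text \<open>An octahedron is an iterated suspension: the bases of the two cones of each stage cancel
  in the boundary.\<close>

lemma lb_oct_chain: "(\<And>i. i \<in> {1..j} \<Longrightarrow> card (P i) = 2) \<Longrightarrow> ext lb (oct_chain j P) = 0"
proof (induction j)
  case (Suc j)
  have fin: "finite (P i)" if "i \<in> {1..Suc j}" for i
    using Suc.prems [OF that] by (intro card_ge_0_finite) simp
  have "card (P (Suc j)) = 2" using Suc.prems by simp
  then obtain x y where xy: "P (Suc j) = {x, y}" "x \<noteq> y"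
    by (auto simp: card_2_iff)
  have "oct_chain (Suc j) P = snoc (Suc j, x) (oct_chain j P) + snoc (Suc j, y) (oct_chain j P)"
    by (subst oct_chain_Suc [OF fin]) (assumption, simp add: xy)
  then show ?case
    using Suc by (simp add: ext_add ext_lb_snoc)
qed (simp add: oct_chain_0)

text \<open>A list sorted by its first coordinate is recovered from its set of vertices, so
  relations between sets of faces carry over to lists.\<close>

lemma olists_oct_faces: "l \<in> olists (k + 1) P \<longleftrightarrow> (\<exists>a. l = map (\<lambda>i. (i, a i)) [1..<k + 2]) \<and> set l \<in> oct_faces k P"
proof
  assume "l \<in> olists (k + 1) P"
  then obtain a where a: "l = map (\<lambda>i. (i, a i)) [1..<k + 2]" "\<forall>i\<in>{1..k + 1}. a i \<in> P i"
    unfolding olists_def by (auto simp del: upt_Suc)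
  moreover have "set l = (\<lambda>i. (i, a i)) ` {1..k + 1}"
    unfolding a(1) by (auto simp del: upt_Suc)
  ultimately show "(\<exists>a. l = map (\<lambda>i. (i, a i)) [1..<k + 2]) \<and> set l \<in> oct_faces k P"
    unfolding oct_faces_def by blast
next
  assume "(\<exists>a. l = map (\<lambda>i. (i, a i)) [1..<k + 2]) \<and> set l \<in> oct_faces k P"
  then obtain a b where a: "l = map (\<lambda>i. (i, a i)) [1..<k + 2]" and b: "set l = (\<lambda>i. (i, b i)) ` {1..k + 1}" "\<forall>i\<in>{1..k + 1}. b i \<in> P i"
    unfolding oct_faces_def by blast
  have "a i = b i" if "i \<in> {1..k + 1}" for i
  proof -
    have "(i, a i) \<in> set l" unfolding a using that by (auto simp del: upt_Suc)
    then show ?thesis unfolding b(1) by auto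
  qed
  then show "l \<in> olists (k + 1) P"
    using a b(2) unfolding olists_def by (auto simp del: upt_Suc)
qed

lemma oct_chain_sym_diff:
  assumes "\<And>i. i \<in> {1..k + 1} \<Longrightarrow> finite (P i) \<and> finite (X i) \<and> finite (Y i)"
    and "oct_faces k P = sym_diff (oct_faces k X) (oct_faces k Y)"
  shows "oct_chain (k + 1) P = oct_chain (k + 1) X + oct_chain (k + 1) Y"
proof -
  have f: "finite (olists (k + 1) P)" "finite (olists (k + 1) X)" "finite (olists (k + 1) Y)"
    using assms(1) by (auto intro!: finite_olists)
  have "olists (k + 1) P = sym_diff (olists (k + 1) X) (olists (k + 1) Y)"
    using assms(2) by (auto simp only: olists_oct_faces set_eq_iff Un_iff Diff_iff)
  then show ?thesis
    unfolding oct_chain_def setchain_def using sum_sym_diff [OF f(2,3), of sg] by simp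
qed

section \<open>The sum of products over the pairs of \<open>S_sum\<close>\<close>

definition tensor_of :: "'v list z2 \<Rightarrow> 'v list z2 \<Rightarrow> 'v tensor" where
  "tensor_of c d = ext (\<lambda>u. ext (\<lambda>w. sg (u, w)) d) c"

lemma tensor_of_sum: "tensor_of (sum f I) d = (\<Sum>i\<in>I. tensor_of (f i) d)" "tensor_of c (sum f I) = (\<Sum>i\<in>I. tensor_of c (f i))"
proof -
  show "tensor_of (sum f I) d = (\<Sum>i\<in>I. tensor_of (f i) d)"
    by (simp add: tensor_of_def ext_sum)
  show "tensor_of c (sum f I) = (\<Sum>i\<in>I. tensor_of c (f i))"
    by (induction I rule: infinite_finite_induct) (simp_all add: tensor_of_def ext_add ext_plus)
qed

lemma tensor_of_snoc: "tensor_of (snoc p c) (snoc q d) = tensor_app [p] [q] (tensor_of c d)"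
  by (simp add: tensor_of_def snoc_def ext_ext tensor_app_def)

lemma tensor_shuf_tensor_of: "tensor_shuf (tensor_of c d) = shuf_chain c d"
  by (simp add: tensor_shuf_def tensor_of_def shuf_chain_def ext_ext)

text \<open>For \<open>T \<subseteq> {2..k + 1}\<close> the pairs \<open>{PT T, QT T}\<close> are those over which \<open>S_sum\<close> is taken, each
  obtained once: fixing the first coordinate orders the two octahedra.\<close>

definition PT :: "nat set \<Rightarrow> nat \<Rightarrow> nat set" where
  "PT T i = (if i = 1 \<or> i \<in> T then {1, 2} else {1, 3})"

definition QT :: "nat set \<Rightarrow> nat \<Rightarrow> nat set" where
  "QT T i = (if i = 1 \<or> i \<in> T then {1, 3} else {1, 2})"

lemma finite_PT: "finite (PT T i)" "finite (QT T i)"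
  by (simp_all add: PT_def QT_def)

text \<open>The pairs of different points in \<open>{1, 2} \<times> {1, 3}\<close>, the product of
  the two choices in coordinate 1; its remaining pair is \<open>base_pair\<close>.\<close>

abbreviation rest_pair :: "(nat \<times> nat) tensor" where
  "rest_pair \<equiv> sg ([(1, 1)], [(1, 3)]) + sg ([(1, 2)], [(1, 1)]) + sg ([(1, 2)], [(1, 3)])"

lemma tensor_of_oct_chain_Suc:
  "tensor_of (oct_chain (Suc j) (PT T)) (oct_chain (Suc j) (QT U)) =
     (\<Sum>x\<in>PT T (Suc j). \<Sum>y\<in>QT U (Suc j). tensor_app [(Suc j, x)] [(Suc j, y)] (tensor_of (oct_chain j (PT T)) (oct_chain j (QT U))))"
  unfolding oct_chain_Suc [OF finite_PT(1)] oct_chain_Suc [OF finite_PT(2)] tensor_of_sum(1) unfolding tensor_of_sum(2) tensor_of_snoc ..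

text \<open>The two choices for a coordinate add up to the hexagon of all pairs of distinct
  points, because the pair \<open>(1, 1)\<close> occurs twice.\<close>

lemma sum_tensor_of:
  "(\<Sum>T\<in>Pow {2..j + 1}. tensor_of (oct_chain (j + 1) (PT T)) (oct_chain (j + 1) (QT T))) = hexagons j (base_pair + rest_pair)"
proof (induction j)
  case 0
  have "{2..0 + 1::nat} = {}" by simp
  moreover have "tensor_of (oct_chain (Suc 0) (PT {})) (oct_chain (Suc 0) (QT {})) = base_pair + rest_pair"
    unfolding tensor_of_oct_chain_Suc oct_chain_0 by (simp add: PT_def QT_def tensor_of_def ac_simps)
  ultimately show ?case by simp
next
  case (Suc j)
  let ?A = "{2..j + 1}" and ?i = "j + 2"
  let ?t = "\<lambda>T. tensor_of (oct_chain (Suc j + 1) (PT T)) (oct_chain (Suc j + 1) (QT T))"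
  let ?c = "\<lambda>T. tensor_of (oct_chain (j + 1) (PT T)) (oct_chain (j + 1) (QT T))"
  have A: "{2..Suc j + 1} = insert ?i ?A" "?i \<notin> ?A" by auto
  have t1: "?t T + ?t (insert ?i T) = hexagon ?i (?c T)" if T: "T \<in> Pow ?A" for T
  proof -
    have "?i \<notin> T" using T by auto
    moreover have "?c (insert ?i T) = ?c T"
      by (intro arg_cong2 [where f = tensor_of] oct_chain_cong) (auto simp: PT_def QT_def)
    ultimately show ?thesis
      using tensor_of_oct_chain_Suc [of "Suc j" T T] tensor_of_oct_chain_Suc [of "Suc j" "insert ?i T" "insert ?i T"]
      by (simp add: PT_def QT_def hexagon_def ac_simps)
  qed
  have inj: "inj_on (insert ?i) (Pow ?A)"
    using A(2) by (intro inj_onI) (metis PowD insert_ident subsetD)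
  have "(\<Sum>T\<in>Pow {2..Suc j + 1}. ?t T) = (\<Sum>T\<in>Pow ?A. ?t T) + (\<Sum>T\<in>insert ?i ` Pow ?A. ?t T)"
    unfolding A(1) Pow_insert by (rule sum.union_disjoint) (use A(2) in auto)
  also have "(\<Sum>T\<in>insert ?i ` Pow ?A. ?t T) = (\<Sum>T\<in>Pow ?A. ?t (insert ?i T))"
    by (rule sum.reindex [OF inj, unfolded o_def])
  also have "(\<Sum>T\<in>Pow ?A. ?t T) + (\<Sum>T\<in>Pow ?A. ?t (insert ?i T)) = (\<Sum>T\<in>Pow ?A. hexagon ?i (?c T))"
    unfolding sum.distrib [symmetric] by (rule sum.cong [OF refl t1])
  also have "\<dots> = hexagon ?i (\<Sum>T\<in>Pow ?A. ?c T)"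
  proof -
    have "hexagon i (sum f I) = (\<Sum>x\<in>I. hexagon i (f x))" for i f and I :: "nat set set"
      by (induction I rule: infinite_finite_induct) (simp_all add: hexagon_add, simp_all add: hexagon_def)
    then show ?thesis by simp
  qed
  finally show ?case
    using Suc by simp
qed

lemma S_sum_eq:
  assumes n: "3 \<le> n" and sym: "\<And>P Q. P \<in> octahedra n k \<Longrightarrow> Q \<in> octahedra n k \<Longrightarrow> A P Q = A Q P"
  shows "S_sum n k A = (\<Sum>T\<in>Pow {2..k + 1}. A (restrict (PT T) {1..k + 1}) (restrict (QT T) {1..k + 1}))"
proof -
  let ?P = "\<lambda>T. restrict (PT T) {1..k + 1}" and ?Q = "\<lambda>T. restrict (QT T) {1..k + 1}"
  have oct: "?P T \<in> octahedra n k" "?Q T \<in> octahedra n k" for T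
    using n by (auto simp: octahedra_def PT_def QT_def)
  have S: "S_pairs n k = (\<lambda>T. {?P T, ?Q T}) ` Pow {2..k + 1}"
  proof (intro Set.set_eqI iffI)
    fix e assume "e \<in> (\<lambda>T. {?P T, ?Q T}) ` Pow {2..k + 1}"
    then obtain T where T: "e = {?P T, ?Q T}" by blast
    have "\<forall>i\<in>{1..k+1}. ?P T i \<subseteq> {1..3} \<and> ?Q T i \<subseteq> {1..3} \<and> ?P T i \<inter> ?Q T i = {1}"
      by (auto simp: PT_def QT_def)
    with T oct show "e \<in> S_pairs n k" unfolding S_pairs_def by blast
  next
    fix e assume "e \<in> S_pairs n k"
    then obtain P Q where e: "e = {P, Q}" and P: "P \<in> octahedra n k" and Q: "Q \<in> octahedra n k"
      and PQ: "\<forall>i\<in>{1..k+1}. P i \<subseteq> {1..3} \<and> Q i \<subseteq> {1..3} \<and> P i \<inter> Q i = {1}"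
      unfolding S_pairs_def by blast
    have two: "X = {1, 2} \<and> Y = {1, 3} \<or> X = {1, 3} \<and> Y = {1, 2}"
      if X: "X \<subseteq> {1..3}" "card X = 2" and Y: "Y \<subseteq> {1..3}" "card Y = 2" and XY: "X \<inter> Y = {1}" for X Y :: "nat set"
    proof -
      have "(1::nat) \<in> X" "1 \<in> Y" using XY by auto
      obtain x where x: "X = {1, x}" "x \<noteq> 1"
        using X(2) \<open>1 \<in> X\<close> by (auto simp: card_2_iff)
      obtain y where y: "Y = {1, y}" "y \<noteq> 1"
        using Y(2) \<open>1 \<in> Y\<close> by (auto simp: card_2_iff)
      have "x = 2 \<or> x = 3" "y = 2 \<or> y = 3" "x \<noteq> y"
        using x y X(1) Y(1) XY by auto
      then show ?thesis using x y by auto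
    qed
    have cs: "P i = {1, 2} \<and> Q i = {1, 3} \<or> P i = {1, 3} \<and> Q i = {1, 2}" if "i \<in> {1..k+1}" for i
      using two [of "P i" "Q i"] PQ P Q that unfolding octahedra_def by blast
    have fin: "{P', Q'} \<in> (\<lambda>T. {?P T, ?Q T}) ` Pow {2..k + 1}"
      if P': "P' \<in> octahedra n k" and Q': "Q' \<in> octahedra n k" and 1: "P' 1 = {1, 2}"
        and cs: "\<And>i. i \<in> {1..k+1} \<Longrightarrow> P' i = {1, 2} \<and> Q' i = {1, 3} \<or> P' i = {1, 3} \<and> Q' i = {1, 2}" for P' Q'
    proof -
      let ?T = "{i \<in> {2..k + 1}. P' i = {1, 2}}"
      have "P' i = PT ?T i \<and> Q' i = QT ?T i" if "i \<in> {1..k + 1}" for i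
      proof (cases "i = 1")
        case True
        then show ?thesis using cs [OF that] 1 by (auto simp: PT_def QT_def doubleton_eq_iff)
      next
        case False
        then show ?thesis using cs [OF that] that by (auto simp: PT_def QT_def doubleton_eq_iff)
      qed
      then have "P' = ?P ?T" "Q' = ?Q ?T"
        using P' Q' unfolding octahedra_def by (auto simp: PiE_iff extensional_def fun_eq_iff)
      then have "{P', Q'} = {?P ?T, ?Q ?T}"
        by (rule arg_cong2 [where f = "\<lambda>a b. {a, b}"])
      moreover have "?T \<in> Pow {2..k + 1}" by blast
      ultimately show ?thesis by (rule image_eqI)
    qed
    show "e \<in> (\<lambda>T. {?P T, ?Q T}) ` Pow {2..k + 1}"
    proof (cases "P 1 = {1, 2}")
      case True
      show ?thesis unfolding e by (rule fin [OF P Q True cs])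
    next
      case False
      then have "Q 1 = {1, 2}" using cs [of 1] by auto
      then show ?thesis
        unfolding e insert_commute [of P Q] by (rule fin [OF Q P]) (use cs in blast)
    qed
  qed
  have P1: "?P T 1 = {1, 2}" "?Q T 1 = {1, 3}" for T
    by (simp_all add: PT_def QT_def)
  have PQ_ne: "?P T \<noteq> ?Q T'" for T T'
    using P1 by (metis doubleton_eq_iff numeral_eq_iff semiring_norm(89) one_eq_numeral_iff)
  have inj: "inj_on (\<lambda>T. {?P T, ?Q T}) (Pow {2..k + 1})"
  proof (rule inj_onI)
    fix T T' assume T: "T \<in> Pow {2..k + 1}" "T' \<in> Pow {2..k + 1}" "{?P T, ?Q T} = {?P T', ?Q T'}"
    then have eq: "?P T = ?P T'"
      using PQ_ne by (auto simp: doubleton_eq_iff)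
    have "i \<in> T \<longleftrightarrow> i \<in> T'" if "i \<in> {2..k + 1}" for i
      using fun_cong [OF eq, of i] that by (auto simp: PT_def doubleton_eq_iff split: if_splits)
    then show "T = T'" using T(1,2) by blast
  qed
  \<comment> \<open>By symmetry of \<open>A\<close> both orders of the pair give the same entry, so
    the description is unique.\<close>
  have the: "(THE b. \<exists>P Q. {?P T, ?Q T} = {P, Q} \<and> b = A P Q) = A (?P T) (?Q T)" for T
    using sym [OF oct, of T T] by (intro the_equality) (auto simp: doubleton_eq_iff)
  show ?thesis
    unfolding S_sum_def S sum.reindex [OF inj] o_def the ..
qed

lemma shuf_chain_map: "shuf_chain (ext (\<lambda>l. sg (map f l)) c) (ext (\<lambda>l. sg (map g l)) d) = ext (\<lambda>l. sg (map (map_prod f g) l)) (shuf_chain c d)"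
  unfolding shuf_chain_def ext_ext by (simp add: shuf_map)

lemma cls_sum:
  assumes "cls p A D f" "\<And>i. i \<in> I \<Longrightarrow> cyc p A D (z i)"
  shows "f (sum z I) = (\<Sum>i\<in>I. f (z i)) \<and> cyc p A D (sum z I)"
  using assms(2)
proof (induction I rule: infinite_finite_induct)
  case (insert x F)
  then have F: "f (sum z F) = (\<Sum>i\<in>F. f (z i))" "cyc p A D (sum z F)" and x: "cyc p A D (z x)"
    by auto
  show ?case
    using cls_add [OF assms(1) x F(2)] cyc_add [OF x F(2)] F(1) insert.hyps by simp
qed (use cls_null [OF assms(1) cyc_0 hmg_refl] in simp_all)

lemma octahedraD:
  assumes "P \<in> octahedra n k" "i \<in> {1..k + 1}"
  shows "P i \<subseteq> {1..n}" "card (P i) = 2" "finite (P i)"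
proof -
  show "P i \<subseteq> {1..n}" "card (P i) = 2"
    using assms unfolding octahedra_def by blast+
  then show "finite (P i)" by (meson finite_atLeastAtMost finite_subset)
qed

lemma finite_octahedra: "finite (octahedra n k)"
  unfolding octahedra_def by (rule finite_PiE) simp_all

section \<open>Octahedral cycles in the manifold\<close>

locale embedding = setting bs n k v
  for bs :: "'a::euclidean_space list" and n k :: nat and v :: "nat \<times> nat \<Rightarrow> 'b::euclidean_space" +
  fixes f :: "'b \<Rightarrow> 'c::euclidean_space" and M :: "'c set"
  assumes cont_f: "continuous_on (body (join_power n k) v) f" and inj_f: "inj_on f (body (join_power n k) v)"
    and f_M: "f ` body (join_power n k) v \<subseteq> M"
begin

abbreviation complex_body :: "'b set" where "complex_body \<equiv> body (join_power n k) v"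

abbreviation oct_cycle :: "(nat \<Rightarrow> nat set) \<Rightarrow> 'c mod2_chain" where
  "oct_cycle P \<equiv> cm k f (aff_chain (ext (\<lambda>l. sg (map v l)) (oct_chain (k + 1) P)))"

definition oct_body :: "(nat \<Rightarrow> nat set) \<Rightarrow> 'b set" where
  "oct_body P = (\<Union>\<sigma>\<in>oct_faces k P. convex hull (v ` \<sigma>))"

lemma m_pos: "0 < m" using m2k k1 by simp

lemma k_plus_k: "k + k = m" using m2k by simp

lemma oct_chain_keys_length:
  assumes "P \<in> octahedra n k" "l \<in> keys (oct_chain (k + 1) P)" shows "length l = Suc k"
  using oct_chain_length [OF _ assms(2)] octahedraD(3) [OF assms(1)] by simp

lemma oct_cycle_list_length:
  assumes "P \<in> octahedra n k" "l \<in> keys (ext (\<lambda>l. sg (map v l)) (oct_chain (k + 1) P))"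
  shows "length l = Suc k"
  using subsetD [OF keys_ext assms(2)] oct_chain_keys_length [OF assms(1)] by auto

lemma oct_faces_join: "P \<in> octahedra n k \<Longrightarrow> \<sigma> \<in> oct_faces k P \<Longrightarrow> \<sigma> \<in> join_power n k"
proof -
  assume P: "P \<in> octahedra n k" and "\<sigma> \<in> oct_faces k P"
  then obtain a where a: "\<sigma> = (\<lambda>i. (i, a i)) ` {1..k + 1}" "\<forall>i\<in>{1..k + 1}. a i \<in> P i"
    unfolding oct_faces_def by blast
  have "\<forall>i\<in>{1..k + 1}. a i \<in> {1..n}"
    using a(2) octahedraD(1) [OF P] by blast
  then have "\<sigma> \<in> k_faces n k"
    unfolding k_faces_def a(1) by blast
  moreover have "\<sigma> \<noteq> {}" unfolding a(1) by simp
  ultimately show "\<sigma> \<in> join_power n k"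
    unfolding join_power_def by blast
qed

lemma oct_body_body: "P \<in> octahedra n k \<Longrightarrow> oct_body P \<subseteq> complex_body"
  unfolding oct_body_def body_def using oct_faces_join by blast

lemma ch_oct_cycle0:
  assumes P: "P \<in> octahedra n k" shows "ch k (oct_body P) (aff_chain (ext (\<lambda>l. sg (map v l)) (oct_chain (k + 1) P)))"
proof (rule ch_aff_chain, intro conjI)
  fix l' assume l': "l' \<in> keys (ext (\<lambda>l. sg (map v l)) (oct_chain (k + 1) P))"
  show "length l' = Suc k" by (rule oct_cycle_list_length [OF P l'])
  obtain l where l: "l \<in> keys (oct_chain (k + 1) P)" "l' = map v l"
    using subsetD [OF keys_ext l'] by auto
  have "l \<in> olists (k + 1) P"
    using l(1) keys_setchain [OF finite_olists [OF octahedraD(3) [OF P]]] by (simp add: oct_chain_def)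
  then have "set l \<in> oct_faces k P"
    using olists_oct_faces by blast
  then show "convex hull (set l') \<subseteq> oct_body P"
    unfolding oct_body_def l(2) set_map by blast
qed

lemma ch_oct_cycle:
  assumes P: "P \<in> octahedra n k" shows "ch k (f ` oct_body P) (oct_cycle P)" "ch k M (oct_cycle P)"
proof -
  show 1: "ch k (f ` oct_body P) (oct_cycle P)"
    by (rule ch_cm [OF ch_oct_cycle0 [OF P] continuous_on_subset [OF cont_f oct_body_body [OF P]]]) simp
  show "ch k M (oct_cycle P)"
    by (rule ch_mono [OF 1]) (use f_M oct_body_body [OF P] in blast)
qed

lemma bd_oct_cycle:
  assumes P: "P \<in> octahedra n k" shows "bd k (oct_cycle P) = 0"
proof -
  have "bd k (oct_cycle P) = cm (k - 1) f (bd k (aff_chain (ext (\<lambda>l. sg (map v l)) (oct_chain (k + 1) P))))"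
    by (rule bd_cm [OF ch_oct_cycle0 [OF P]])
  also have "bd k (aff_chain (ext (\<lambda>l. sg (map v l)) (oct_chain (k + 1) P))) = aff_chain (ext lb (ext (\<lambda>l. sg (map v l)) (oct_chain (k + 1) P)))"
    by (rule bd_aff_chain) (rule oct_cycle_list_length [OF P])
  also have "ext lb (ext (\<lambda>l. sg (map v l)) (oct_chain (k + 1) P)) = ext (\<lambda>l. sg (map v l)) (ext lb (oct_chain (k + 1) P))"
    by (simp add: ext_ext lb_map)
  also have "ext lb (oct_chain (k + 1) P) = 0"
    using octahedraD(2) [OF P] by (rule lb_oct_chain)
  finally show ?thesis by simp
qed

lemma cross_oct_cycle:
  assumes "P \<in> octahedra n k" "Q \<in> octahedra n k"
  shows "cross k k (oct_cycle P) (oct_cycle Q) = cm m (map_prod f f) (pair_chain (tensor_of (oct_chain (k + 1) P) (oct_chain (k + 1) Q)))"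
  unfolding pair_chain_def tensor_shuf_tensor_of k_plus_k [symmetric] shuf_chain_map [symmetric]
  by (rule cross_cm_aff_chain) (rule oct_cycle_list_length [OF assms(1)], assumption, rule oct_cycle_list_length [OF assms(2)], assumption)

lemma cyc_cross_oct_cycle:
  assumes "P \<in> octahedra n k" "Q \<in> octahedra n k"
  shows "cyc m (M \<times> M) off_diag (cross k k (oct_cycle P) (oct_cycle Q))"
proof -
  have "bd (k + k) (cross k k (oct_cycle P) (oct_cycle Q)) = 0"
    unfolding bd_cross bd_oct_cycle [OF assms(1)] bd_oct_cycle [OF assms(2)] by simp
  moreover have "ch (k + k) (M \<times> M) (cross k k (oct_cycle P) (oct_cycle Q))"
    by (rule ch_cross [OF ch_oct_cycle(2) [OF assms(1)] ch_oct_cycle(2) [OF assms(2)]])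
  ultimately show ?thesis
    unfolding k_plus_k by (simp add: cyc_def)
qed

lemma map_prod_f_off_diag: "map_prod f f ` (complex_body \<times> complex_body \<inter> off_diag) \<subseteq> off_diag"
  using inj_f by (auto simp: off_diag_def dest: inj_onD)

end

section \<open>The matrix on a finite union of charts\<close>

locale charted_embedding = embedding bs n k v f M
  for bs :: "'a::euclidean_space list" and n k :: nat and v :: "nat \<times> nat \<Rightarrow> 'b::euclidean_space"
    and f :: "'b \<Rightarrow> 'c::euclidean_space" and M :: "'c set" +
  fixes N :: nat and U :: "nat \<Rightarrow> 'c set" and \<phi> :: "nat \<Rightarrow> 'c \<Rightarrow> 'a" and \<psi> :: "nat \<Rightarrow> 'a \<Rightarrow> 'c"
  assumes charts: "\<And>i. i < N \<Longrightarrow> chart M (U i) (\<phi> i) (\<psi> i)" and M_eq: "M = (\<Union>i<N. U i)"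
begin

text \<open>The star is shrunk towards the apex until \<open>f\<close> maps it into a single chart.
  Every stage of the shrinking is injective, and so is \<open>f\<close>; hence points off the
  diagonal stay off it and the class does not change.\<close>

lemma class_near_apex:
  assumes D: "cls m (M \<times> M) off_diag D"
    and Dd: "\<And>i z. i < N \<Longrightarrow> cyc m (U i \<times> U i) off_diag z \<Longrightarrow> D z = chart_deg (\<phi> i) z"
  shows "D (cm m (map_prod f f) (pair_chain (hexagons k base_pair))) = 1 \<and>
     cyc m (M \<times> M) off_diag (cm m (map_prod f f) (pair_chain (hexagons k base_pair)))"
proof -
  let ?c = "pair_chain (hexagons k base_pair)"
  have SB: "star \<subseteq> complex_body" by (rule star_subset_body)
  have face_pair: "face_pairs k (m + 2) {(1, 1)} {1} (hexagons k base_pair)"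
    using face_pairs_hexagons [OF face_pairs_base, of k] by (simp add: m2k)
  have c: "ch m (star \<times> star) ?c"
    by (rule ch_pair_chain_star [OF face_pair order_refl])
  have tokb: "face_pairs k ((m - 1) + 2) {} {1} (hexagons k (tensor_bd base_pair))"
    using face_pairs_hexagons [OF face_pairs_tensor_bd_base, of k] m_pos k1 by (simp add: m2k)
  have "bd m ?c = pair_chain (hexagons k (tensor_bd base_pair))"
    unfolding bd_pair_chain [OF face_pair] tensor_bd_hexagons ..
  then have cc: "cyc m (star \<times> star) off_diag ?c"
    using c ch_pair_chain_off_diag [OF tokb order_refl] by (simp add: cyc_def)
  have cfs: "continuous_on star f" by (rule continuous_on_subset [OF cont_f SB])
  have fM: "f x \<in> M" if "x \<in> star" for x using f_M SB that by blast
  have inj: "x = y" if "x \<in> star" "y \<in> star" "f x = f y" for x y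
    using inj_f SB that by (meson inj_onD subsetD)
  obtain i where i: "i < N" "f apex \<in> U i"
    using fM [OF apex_in_star] unfolding M_eq by blast
  note ch = charts [OF i(1)]
  obtain T where T: "open T" "U i = M \<inter> T"
    using chartD(1) [OF ch] unfolding openin_open by blast
  have "f apex \<in> T" using i(2) T by blast
  then obtain r where r: "0 < r" "ball (f apex) r \<subseteq> T"
    using T(1) by (meson openE)
  obtain d where d: "0 < d" "\<And>x. x \<in> star \<Longrightarrow> dist x apex < d \<Longrightarrow> dist (f x) (f apex) < r"
    using cfs apex_in_star r(1) unfolding continuous_on_iff by metis
  obtain B where B: "0 < B" "\<And>x. x \<in> star \<Longrightarrow> norm (x - apex) \<le> B"
  proof -
    have "bounded ((\<lambda>x. x - apex) ` star)"
      by (intro compact_imp_bounded compact_continuous_image compact_star continuous_intros)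
    then show ?thesis using that unfolding bounded_pos by auto
  qed
  \<comment> \<open>The star lies within distance \<open>B\<close> of the apex, so scaling by
    \<open>e\<close> brings it within \<open>d / 2\<close>.\<close>
  define e where "e = min 1 (d / (2 * B))"
  have e: "0 < e" "e \<le> 1" using d B(1) by (auto simp: e_def)
  \<comment> \<open>The scale runs from 1 at time 0 to \<open>e\<close> at time 1 and is always
    positive, which keeps \<open>s t\<close> injective.\<close>
  define s where "s t x = apex + ((1 - t) + t * e) *\<^sub>R (x - apex)" for t and x :: 'b
  have coef: "0 < (1 - t) + t * e" "(1 - t) + t * e \<le> 1" if "t \<in> {0..1}" for t
  proof -
    show "0 < (1 - t) + t * e"
    proof (cases "t = 1")
      case False
      then have "0 < 1 - t" "0 \<le> t * e" using that e by auto
      then show ?thesis by linarith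
    qed (use e in simp)
    have "t * e \<le> t * 1" using that e by (intro mult_left_mono) auto
    then show "(1 - t) + t * e \<le> 1" by simp
  qed
  have s_star: "s t x \<in> star" if "x \<in> star" "t \<in> {0..1}" for t x
    unfolding s_def using star_shrink [OF that(1)] coef [OF that(2)] by simp
  have s_inj: "x = y" if "s t x = s t y" "t \<in> {0..1}" for t x y
    using that coef [OF that(2)] by (simp add: s_def)
  have s_neq: "f (s t (fst x)) \<noteq> f (s t (snd x))" if x: "x \<in> star \<times> star" "x \<in> off_diag" and t: "t \<in> {0..1}" for x t
  proof
    assume "f (s t (fst x)) = f (s t (snd x))"
    then have "s t (fst x) = s t (snd x)"
      using x(1) t by (intro inj s_star) auto
    then have "fst x = snd x" by (rule s_inj [OF _ t])
    then show False using x(2) by (auto simp: off_diag_def)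
  qed
  have s1: "f (s 1 x) \<in> U i" if x: "x \<in> star" for x
  proof -
    have "norm (s 1 x - apex) \<le> e * B"
      using B(2) [OF x] e by (simp add: s_def mult_left_mono)
    also have "\<dots> \<le> d / (2 * B) * B"
      using B(1) by (intro mult_right_mono) (auto simp: e_def)
    also have "\<dots> < d" using B(1) d(1) by simp
    finally have "dist (s 1 x) apex < d" by (simp add: dist_norm)
    then have "dist (f (s 1 x)) (f apex) < r"
      using d(2) s_star [OF x, of 1] by simp
    then have "f (s 1 x) \<in> T" using r(2) by (auto simp: dist_commute)
    then show ?thesis using T(2) fM s_star [OF x, of 1] by simp
  qed
  let ?H = "\<lambda>x::('b \<times> 'b) \<times> real. (f (s (snd x) (fst (fst x))), f (s (snd x) (snd (fst x))))"
  have cs: "continuous_on X (\<lambda>x::('b \<times> 'b) \<times> real. s (snd x) (fst (fst x)))"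
    "continuous_on X (\<lambda>x::('b \<times> 'b) \<times> real. s (snd x) (snd (fst x)))" for X
    unfolding s_def by (intro continuous_intros)+
  have cH: "continuous_on ((star \<times> star) \<times> {0..1}) ?H"
    by (intro continuous_on_Pair continuous_on_compose2 [OF cfs cs(1)] continuous_on_compose2 [OF cfs cs(2)])
      (auto intro: s_star)
  have "hmg m (M \<times> M) off_diag (cm m (\<lambda>x. ?H (x, 0)) ?c) (cm m (\<lambda>x. ?H (x, 1)) ?c)"
  proof (rule hmg_homotopy [OF cc cH])
    show "?H ` ((star \<times> star) \<times> {0..1}) \<subseteq> M \<times> M"
      using s_star fM by auto
    show "?H (x, t) \<in> off_diag" if "x \<in> star \<times> star" "x \<in> off_diag" "t \<in> {0..1}" for x t
      using s_neq [OF that] by (simp add: off_diag_def)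
  qed
  moreover have "(\<lambda>x. ?H (x, 0)) = map_prod f f"
    by (auto simp: s_def fun_eq_iff)
  ultimately have h: "hmg m (M \<times> M) off_diag (cm m (map_prod f f) ?c) (cm m (\<lambda>x. ?H (x, 1)) ?c)"
    by simp
  have z: "cyc m (M \<times> M) off_diag (cm m (map_prod f f) ?c)"
  proof (rule cyc_cm [OF cc])
    show "continuous_on (star \<times> star) (map_prod f f)"
      by (rule continuous_on_map_prod [OF cfs])
    show "map_prod f f ` (star \<times> star) \<subseteq> M \<times> M" using fM by auto
    show "map_prod f f ` (star \<times> star \<inter> off_diag) \<subseteq> off_diag" using inj by (auto simp: off_diag_def)
  qed
  let ?g1 = "\<lambda>x::'b \<times> 'b. ?H (x, 1)"
  have cg1: "continuous_on (star \<times> star) ?g1"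
    by (rule continuous_on_compose2 [OF cH]) (auto intro!: continuous_intros)
  have g1: "?g1 x \<in> U i \<times> U i" if "x \<in> star \<times> star" for x
    using s1 that by auto
  have g1_off: "?g1 x \<in> off_diag" if "x \<in> star \<times> star" "x \<in> off_diag" for x
    using s_neq [OF that, of 1] by (simp add: off_diag_def)
  have z1: "cyc m (U i \<times> U i) off_diag (cm m ?g1 ?c)"
    by (rule cyc_cm [OF cc cg1]) (use g1 g1_off in blast)+
  let ?g = "\<lambda>x. \<phi> i (snd (?g1 x)) - \<phi> i (fst (?g1 x))"
  have "chart_deg (\<phi> i) (cm m ?g1 ?c) = local_deg (cm m ?g ?c)"
    unfolding chart_deg_def cm_compose by (simp add: o_def)
  also have "\<dots> = 1"
  proof (rule local_degree)
    show "continuous_on (star \<times> star) ?g"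
      by (rule continuous_on_compose2 [OF continuous_chart_diff [OF ch] cg1]) (use g1 in blast)
    show "?g ` (star \<times> star) \<subseteq> V"
      using chart_diff_V [OF ch] g1 by blast
    show "?g (prod.swap x) = - ?g x" for x by simp
    show "?g x \<noteq> 0" if x: "x \<in> star \<times> star" "x \<in> off_diag" for x
    proof -
      have "?g1 x \<in> U i \<times> U i \<inter> off_diag" using g1 g1_off x by blast
      then have "?g x \<in> Dn m" using chart_diff_Dn [OF ch] by blast
      then show ?thesis by (rule Dn_nonzero)
    qed
  qed
  finally have "D (cm m ?g1 ?c) = 1"
    using Dd [OF i(1) z1] by simp
  then show ?thesis
    using cls_hmg [OF D z h] z by simp
qed

text \<open>The second clause prepares the rank bound: if \<open>d\<close> bounds a sum of cycles,
  its product with \<open>oct_cycle i\<close> bounds the corresponding sum of products, on which the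
  class vanishes. With \<open>d\<close> explicit, a relation found in a larger manifold can be used
  as soon as \<open>d\<close> lies in \<open>M\<close>.\<close>

theorem matrix_exists:
  "\<exists>A. nk_matrix n k A \<and>
    (\<forall>j\<in>octahedra n k. \<forall>T\<subseteq>octahedra n k. \<forall>d. ch (Suc k) M d \<longrightarrow> oct_cycle j + (\<Sum>q\<in>T. oct_cycle q) = bd (Suc k) d \<longrightarrow>
       (\<forall>i\<in>octahedra n k. A i j = (\<Sum>q\<in>T. A i q)))"
proof -
  obtain D where D: "cls m (M \<times> M) off_diag D"
    and Dd: "\<And>i z. i < N \<Longrightarrow> cyc m (U i \<times> U i) off_diag z \<Longrightarrow> D z = chart_deg (\<phi> i) z"
    and Ds: "\<And>z. cyc m (M \<times> M) off_diag z \<Longrightarrow> D (cm m prod.swap z) = D z"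
    and D0: "\<And>z. ch m ((M \<times> M) \<inter> off_diag) z \<Longrightarrow> D z = 0"
    using thom_class [OF m_pos charts M_eq] by metis
  define A where "A P Q = D (cross k k (oct_cycle P) (oct_cycle Q))" for P Q
  have sym: "A P Q = A Q P" if "P \<in> octahedra n k" "Q \<in> octahedra n k" for P Q
    unfolding A_def using Ds [OF cyc_cross_oct_cycle [OF that(2,1)]] cm_swap_cross [of k k "oct_cycle Q" "oct_cycle P"] by (simp add: k_plus_k)
  have indep: "A P Q = 0" if P: "P \<in> octahedra n k" and Q: "Q \<in> octahedra n k" and PQ: "vertex_disjoint k P Q" for P Q
  proof -
    have "ch (k + k) ((f ` oct_body P) \<times> (f ` oct_body Q)) (cross k k (oct_cycle P) (oct_cycle Q))"
      by (rule ch_cross [OF ch_oct_cycle(1) [OF P] ch_oct_cycle(1) [OF Q]])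
    moreover have "(f ` oct_body P) \<times> (f ` oct_body Q) \<subseteq> (M \<times> M) \<inter> off_diag"
    proof
      fix z assume "z \<in> (f ` oct_body P) \<times> (f ` oct_body Q)"
      then obtain x y where z: "z = (f x, f y)" and x: "x \<in> oct_body P" and y: "y \<in> oct_body Q" by blast
      obtain \<sigma> where \<sigma>: "\<sigma> \<in> oct_faces k P" "x \<in> convex hull (v ` \<sigma>)" using x by (auto simp: oct_body_def)
      obtain \<tau> where \<tau>: "\<tau> \<in> oct_faces k Q" "y \<in> convex hull (v ` \<tau>)" using y by (auto simp: oct_body_def)
      have "\<sigma> \<inter> \<tau> = {}"
      proof -
        obtain a where a: "\<sigma> = (\<lambda>i. (i, a i)) ` {1..k+1}" "\<forall>i\<in>{1..k+1}. a i \<in> P i"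
          using \<sigma>(1) unfolding oct_faces_def by blast
        obtain b where b: "\<tau> = (\<lambda>i. (i, b i)) ` {1..k+1}" "\<forall>i\<in>{1..k+1}. b i \<in> Q i"
          using \<tau>(1) unfolding oct_faces_def by blast
        have "a i \<noteq> b i" if "i \<in> {1..k+1}" for i
          using bspec [OF a(2) that] bspec [OF b(2) that] bspec [OF PQ [unfolded vertex_disjoint_def] that]
          by (metis disjoint_iff)
        then show ?thesis unfolding a(1) b(1) by fast
      qed
      then have "x \<noteq> y"
        using hulls_disjoint [OF oct_faces_join [OF P \<sigma>(1)] oct_faces_join [OF Q \<tau>(1)]] \<sigma>(2) \<tau>(2) by blast
      then have "f x \<noteq> f y"
        using inj_f oct_body_body [OF P] oct_body_body [OF Q] x y by (meson inj_onD subsetD)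
      moreover have "f x \<in> M" "f y \<in> M"
        using f_M oct_body_body [OF P] oct_body_body [OF Q] x y by blast+
      ultimately show "z \<in> (M \<times> M) \<inter> off_diag" by (simp add: z off_diag_def)
    qed
    ultimately have "ch (k + k) ((M \<times> M) \<inter> off_diag) (cross k k (oct_cycle P) (oct_cycle Q))"
      by (rule ch_mono)
    then show ?thesis unfolding A_def k_plus_k by (rule D0)
  qed
  have additive: "A P Q = A X Q + A Y Q"
    if P: "P \<in> octahedra n k" and X: "X \<in> octahedra n k" and Y: "Y \<in> octahedra n k" and Q: "Q \<in> octahedra n k"
      and eq: "oct_faces k P = sym_diff (oct_faces k X) (oct_faces k Y)" for P X Y Q
  proof -
    have "oct_chain (k + 1) P = oct_chain (k + 1) X + oct_chain (k + 1) Y"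
      using octahedraD(3) P X Y by (intro oct_chain_sym_diff [OF _ eq]) blast
    then have "cross k k (oct_cycle P) (oct_cycle Q) = cross k k (oct_cycle X) (oct_cycle Q) + cross k k (oct_cycle Y) (oct_cycle Q)"
      by (simp only: ext_add aff_chain_add cm_add cross_add1)
    then show ?thesis
      unfolding A_def using cls_add [OF D cyc_cross_oct_cycle [OF X Q] cyc_cross_oct_cycle [OF Y Q]] by simp
  qed
  \<comment> \<open>The two factors differ in coordinate 1 by the choice of
    \<open>rest_pair\<close>, and in all others because a hexagon pairs different points; so these
    cells avoid the diagonal.\<close>
  have far: "ch m ((M \<times> M) \<inter> off_diag) (cm m (map_prod f f) (pair_chain (hexagons k rest_pair)))"
  proof -
    have "face_pairs 0 2 {} UNIV rest_pair"
      by (intro face_pairs_add) (simp_all add: face_pairs_sg face_pair_def)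
    from face_pairs_hexagons [OF this, of k] have face_pair: "face_pairs k (m + 2) {} UNIV (hexagons k rest_pair)"
      by (simp add: m2k)
    have "ch m (complex_body \<times> complex_body \<inter> off_diag) (pair_chain (hexagons k rest_pair))"
      unfolding ch_Int by (intro conjI ch_pair_chain_body [OF face_pair order_refl] ch_pair_chain_off_diag [OF face_pair order_refl])
    then show ?thesis
    proof (rule ch_cm)
      show "continuous_on (complex_body \<times> complex_body \<inter> off_diag) (map_prod f f)"
        by (rule continuous_on_subset [OF continuous_on_map_prod [OF cont_f]]) blast
      show "map_prod f f ` (complex_body \<times> complex_body \<inter> off_diag) \<subseteq> (M \<times> M) \<inter> off_diag"
        using map_prod_f_off_diag f_M by auto
    qed
  qed
  have "S_sum n k A = 1"
  proof -
    let ?P = "\<lambda>T. restrict (PT T) {1..k + 1}" and ?Q = "\<lambda>T. restrict (QT T) {1..k + 1}"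
    have oct: "?P T \<in> octahedra n k" "?Q T \<in> octahedra n k" for T
      using n3 by (auto simp: octahedra_def PT_def QT_def)
    have OLP: "oct_chain (k + 1) (?P T) = oct_chain (k + 1) (PT T)" "oct_chain (k + 1) (?Q T) = oct_chain (k + 1) (QT T)" for T
      by (rule oct_chain_cong, simp)+
    have "S_sum n k A = (\<Sum>T\<in>Pow {2..k + 1}. A (?P T) (?Q T))"
      by (rule S_sum_eq [OF n3 sym])
    also have "\<dots> = D (\<Sum>T\<in>Pow {2..k + 1}. cross k k (oct_cycle (?P T)) (oct_cycle (?Q T)))"
      unfolding A_def by (rule cls_sum [OF D cyc_cross_oct_cycle [OF oct], THEN conjunct1, symmetric])
    also have "(\<Sum>T\<in>Pow {2..k + 1}. cross k k (oct_cycle (?P T)) (oct_cycle (?Q T))) =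
        (\<Sum>T\<in>Pow {2..k + 1}. cm m (map_prod f f) (pair_chain (tensor_of (oct_chain (k + 1) (PT T)) (oct_chain (k + 1) (QT T)))))"
      unfolding cross_oct_cycle [OF oct] unfolding OLP ..
    also have "\<dots> = cm m (map_prod f f) (pair_chain (\<Sum>T\<in>Pow {2..k + 1}. tensor_of (oct_chain (k + 1) (PT T)) (oct_chain (k + 1) (QT T))))"
    proof -
      have "pair_chain (sum g I) = (\<Sum>i\<in>I. pair_chain (g i))" for g and I :: "nat set set"
        by (induction I rule: infinite_finite_induct) (simp_all add: pair_chain_add, simp_all add: pair_chain_def)
      then show ?thesis by (simp add: cm_sum)
    qed
    also have "\<dots> = cm m (map_prod f f) (pair_chain (hexagons k base_pair)) + cm m (map_prod f f) (pair_chain (hexagons k rest_pair))"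
      unfolding sum_tensor_of hexagons_add pair_chain_add cm_add ..
    also have "D \<dots> = D (cm m (map_prod f f) (pair_chain (hexagons k base_pair))) + D (cm m (map_prod f f) (pair_chain (hexagons k rest_pair)))"
    proof (rule cls_add [OF D])
      show "cyc m (M \<times> M) off_diag (cm m (map_prod f f) (pair_chain (hexagons k base_pair)))"
        using class_near_apex [OF D Dd] by blast
      show "cyc m (M \<times> M) off_diag (cm m (map_prod f f) (pair_chain (hexagons k rest_pair)))"
        using far ch_bd [OF far] unfolding cyc_def ch_Int by (simp only: simp_thms)
    qed
    also have "\<dots> = 1"
      using D0 [OF far] class_near_apex [OF D Dd] by simp
    finally show ?thesis .
  qed
  then have nk: "nk_matrix n k A"
    unfolding nk_matrix_def using sym indep additive by (intro conjI ballI impI)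
  have rank: "A i j = (\<Sum>q\<in>T. A i q)"
    if j: "j \<in> octahedra n k" and T: "T \<subseteq> octahedra n k" and d: "ch (Suc k) M d"
      and eq: "oct_cycle j + (\<Sum>q\<in>T. oct_cycle q) = bd (Suc k) d" and i: "i \<in> octahedra n k" for i j T d
  proof -
    have cT: "D (\<Sum>q\<in>T. cross k k (oct_cycle i) (oct_cycle q)) = (\<Sum>q\<in>T. A i q) \<and> cyc m (M \<times> M) off_diag (\<Sum>q\<in>T. cross k k (oct_cycle i) (oct_cycle q))"
      unfolding A_def by (rule cls_sum [OF D cyc_cross_oct_cycle [OF i]]) (use T in blast)
    have "cross k k (oct_cycle i) (oct_cycle j) + (\<Sum>q\<in>T. cross k k (oct_cycle i) (oct_cycle q)) = cross k k (oct_cycle i) (bd (Suc k) d)"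
      by (simp only: cross_sum2 [symmetric] cross_add2 [symmetric] eq)
    also have "\<dots> = bd (k + Suc k) (cross k (Suc k) (oct_cycle i) d)"
      unfolding bd_cross bd_oct_cycle [OF i] by simp
    finally have sum: "cross k k (oct_cycle i) (oct_cycle j) + (\<Sum>q\<in>T. cross k k (oct_cycle i) (oct_cycle q)) = bd (Suc m) (cross k (Suc k) (oct_cycle i) d)"
      by (simp add: k_plus_k [symmetric])
    have "ch (k + Suc k) (M \<times> M) (cross k (Suc k) (oct_cycle i) d)"
      by (rule ch_cross [OF ch_oct_cycle(2) [OF i] d])
    then have "hmg m (M \<times> M) off_diag (bd (Suc m) (cross k (Suc k) (oct_cycle i) d)) 0"
      by (intro hmg_bd) (simp add: k_plus_k [symmetric])
    then have "D (cross k k (oct_cycle i) (oct_cycle j) + (\<Sum>q\<in>T. cross k k (oct_cycle i) (oct_cycle q))) = 0"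
      unfolding sum [symmetric] using cyc_add [OF cyc_cross_oct_cycle [OF i j] conjunct2 [OF cT]] by (intro cls_null [OF D])
    then have "A i j + (\<Sum>q\<in>T. A i q) = 0"
      using cls_add [OF D cyc_cross_oct_cycle [OF i j] conjunct2 [OF cT]] cT by (simp add: A_def)
    then show ?thesis by (simp only: bit_add_eq_0)
  qed
  show ?thesis
    by (intro exI [of _ A] conjI nk ballI allI impI) (rule rank)
qed

end

section \<open>Rank and Betti number\<close>

text \<open>The chains \<open>lift (z P)\<close> represent classes in the quotient of integral
  chains, and \<open>rho\<close> turns a trivial product of these classes into a boundary relation
  between the \<open>z P\<close>, to which \<open>ind\<close> applies.\<close>

lemma card_le_mod2_betti:
  fixes z :: "'i \<Rightarrow> ((nat \<Rightarrow> real) \<Rightarrow> 'a::topological_space) z2"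
  assumes fin: "finite B" and z: "\<And>P. P \<in> B \<Longrightarrow> ch p M (z P) \<and> bd p (z P) = 0"
    and ind: "\<And>T d. T \<subseteq> B \<Longrightarrow> ch (Suc p) M d \<Longrightarrow> sum z T = bd (Suc p) d \<Longrightarrow> T = {}"
  shows "enat (card B) \<le> mod2_betti p M"
proof -
  let ?X = "top_of_set M"
  let ?Z = "subgroup_generated (chain_group p ?X) (mod2_cycles p ?X)"
  let ?B = "mod2_boundaries p ?X"
  define G where "G = mod2_homology_group p ?X"
  define q where "q c = ?B #>\<^bsub>?Z\<^esub> c" for c
  interpret Z: comm_group ?Z
    by (intro group.abelian_subgroup_generated group_chain_group)
       (auto simp: abelian_chain_group mod2_cycles_def)
  interpret G: comm_group G
    unfolding G_def by (rule comm_group_mod2_homology_group)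
  have B: "subgroup ?B ?Z"
    by (simp add: group.subgroup_of_subgroup_generated mod2_boundaries_subgroup mod2_boundaries_subset)
  then have N: "?B \<lhd> ?Z"
    by (simp add: Z.normal_iff_subgroup)
  have carrier_Z: "carrier ?Z = mod2_cycles p ?X"
    by (simp add: subgroup.carrier_subgroup_generated_subgroup mod2_cycles_subgroup)
  have qG: "q c \<in> carrier G" if "c \<in> mod2_cycles p ?X" for c
    unfolding q_def G_def mod2_homology_group_def carrier_FactGroup carrier_Z by (rule imageI [OF that])
  have q_add: "q a \<otimes>\<^bsub>G\<^esub> q b = q (a + b)" if "a \<in> mod2_cycles p ?X" "b \<in> mod2_cycles p ?X" for a b
    using normal.rcos_sum [OF N, of a b] that by (simp add: carrier_Z q_def G_def mod2_homology_group_def)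
  have one: "\<one>\<^bsub>G\<^esub> = ?B"
    by (simp add: G_def mod2_homology_group_def)
  have q0: "q 0 = \<one>\<^bsub>G\<^esub>"
    using Z.coset_mult_one [OF subgroup.subset [OF B]] by (simp add: q_def one)
  have q1: "c \<in> ?B" if "q c = \<one>\<^bsub>G\<^esub>" "c \<in> mod2_cycles p ?X" for c
    using that Z.coset_join1 [OF _ _ B, of c] subgroup.subset [OF B] unfolding q_def one carrier_Z by blast
  have zc: "lift (z P) \<in> mod2_cycles p ?X" if P: "P \<in> B" for P
  proof -
    have "rho (chain_boundary p (lift (z P))) = 0"
      using z [OF P] by (simp add: rho_boundary)
    then obtain e where "chain_boundary p (lift (z P)) = frag_cmul 2 e"
      by (rule rho_eq_0_imp)
    then show ?thesis
      using z [OF P] unfolding mod2_cycles_def by (auto simp: ch_lift)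
  qed
  have fp: "(\<Sum>P\<in>T. lift (z P)) \<in> mod2_cycles p ?X \<and> finprod G (\<lambda>P. q (lift (z P))) T = q (\<Sum>P\<in>T. lift (z P))"
    if T: "T \<subseteq> B" for T
    using finite_subset [OF T fin] T
  proof (induction T rule: finite_induct)
    case empty
    show ?case using subgroup.one_closed [OF mod2_cycles_subgroup [of p ?X]] by (simp add: q0)
  next
    case (insert P T)
    then have IH: "(\<Sum>P\<in>T. lift (z P)) \<in> mod2_cycles p ?X" "finprod G (\<lambda>P. q (lift (z P))) T = q (\<Sum>P\<in>T. lift (z P))"
      and P: "P \<in> B" and TB: "T \<subseteq> B" by auto
    have "(\<lambda>P. q (lift (z P))) \<in> T \<rightarrow> carrier G" using TB zc qG by blast
    then have "finprod G (\<lambda>P. q (lift (z P))) (insert P T) = q (lift (z P)) \<otimes>\<^bsub>G\<^esub> q (\<Sum>P\<in>T. lift (z P))"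
      using insert.hyps IH P zc qG by (simp add: G.finprod_insert)
    moreover have "lift (z P) + (\<Sum>P\<in>T. lift (z P)) \<in> mod2_cycles p ?X"
      using subgroup.m_closed [OF mod2_cycles_subgroup zc [OF P] IH(1)] by simp
    ultimately show ?case
      using insert.hyps q_add [OF zc [OF P] IH(1)] by simp
  qed
  have triv: "T = {}" if T: "T \<subseteq> B" and f: "finprod G (\<lambda>P. q (lift (z P))) T = \<one>\<^bsub>G\<^esub>" for T
  proof -
    have "(\<Sum>P\<in>T. lift (z P)) \<in> ?B"
      using fp [OF T] f q1 by metis
    then obtain d e where "(\<Sum>P\<in>T. lift (z P)) = chain_boundary (Suc p) d + frag_cmul 2 e" and d: "singular_chain (Suc p) ?X d"
      unfolding mod2_boundaries_def by auto
    then have "rho (\<Sum>P\<in>T. lift (z P)) = rho (chain_boundary (Suc p) d + frag_cmul 2 e)" by simp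
    then have "sum z T = bd (Suc p) (rho d)"
      by (simp add: rho_sum rho_add rho_cmul rho_boundary)
    then show ?thesis by (rule ind [OF T ch_rho [OF d]])
  qed
  \<comment> \<open>If two of the classes coincided, their product would be trivial in a group of
    exponent 2, against independence.\<close>
  have inj: "inj_on (\<lambda>P. q (lift (z P))) B"
  proof (rule inj_onI, rule ccontr)
    fix P Q assume P: "P \<in> B" and Q: "Q \<in> B" and eq: "q (lift (z P)) = q (lift (z Q))" and ne: "P \<noteq> Q"
    have "finprod G (\<lambda>P. q (lift (z P))) {P, Q} = q (lift (z P)) \<otimes>\<^bsub>G\<^esub> q (lift (z Q))"
      using ne qG [OF zc [OF P]] qG [OF zc [OF Q]] by (simp add: G.finprod_insert)
    also have "\<dots> = \<one>\<^bsub>G\<^esub>"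
      unfolding eq using qG [OF zc [OF Q]] unfolding G_def by (rule mod2_homology_group_exponent_2)
    finally show False using triv [of "{P, Q}"] P Q by blast
  qed
  let ?S = "(\<lambda>P. q (lift (z P))) ` B"
  have "T = {}" if T: "T \<subseteq> ?S" and f: "finprod G (\<lambda>x. x) T = \<one>\<^bsub>G\<^esub>" for T
  proof -
    obtain T' where T': "T' \<subseteq> B" "T = (\<lambda>P. q (lift (z P))) ` T'"
      using T unfolding subset_image_iff by blast
    have "finprod G (\<lambda>x. x) T = finprod G (\<lambda>P. q (lift (z P))) T'"
      unfolding T'(2)
    proof (rule G.finprod_reindex)
      show "(\<lambda>x. x) \<in> (\<lambda>P. q (lift (z P))) ` T' \<rightarrow> carrier G" using T'(1) zc qG by blast
      show "inj_on (\<lambda>P. q (lift (z P))) T'" by (rule inj_on_subset [OF inj T'(1)])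
    qed
    then show ?thesis using triv [OF T'(1)] f T'(2) by simp
  qed
  moreover have "?S \<subseteq> carrier G" using zc qG by blast
  ultimately have "enat (card ?S) \<le> mod2_dim G"
    unfolding mod2_dim_def using fin by (intro Sup_upper) blast
  then show ?thesis
    using card_image [OF inj] by (simp add: mod2_betti_def G_def)
qed

lemma matrix_rank_le:
  fixes A :: "'i \<Rightarrow> 'i \<Rightarrow> 'f::field"
  assumes I: "finite I" "B \<subseteq> I" and A: "\<And>j. j \<in> I \<Longrightarrow> \<exists>T\<subseteq>B. \<forall>i\<in>I. A i j = (\<Sum>q\<in>T. A i q)"
  shows "matrix_rank I A \<le> card B"
proof -
  interpret vs: vector_space "\<lambda>(c::'f) (u::'i \<Rightarrow> 'f) i. c * u i" by (rule vector_space_fun)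
  let ?c = "\<lambda>j i. if i \<in> I then A i j else 0"
  have fin: "finite B" by (rule finite_subset [OF I(2,1)])
  have fsum: "(\<Sum>q\<in>T. g q) i = (\<Sum>q\<in>T. g q i)" for T and g :: "'i \<Rightarrow> 'i \<Rightarrow> 'f" and i
    by (induction T rule: infinite_finite_induct) simp_all
  have "?c j \<in> vs.span (?c ` B)" if j: "j \<in> I" for j
  proof -
    obtain T where T: "T \<subseteq> B" "\<forall>i\<in>I. A i j = (\<Sum>q\<in>T. A i q)"
      using A [OF j] by blast
    have "?c j = (\<Sum>q\<in>T. ?c q)"
      using T by (auto simp: fun_eq_iff fsum)
    also have "\<dots> \<in> vs.span (?c ` B)"
      using T(1) by (intro vs.span_sum vs.span_base) blast
    finally show ?thesis .
  qed
  then have "vs.dim (?c ` I) \<le> card (?c ` B)"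
    using fin by (intro vs.dim_le_card) auto
  also have "\<dots> \<le> card B" by (rule card_image_le [OF fin])
  finally show ?thesis by (simp add: matrix_rank_def)
qed

text \<open>A nonempty manifold provides a \<open>p\<close>-simplex in its ambient space, so
  \<open>p\<close> is at most the dimension of that space and there are enough basis
  vectors.\<close>

lemma manifold_frame:
  fixes M :: "'a::euclidean_space set"
  assumes M: "pl_manifold p M" and x: "x \<in> M"
  obtains bs :: "'a list" where "frame bs" "length bs = p"
proof -
  obtain S :: "'a set" where "int p simplex S"
    using M x unfolding pl_manifold_def by meson
  then have "int p \<le> int (DIM('a))"
    using aff_dim_le_DIM [of S] by (simp add: aff_dim_simplex)
  then obtain B :: "'a set" where B: "B \<subseteq> Basis" "card B = p" "finite B"
    using obtain_subset_with_card_n [of p Basis] by auto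
  then obtain bs where "set bs = B" "distinct bs"
    using finite_distinct_list by blast
  then show thesis
    using B by (intro that [of bs]) (auto simp: frame_def distinct_card [symmetric])
qed

section \<open>Charts of a PL manifold\<close>

context frame
begin

lemma aff_dim_S: "aff_dim S = int m"
proof -
  have "0 \<in> V \<inter> interior (cball 0 1)" by (simp add: span_zero)
  then have "aff_dim (V \<inter> cball 0 1) = aff_dim V"
    by (intro aff_dim_convex_Int_nonempty_interior) (auto intro: subspace_imp_convex)
  moreover have "dim V = m"
    using basis dist independent_mono [OF independent_Basis basis] by (simp add: dim_eq_card_independent distinct_card)
  ultimately show ?thesis
    by (simp add: aff_dim_subspace Int_commute)
qed

lemma chart_subset: "chart M U \<phi> \<psi> \<Longrightarrow> U \<subseteq> M' \<Longrightarrow> M' \<subseteq> M \<Longrightarrow> chart M' U \<phi> \<psi>"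
  unfolding chart_def using openin_subset_trans by blast

text \<open>Compact convex sets of equal dimension are homeomorphic, so the simplex in the
  definition of a manifold can be replaced by the ball \<open>S\<close>. The set \<open>U\<close> is
  open in the neighbourhood \<open>N\<close>, hence its image is open in \<open>S\<close> even at
  boundary points.\<close>

lemma manifold_chart:
  fixes M :: "'b::euclidean_space set"
  assumes M: "pl_manifold m M" and x: "x \<in> M"
  obtains U \<phi> \<psi> where "x \<in> U" "chart M U \<phi> \<psi>"
proof -
  obtain U N and T :: "'b set" where U: "openin (top_of_set M) U" "x \<in> U" "U \<subseteq> N" "N \<subseteq> M"
    and T: "int m simplex T" and "pl_homeomorphic N T"
    using M x unfolding pl_manifold_def by meson
  then obtain h g where h: "homeomorphism N T h g"
    unfolding pl_homeomorphic_def by blast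
  have "T homeomorphic S"
    using T convex_S compact_S by (intro homeomorphic_convex_compact_sets)
      (auto simp: aff_dim_S aff_dim_simplex convex_simplex compact_simplex)
  then obtain a b where "homeomorphism T S a b"
    unfolding homeomorphic_def by blast
  with h have hom: "homeomorphism N S (a \<circ> h) (g \<circ> b)"
    by (rule homeomorphism_compose)
  have "openin (top_of_set N) U" by (rule openin_subset_trans [OF U(1,3,4)])
  then have "openin (top_of_set S) ((a \<circ> h) ` U)"
    by (rule homeomorphism_imp_open_map [OF hom])
  moreover have "homeomorphism U ((a \<circ> h) ` U) (a \<circ> h) (g \<circ> b)"
    by (rule homeomorphism_of_subsets [OF hom U(3) order_refl refl])
  ultimately have "chart M U (a \<circ> h) (g \<circ> b)"
    unfolding chart_def using U(1) by blast
  with U(2) show thesis by (rule that)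
qed

end

context embedding
begin

text \<open>\<open>B\<close> indexes a maximal family of cycles that is independent in the homology
  of \<open>M\<close> itself, which bounds \<open>card B\<close>. The matrix is made over a smaller
  \<open>M0\<close>, whose Betti number may be larger; but every column relation rests on a bounding
  chain \<open>d j\<close>, and \<open>M0\<close> is chosen to contain these.\<close>

theorem low_rank_matrix:
  assumes M: "pl_manifold m M"
  shows "\<exists>A. nk_matrix n k A \<and> enat (matrix_rank (octahedra n k) A) \<le> mod2_betti k M"
proof -
  let ?O = "octahedra n k"
  define ind where "ind B \<longleftrightarrow> B \<subseteq> ?O \<and>
    (\<forall>T d. T \<subseteq> B \<longrightarrow> ch (Suc k) M d \<longrightarrow> (\<Sum>P\<in>T. oct_cycle P) = bd (Suc k) d \<longrightarrow> T = {})" for B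
  have "finite {B. ind B}"
    by (rule finite_subset [OF _ finite_Pow_iff [THEN iffD2, OF finite_octahedra [of n k]]]) (auto simp: ind_def)
  moreover have "ind {}" by (simp add: ind_def)
  ultimately obtain B where B: "ind B" and maxB: "\<And>B'. ind B' \<Longrightarrow> B \<subseteq> B' \<Longrightarrow> B = B'"
    using finite_has_maximal [of "{B. ind B}"] by auto
  have BO: "B \<subseteq> ?O" using B by (simp add: ind_def)
  have BI: "T = {}" if "T \<subseteq> B" "ch (Suc k) M d" "(\<Sum>P\<in>T. oct_cycle P) = bd (Suc k) d" for T d
    using B that unfolding ind_def by blast
  have "\<exists>T d. T \<subseteq> B \<and> ch (Suc k) M d \<and> oct_cycle j + (\<Sum>q\<in>T. oct_cycle q) = bd (Suc k) d" if j: "j \<in> ?O" for j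
  proof (cases "j \<in> B")
    case True
    \<comment> \<open>A cycle of the family is related to itself, since its double is 0 mod
      2.\<close>
    then show ?thesis by (intro exI [of _ "{j}"] exI [of _ 0]) simp
  next
    case False
    then have "\<not> ind (insert j B)" using maxB [of "insert j B"] by blast
    then obtain T d where T: "T \<subseteq> insert j B" "ch (Suc k) M d" "(\<Sum>P\<in>T. oct_cycle P) = bd (Suc k) d" "T \<noteq> {}"
      using j BO unfolding ind_def by blast
    have "j \<in> T"
    proof (rule ccontr)
      assume "j \<notin> T"
      then have "T \<subseteq> B" using T(1) by blast
      from BI [OF this T(2,3)] T(4) show False by blast
    qed
    moreover have "finite T"
      using T(1) BO finite_octahedra [of n k] by (meson finite_insert finite_subset)
    ultimately have "(\<Sum>P\<in>T. oct_cycle P) = oct_cycle j + (\<Sum>q\<in>T - {j}. oct_cycle q)"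
      by (intro sum.remove)
    moreover have "T - {j} \<subseteq> B" using T(1) by blast
    ultimately show ?thesis using T(2,3) by metis
  qed
  then obtain T d where Td: "\<And>j. j \<in> ?O \<Longrightarrow> T j \<subseteq> B \<and> ch (Suc k) M (d j) \<and> oct_cycle j + (\<Sum>q\<in>T j. oct_cycle q) = bd (Suc k) (d j)"
    by metis
  then have "\<exists>K. compact K \<and> K \<subseteq> M \<and> ch (Suc k) K (d j)" if "j \<in> ?O" for j
    using ch_compact_support that by metis
  then obtain K where K: "\<And>j. j \<in> ?O \<Longrightarrow> compact (K j) \<and> K j \<subseteq> M \<and> ch (Suc k) (K j) (d j)"
    by metis
  \<comment> \<open>\<open>C\<close> collects the image of the complex and the supports of the
    bounding chains; a finite cover of it by charts defines \<open>M0\<close>.\<close>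
  define C where "C = f ` complex_body \<union> (\<Union>j\<in>?O. K j)"
  have cC: "compact C"
    unfolding C_def using K finite_octahedra
    by (intro compact_Un compact_UN compact_continuous_image [OF cont_f compact_body]) blast+
  have CM: "C \<subseteq> M" using K f_M by (auto simp: C_def)
  have "\<exists>U \<phi> \<psi>. x \<in> U \<and> chart M U \<phi> \<psi>" if "x \<in> M" for x
    by (rule manifold_chart [OF M that]) blast
  then obtain U \<phi> \<psi> where U: "\<And>x. x \<in> M \<Longrightarrow> x \<in> U x \<and> chart M (U x) (\<phi> x) (\<psi> x)"
    by metis
  then have "\<exists>W. open W \<and> U x = M \<inter> W" if "x \<in> M" for x
    using chartD(1) that unfolding openin_open by metis
  then obtain W where W: "\<And>x. x \<in> M \<Longrightarrow> open (W x) \<and> U x = M \<inter> W x"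
    by metis
  have cover: "C \<subseteq> (\<Union>x\<in>M. W x)" using CM U W by blast
  obtain X where X: "X \<subseteq> M" "finite X" "C \<subseteq> (\<Union>x\<in>X. W x)"
    by (rule compactE_image [OF cC _ cover]) (use W in blast)+
  obtain xs where xs: "set xs = X" using X(2) finite_list by blast
  define M0 where "M0 = (\<Union>x\<in>X. U x)"
  have M0: "M0 = M \<inter> (\<Union>x\<in>X. W x)"
    unfolding M0_def Int_UN_distrib by (rule SUP_cong [OF refl]) (use W X(1) in blast)
  have CM0: "C \<subseteq> M0" and M0M: "M0 \<subseteq> M"
    using CM X(3) unfolding M0 by auto
  interpret charted: charted_embedding bs n k v f M0 "length xs" "\<lambda>i. U (xs ! i)" "\<lambda>i. \<phi> (xs ! i)" "\<lambda>i. \<psi> (xs ! i)"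
  proof unfold_locales
    show "f ` complex_body \<subseteq> M0" using CM0 by (auto simp: C_def)
    show "chart M0 (U (xs ! i)) (\<phi> (xs ! i)) (\<psi> (xs ! i))" if "i < length xs" for i
    proof -
      have "xs ! i \<in> X" using that xs nth_mem by blast
      then show ?thesis
        using U X(1) by (intro chart_subset [OF _ _ M0M]) (auto simp: M0_def)
    qed
    show "M0 = (\<Union>i<length xs. U (xs ! i))"
      unfolding M0_def xs [symmetric] set_conv_nth by blast
  qed (rule cont_f inj_f)+
  obtain A where A: "nk_matrix n k A"
    and AT: "\<forall>j\<in>?O. \<forall>T\<subseteq>?O. \<forall>d. ch (Suc k) M0 d \<longrightarrow> oct_cycle j + (\<Sum>q\<in>T. oct_cycle q) = bd (Suc k) d \<longrightarrow>
      (\<forall>i\<in>?O. A i j = (\<Sum>q\<in>T. A i q))"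
    using charted.matrix_exists by (elim exE conjE) (rule that)
  have "matrix_rank ?O A \<le> card B"
  proof (rule matrix_rank_le [OF finite_octahedra BO])
    fix j assume j: "j \<in> ?O"
    have "T j \<subseteq> ?O" using Td [OF j] BO by blast
    moreover have "ch (Suc k) M0 (d j)"
      using K [OF j] by (rule ch_mono [OF conjunct2 [OF conjunct2]]) (use CM0 j in \<open>auto simp: C_def\<close>)
    ultimately have "\<forall>i\<in>?O. A i j = (\<Sum>q\<in>T j. A i q)"
      using AT j Td [OF j] by blast
    then show "\<exists>T\<subseteq>B. \<forall>i\<in>?O. A i j = (\<Sum>q\<in>T. A i q)"
      using Td [OF j] by blast
  qed
  moreover have "enat (card B) \<le> mod2_betti k M"
  proof (rule card_le_mod2_betti)
    show "finite B" by (rule finite_subset [OF BO finite_octahedra])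
    show "ch k M (oct_cycle P) \<and> bd k (oct_cycle P) = 0" if "P \<in> B" for P
      using subsetD [OF BO that] ch_oct_cycle(2) bd_oct_cycle by blast
  qed (rule BI)
  ultimately show ?thesis
    using A by (meson enat_ord_simps(1) order_trans)
qed

end

theorem theorem1p4:
  fixes k n :: nat
    and M :: "'a::euclidean_space set"
    and v :: "nat \<times> nat \<Rightarrow> 'b::euclidean_space"
    and f :: "'b \<Rightarrow> 'a"
  assumes "k \<ge> 1" and "n \<ge> 3"
    and "pl_manifold (2 * k) M"
    and "geometric_realization (join_power n k) v"
    and "pl_embedding f (body (join_power n k) v) M"
  shows "\<exists>A. nk_matrix n k A \<and> enat (matrix_rank (octahedra n k) A) \<le> mod2_betti k M"
proof -
  interpret realization n k v
    using assms(2,4) by unfold_locales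
  have fM: "f ` body (join_power n k) v \<subseteq> M" and cont: "continuous_on (body (join_power n k) v) f"
    using assms(5) unfolding pl_embedding_def pl_map_def by simp_all
  obtain g where fg: "homeomorphism (body (join_power n k) v) (f ` body (join_power n k) v) f g"
    using assms(5) unfolding pl_embedding_def by (elim conjE exE) (rule that)
  \<comment> \<open>The apex shows that \<open>M\<close> is nonempty, as
    \<open>manifold_frame\<close> requires.\<close>
  have "f apex \<in> M" using fM apex_in_star star_subset_body by blast
  then obtain bs :: "'a list" where bs: "frame bs" "length bs = 2 * k"
    by (rule manifold_frame [OF assms(3)])
  interpret frame bs by (rule bs(1))
  interpret embedding bs n k v f M
  proof unfold_locales
    show "inj_on f (body (join_power n k) v)"
      using fg by (metis homeomorphism_def inj_on_inverseI)
  qed (rule assms(1) bs(2) fM cont)+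
  show ?thesis
    by (rule low_rank_matrix) (simp add: bs(2) assms(3))
qed

end
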